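(* Let $E$, $\Delta_E(z)=\lambda_0z+\mathbf c_0+\sum_{j=1}^g\frac{\lambda_j}{\mathbf c_j-z}$ and $\mathbf C=\{\mathbf c_1,\dots,\mathbf c_g\}$ be as in the context. A matrix $\mathring A\in\mathrm{GMP}(\mathbf C)$ belongs to the isospectral set $A(E,\mathbf C)$ if and only if $$\Delta_E(\mathring A)=S^{g+1}+S^{-(g+1)} .$$ Moreover, the isospectral surface $\mathcal{IS}_E$, i.e. the set of all $\vec{\mathbf p}=(\vec p,\vec q)\in\mathbb R^{2g+2}$ with $p_g>0$ such that the block-periodic matrix generated by $\vec{\mathbf p}_j=\vec{\mathbf p}$, $j\in\mathbb Z$, belongs to $A(E,\mathbf C)$, is given by the equations $$p_g=\frac1{\lambda_0},\qquad q_g=-\mathbf c_0-\lambda_0\sum_{j=0}^{g-1}p_jq_j,\qquad \Lambda_k(\vec{\mathbf p})=\lambda_k,\quad k=1,\dots,g.$$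
   Context: The set $E$ and the function $\Delta_E$: $g\ge1$, $E=[\mathbf b_0,\mathbf a_0]\setminus\bigcup_{j=1}^g(\mathbf a_j,\mathbf b_j)$, where the gaps $(\mathbf a_j,\mathbf b_j)$ are nonempty with pairwise disjoint closures contained in $(\mathbf b_0,\mathbf a_0)$ (labelled in any fixed order). $\Delta_E$ is the unique rational function with $\Delta_E(\infty)=\infty$, $\mathrm{Im}\,\Delta_E(z)>0$ for $\mathrm{Im}\, z>0$ and $\Delta_E^{-1}([-2,2])=E$; it has the form $\lambda_0z+\mathbf c_0+\sum_{j=1}^g\frac{\lambda_j}{\mathbf c_j-z}$ with $\lambda_j>0$ ($j\ge0$) and $\mathbf c_j\in(\mathbf a_j,\mathbf b_j)$ ($j\ge1$). $\mathbf C=\{\mathbf c_1,\dots,\mathbf c_g\}$ is the corresponding ordered collection. GMP matrices: $\{e_n\}_{n\in\mathbb Z}$ is the standard basis of $\ell^2=\ell^2(\mathbb Z)$, $Se_n=e_{n+1}$; $\delta_0,\dots,\delta_g$ is the standard basis of $\mathbb C^{g+1}$. For a square matrix $T$, $T^-$ is its strictly upper triangular part and $T^+=T-T^-$. For an ordered collection $\mathbf C$ of $g$ distinct real points, a bounded operator $A$ on $\ell^2$ is of class $\mathbb A(\mathbf C)$ if it is block tridiagonal with $(g+1)\times(g+1)$ blocks (block $j$ occupying indices $j(g+1),\dots,j(g+1)+g$), with $(j,j)$ block $B(\vec{\mathbf p}_j)$, $(j-1,j)$ block $A(\vec p_j)$, $(j,j-1)$ block $A(\vec p_j)^*$, where $\vec{\mathbf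 p}_j=(\vec p_j,\vec q_j)\in\mathbb R^{2g+2}$, $\vec p_j=(p_0^{(j)},\dots,p_g^{(j)})^*$, $p^{(j)}_g>0$, and $$A(\vec p)=\delta_g\vec p^{\,*},\qquad B(\vec{\mathbf p})=(\vec q\,\vec p^{\,*})^-+(\vec p\,\vec q^{\,*})^++\mathrm{diag}(\mathbf c_1,\dots,\mathbf c_g,0).$$ One says that $A$ is generated by $\{\vec{\mathbf p}_j\}$. $A\in\mathbb A(\mathbf C)$ belongs to $\mathrm{GMP}(\mathbf C)$ if for every $k=1,\dots,g$ the operator $\mathbf c_k-A$ is boundedly invertible and $S^{-k}(\mathbf c_k-A)^{-1}S^k$ is again of class $\mathbb A(\mathbf C_k)$ for some ordered collection $\mathbf C_k$ of $g$ distinct real points. The isospectral set: $A(E,\mathbf C)$ is the set of all $\mathring A\in\mathrm{GMP}(\mathbf C)$ that are periodic, i.e. $\vec{\mathbf p}_j=\vec{\mathbf p}$ for all $j\in\mathbb Z$ (equivalently $S^{-(g+1)}\mathring AS^{g+1}=\mathring A$), and whose spectrum equals $E$. The functions $\Lambda_k$: let $\mathfrak j=\begin{bmatrix}0&-1\\ 1&0\end{bmatrix}$, $\mathbf p_j=\begin{bmatrix}p_j\\ q_j\end{bmatrix}$, and $$\mathfrak a(z,\mathbf c;\mathbf p)=I-\frac1{\mathbf c-z}\mathbf p\mathbf p^*\mathfrak j,\qquad \mathfrak a(z;\mathbf p)=\begin{bmatrix}0&-p\\ \frac1p&\frac{z-pq}{p}\end{bmatrix}\quad\text{for }\mathbf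 p=\begin{bmatrix}p\\ q\end{bmatrix}.$$ Then $$\Lambda_k(\vec{\mathbf p})=-\mathrm{tr}\Big\{\prod_{j=0}^{k-2}\mathfrak a(\mathbf c_k,\mathbf c_{j+1};\mathbf p_j)\;\mathbf p_{k-1}\mathbf p_{k-1}^*\mathfrak j\;\prod_{j=k}^{g-1}\mathfrak a(\mathbf c_k,\mathbf c_{j+1};\mathbf p_j)\;\mathfrak a(\mathbf c_k;\mathbf p_g)\Big\},$$ products being ordered from left to right with increasing index. *)

theory Defs
  imports "HOL-Analysis.Analysis" "HOL-Computational_Algebra.Polynomial_Factorial"
begin

section \<open>The Hilbert space of square summable two-sided complex sequences\<close>

lemma sq_summable_add:
  fixes x y :: "int \<Rightarrow> complex"
  assumes x: "(\<lambda>n. (cmod (x n))\<^sup>2) summable_on UNIV"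
    and y: "(\<lambda>n. (cmod (y n))\<^sup>2) summable_on UNIV"
  shows "(\<lambda>n. (cmod (x n + y n))\<^sup>2) summable_on UNIV"
    and "sqrt (\<Sum>\<^sub>\<infinity>n. (cmod (x n + y n))\<^sup>2)
          \<le> sqrt (\<Sum>\<^sub>\<infinity>n. (cmod (x n))\<^sup>2) + sqrt (\<Sum>\<^sub>\<infinity>n. (cmod (y n))\<^sup>2)"
proof -
  define X where "X = sqrt (\<Sum>\<^sub>\<infinity>n. (cmod (x n))\<^sup>2)"
  define Y where "Y = sqrt (\<Sum>\<^sub>\<infinity>n. (cmod (y n))\<^sup>2)"
  have nonneg: "0 \<le> X" "0 \<le> Y" by (simp_all add: X_def Y_def infsum_nonneg)
  have bound: "(\<Sum>n\<in>F. (cmod (x n + y n))\<^sup>2) \<le> (X + Y)\<^sup>2" if F: "finite F" for F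
  proof -
    have "L2_set (\<lambda>n. cmod (x n + y n)) F \<le> L2_set (\<lambda>n. cmod (x n) + cmod (y n)) F"
      by (rule L2_set_mono) (auto intro: norm_triangle_ineq)
    also have "\<dots> \<le> L2_set (\<lambda>n. cmod (x n)) F + L2_set (\<lambda>n. cmod (y n)) F"
      by (rule L2_set_triangle_ineq)
    also have "\<dots> \<le> X + Y"
      unfolding L2_set_def X_def Y_def
      by (intro add_mono real_sqrt_le_mono finite_sum_le_infsum x y F) auto
    finally have "(L2_set (\<lambda>n. cmod (x n + y n)) F)\<^sup>2 \<le> (X + Y)\<^sup>2"
      by (intro power_mono) auto
    then show ?thesis by (simp add: L2_set_def sum_nonneg)
  qed
  show s: "(\<lambda>n. (cmod (x n + y n))\<^sup>2) summable_on UNIV"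
    by (rule nonneg_bdd_above_summable_on) (auto intro!: bdd_aboveI2 bound)
  have "(\<Sum>\<^sub>\<infinity>n. (cmod (x n + y n))\<^sup>2) \<le> (X + Y)\<^sup>2"
    by (rule infsum_le_finite_sums[OF s]) (auto intro: bound)
  then show "sqrt (\<Sum>\<^sub>\<infinity>n. (cmod (x n + y n))\<^sup>2)
          \<le> sqrt (\<Sum>\<^sub>\<infinity>n. (cmod (x n))\<^sup>2) + sqrt (\<Sum>\<^sub>\<infinity>n. (cmod (y n))\<^sup>2)"
    using nonneg by (fold X_def Y_def) (metis add_nonneg_nonneg real_le_lsqrt)
qed

lemma sq_summable_mult:
  fixes x :: "int \<Rightarrow> complex"
  assumes "(\<lambda>n. (cmod (x n))\<^sup>2) summable_on UNIV"
  shows "(\<lambda>n. (cmod (c * x n))\<^sup>2) summable_on UNIV"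
  using summable_on_cmult_right[OF assms, of "(cmod c)\<^sup>2"]
  by (simp add: norm_mult power_mult_distrib)

typedef ell2 = "{x :: int \<Rightarrow> complex. (\<lambda>n. (cmod (x n))\<^sup>2) summable_on UNIV}"
  by (rule exI[of _ "\<lambda>_. 0"]) simp

setup_lifting type_definition_ell2

lift_definition scaleC :: "complex \<Rightarrow> ell2 \<Rightarrow> ell2" (infixr "*\<^sub>C" 75)
  is "\<lambda>c x n. c * x n"
  by (rule sq_summable_mult)

instantiation ell2 :: real_normed_vector
begin

lift_definition zero_ell2 :: ell2 is "\<lambda>_. 0" by simp
lift_definition plus_ell2 :: "ell2 \<Rightarrow> ell2 \<Rightarrow> ell2" is "\<lambda>x y n. x n + y n"
  by (rule sq_summable_add)
lift_definition uminus_ell2 :: "ell2 \<Rightarrow> ell2" is "\<lambda>x n. - x n" by simp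
lift_definition minus_ell2 :: "ell2 \<Rightarrow> ell2 \<Rightarrow> ell2" is "\<lambda>x y n. x n - y n"
  using sq_summable_add(1)[of _ "\<lambda>n. - y n" for y] by fastforce
definition scaleR_ell2 :: "real \<Rightarrow> ell2 \<Rightarrow> ell2" where "scaleR_ell2 r x = complex_of_real r *\<^sub>C x"
lift_definition norm_ell2 :: "ell2 \<Rightarrow> real" is "\<lambda>x. sqrt (\<Sum>\<^sub>\<infinity>n. (cmod (x n))\<^sup>2)" .
definition sgn_ell2 :: "ell2 \<Rightarrow> ell2" where "sgn_ell2 x = inverse (norm x) *\<^sub>R x"
definition dist_ell2 :: "ell2 \<Rightarrow> ell2 \<Rightarrow> real" where "dist_ell2 x y = norm (x - y)"
definition uniformity_ell2 :: "(ell2 \<times> ell2) filter" where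
  "uniformity_ell2 = (INF e\<in>{0<..}. principal {(x, y). dist x y < e})"
definition open_ell2 :: "ell2 set \<Rightarrow> bool" where
  "open_ell2 U = (\<forall>x\<in>U. \<forall>\<^sub>F (x', y) in uniformity. x' = x \<longrightarrow> y \<in> U)"

instance
proof
  fix x y z :: ell2 and r s :: real
  show "x + y + z = x + (y + z)" by transfer (simp add: add.assoc)
  show "x + y = y + x" by transfer (simp add: add.commute)
  show "0 + x = x" by transfer simp
  show "- x + x = 0" by transfer simp
  show "x - y = x + - y" by transfer simp
  show "r *\<^sub>R (x + y) = r *\<^sub>R x + r *\<^sub>R y"
    unfolding scaleR_ell2_def by transfer (simp add: distrib_left)
  show "(r + s) *\<^sub>R x = r *\<^sub>R x + s *\<^sub>R x"
    unfolding scaleR_ell2_def by transfer (simp add: distrib_right)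
  show "r *\<^sub>R s *\<^sub>R x = (r * s) *\<^sub>R x"
    unfolding scaleR_ell2_def by transfer (simp add: mult.assoc)
  show "1 *\<^sub>R x = x" unfolding scaleR_ell2_def by transfer simp
  show "sgn x = inverse (norm x) *\<^sub>R x" by (rule sgn_ell2_def)
  show "dist x y = norm (x - y)" by (rule dist_ell2_def)
  show "uniformity = (INF e\<in>{0<..}. principal {(x :: ell2, y). dist x y < e})"
    by (rule uniformity_ell2_def)
  show "open U = (\<forall>x\<in>U. \<forall>\<^sub>F (x', y) in uniformity. x' = x \<longrightarrow> y \<in> U)" for U :: "ell2 set"
    by (rule open_ell2_def)
  show "(norm x = 0) = (x = 0)"
  proof transfer
    fix x :: "int \<Rightarrow> complex" assume s: "(\<lambda>n. (cmod (x n))\<^sup>2) summable_on UNIV"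
    show "(sqrt (\<Sum>\<^sub>\<infinity>n. (cmod (x n))\<^sup>2) = 0) = (x = (\<lambda>_. 0))"
    proof
      assume "sqrt (\<Sum>\<^sub>\<infinity>n. (cmod (x n))\<^sup>2) = 0"
      then have 0: "(\<Sum>\<^sub>\<infinity>n. (cmod (x n))\<^sup>2) = 0" by (rule real_sqrt_eq_zero_cancel_iff[THEN iffD1])
      have "x n = 0" for n
      proof -
        have "(\<Sum>m\<in>{n}. (cmod (x m))\<^sup>2) \<le> (\<Sum>\<^sub>\<infinity>m. (cmod (x m))\<^sup>2)"
          by (rule finite_sum_le_infsum[OF s]) auto
        then show ?thesis unfolding 0 by simp
      qed
      then show "x = (\<lambda>_. 0)" by (rule ext)
    next
      assume "x = (\<lambda>_. 0)"
      then show "sqrt (\<Sum>\<^sub>\<infinity>n. (cmod (x n))\<^sup>2) = 0" by simp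
    qed
  qed
  show "norm (x + y) \<le> norm x + norm y" by transfer (rule sq_summable_add(2))
  show "norm (r *\<^sub>R x) = \<bar>r\<bar> * norm x"
    unfolding scaleR_ell2_def
    by transfer (simp add: norm_mult power_mult_distrib infsum_cmult_right' real_sqrt_mult)
qed

end

lift_definition basis_vec :: "int \<Rightarrow> ell2" is "\<lambda>n m. if m = n then 1 else 0"
proof -
  fix n :: int
  have "(\<lambda>m. (cmod (if m = n then 1 else 0))\<^sup>2) summable_on {n}" by simp
  then show "(\<lambda>m. (cmod (if m = n then 1 else 0))\<^sup>2) summable_on UNIV"
    by (rule summable_on_cong_neutral[THEN iffD1, rotated -1]) auto
qed

lift_definition shift_op :: "ell2 \<Rightarrow> ell2" is "\<lambda>x n. x (n - 1)"
proof -
  fix x :: "int \<Rightarrow> complex" assume "(\<lambda>n. (cmod (x n))\<^sup>2) summable_on UNIV"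
  moreover have "bij_betw (\<lambda>n :: int. n - 1) UNIV UNIV"
    by (rule bij_betwI[of _ _ _ "\<lambda>n. n + 1"]) auto
  ultimately show "(\<lambda>n. (cmod (x (n - 1)))\<^sup>2) summable_on UNIV"
    by (subst summable_on_reindex_bij_betw)
qed

lemma shift_op_basis_vec: "shift_op (basis_vec n) = basis_vec (n + 1)"
  by transfer (auto simp: fun_eq_iff)

section \<open>Bounded operators\<close>

definition bounded_op :: "(ell2 \<Rightarrow> ell2) \<Rightarrow> bool" where
  "bounded_op T \<longleftrightarrow> bounded_linear T \<and> (\<forall>c x. T (c *\<^sub>C x) = c *\<^sub>C T x)"

definition boundedly_invertible :: "(ell2 \<Rightarrow> ell2) \<Rightarrow> bool" where
  "boundedly_invertible T \<longleftrightarrow> (\<exists>R. bounded_op R \<and> R \<circ> T = id \<and> T \<circ> R = id)"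

definition spectrum :: "(ell2 \<Rightarrow> ell2) \<Rightarrow> complex set" where
  "spectrum T = {z. \<not> boundedly_invertible (\<lambda>x. z *\<^sub>C x - T x)}"

definition matrix_entry :: "(ell2 \<Rightarrow> ell2) \<Rightarrow> int \<Rightarrow> int \<Rightarrow> complex" where
  "matrix_entry T m n = Rep_ell2 (T (basis_vec n)) m"

section \<open>GMP matrices\<close>

text \<open>
  Vectors of length \<open>g + 1\<close> are functions on \<open>nat\<close> of which only the values at \<open>0, \<dots>, g\<close>
  matter, and similarly for matrices.  An ordered collection of \<open>g\<close> points is a function \<open>c\<close> of
  which the values \<open>c 1, \<dots>, c g\<close> matter; \<open>c 0\<close> is reserved for the additive constant of the
  rational function.
\<close>

definition outer :: "(nat \<Rightarrow> real) \<Rightarrow> (nat \<Rightarrow> real) \<Rightarrow> nat \<Rightarrow> nat \<Rightarrow> real" where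
  "outer u v = (\<lambda>r s. u r * v s)"

definition upper_part :: "(nat \<Rightarrow> nat \<Rightarrow> real) \<Rightarrow> nat \<Rightarrow> nat \<Rightarrow> real" where
  "upper_part T = (\<lambda>r s. if r < s then T r s else 0)"

definition lower_part :: "(nat \<Rightarrow> nat \<Rightarrow> real) \<Rightarrow> nat \<Rightarrow> nat \<Rightarrow> real" where
  "lower_part T = (\<lambda>r s. T r s - upper_part T r s)"

definition A_block :: "nat \<Rightarrow> (nat \<Rightarrow> real) \<Rightarrow> nat \<Rightarrow> nat \<Rightarrow> real" where
  "A_block g p = outer (\<lambda>r. if r = g then 1 else 0) p"

definition B_block ::
  "nat \<Rightarrow> (nat \<Rightarrow> real) \<Rightarrow> (nat \<Rightarrow> real) \<Rightarrow> (nat \<Rightarrow> real) \<Rightarrow> nat \<Rightarrow> nat \<Rightarrow> real" where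
  "B_block g c p q = (\<lambda>r s. upper_part (outer q p) r s + lower_part (outer p q) r s
     + (if r = s \<and> r < g then c (Suc r) else 0))"

text \<open>The entry in position \<open>(r, s)\<close> of the block in position \<open>(i, j)\<close>.\<close>

definition gmp_entry ::
  "nat \<Rightarrow> (nat \<Rightarrow> real) \<Rightarrow> (int \<Rightarrow> nat \<Rightarrow> real) \<Rightarrow> (int \<Rightarrow> nat \<Rightarrow> real) \<Rightarrow>
    int \<Rightarrow> nat \<Rightarrow> int \<Rightarrow> nat \<Rightarrow> real" where
  "gmp_entry g c p q i r j s =
    (if i = j then B_block g c (p j) (q j) r s
     else if i = j - 1 then A_block g (p j) r s
     else if i = j + 1 then A_block g (p i) s r
     else 0)"

definition generated_by ::
  "nat \<Rightarrow> (nat \<Rightarrow> real) \<Rightarrow> (int \<Rightarrow> nat \<Rightarrow> real) \<Rightarrow> (int \<Rightarrow> nat \<Rightarrow> real) \<Rightarrow> (ell2 \<Rightarrow> ell2) \<Rightarrow> bool"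
where
  "generated_by g c p q A \<longleftrightarrow> bounded_op A \<and> (\<forall>j. p j g > 0) \<and>
    (\<forall>i j. \<forall>r\<le>g. \<forall>s\<le>g.
      matrix_entry A (i * int (g + 1) + int r) (j * int (g + 1) + int s)
        = complex_of_real (gmp_entry g c p q i r j s))"

definition class_A :: "nat \<Rightarrow> (nat \<Rightarrow> real) \<Rightarrow> (ell2 \<Rightarrow> ell2) set" where
  "class_A g c = {A. inj_on c {1..g} \<and> (\<exists>p q. generated_by g c p q A)}"

definition shifted_minus :: "real \<Rightarrow> (ell2 \<Rightarrow> ell2) \<Rightarrow> ell2 \<Rightarrow> ell2" where
  "shifted_minus t A = (\<lambda>x. t *\<^sub>R x - A x)"

definition GMP :: "nat \<Rightarrow> (nat \<Rightarrow> real) \<Rightarrow> (ell2 \<Rightarrow> ell2) set" where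
  "GMP g c = {A \<in> class_A g c. \<forall>k\<in>{1..g}.
     boundedly_invertible (shifted_minus (c k) A) \<and>
     (\<exists>c'. (inv shift_op ^^ k) \<circ> inv (shifted_minus (c k) A) \<circ> (shift_op ^^ k) \<in> class_A g c')}"

section \<open>The set E and its rational function\<close>

definition gap_data :: "nat \<Rightarrow> (nat \<Rightarrow> real) \<Rightarrow> (nat \<Rightarrow> real) \<Rightarrow> bool" where
  "gap_data g a b \<longleftrightarrow> g \<ge> 1 \<and>
    (\<forall>j\<in>{1..g}. a j < b j \<and> {a j..b j} \<subseteq> {b 0<..<a 0}) \<and>
    disjoint_family_on (\<lambda>j. {a j..b j}) {1..g}"

definition finite_gap_set :: "nat \<Rightarrow> (nat \<Rightarrow> real) \<Rightarrow> (nat \<Rightarrow> real) \<Rightarrow> real set" where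
  "finite_gap_set g a b = {b 0..a 0} - (\<Union>j\<in>{1..g}. {a j<..<b j})"

text \<open>
  The rational function \<open>P / Q\<close>, in lowest terms, is the function \<open>\<Delta>\<close> of \<open>E\<close>.  The condition on
  the degrees is \<open>\<Delta>(\<infinity>) = \<infinity>\<close>; since division by zero is total, poles have to be excluded
  explicitly from the preimage of \<open>[-2, 2]\<close>.
\<close>

definition is_Delta :: "real set \<Rightarrow> complex poly \<Rightarrow> complex poly \<Rightarrow> bool" where
  "is_Delta E P Q \<longleftrightarrow> coprime P Q \<and> degree Q < degree P \<and>
    (\<forall>z. Im z > 0 \<longrightarrow> poly Q z \<noteq> 0 \<and> Im (poly P z / poly Q z) > 0) \<and>
    {z. poly Q z \<noteq> 0 \<and> poly P z / poly Q z \<in> complex_of_real ` {-2..2}} = complex_of_real ` E"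

definition pf_value :: "nat \<Rightarrow> (nat \<Rightarrow> real) \<Rightarrow> (nat \<Rightarrow> real) \<Rightarrow> complex \<Rightarrow> complex" where
  "pf_value g l c z = complex_of_real (l 0) * z + complex_of_real (c 0)
     + (\<Sum>j=1..g. complex_of_real (l j) / (complex_of_real (c j) - z))"

text \<open>
  The value of this rational function at an operator \<open>A\<close> for which all \<open>c j - A\<close> are boundedly
  invertible.
\<close>

definition pf_op ::
  "nat \<Rightarrow> (nat \<Rightarrow> real) \<Rightarrow> (nat \<Rightarrow> real) \<Rightarrow> (ell2 \<Rightarrow> ell2) \<Rightarrow> ell2 \<Rightarrow> ell2" where
  "pf_op g l c A = (\<lambda>x. l 0 *\<^sub>R A x + c 0 *\<^sub>R x
     + (\<Sum>j=1..g. l j *\<^sub>R inv (shifted_minus (c j) A) x))"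

section \<open>The isospectral set and surface\<close>

definition isospectral_set :: "nat \<Rightarrow> real set \<Rightarrow> (nat \<Rightarrow> real) \<Rightarrow> (ell2 \<Rightarrow> ell2) set" where
  "isospectral_set g E c = {A \<in> GMP g c.
     (\<exists>p q. generated_by g c (\<lambda>_. p) (\<lambda>_. q) A) \<and> spectrum A = complex_of_real ` E}"

definition isospectral_surface ::
  "nat \<Rightarrow> real set \<Rightarrow> (nat \<Rightarrow> real) \<Rightarrow> ((nat \<Rightarrow> real) \<times> (nat \<Rightarrow> real)) set" where
  "isospectral_surface g E c =
    {(p, q). p \<in> {..g} \<rightarrow>\<^sub>E UNIV \<and> q \<in> {..g} \<rightarrow>\<^sub>E UNIV \<and> p g > 0 \<and>
      (\<exists>A\<in>isospectral_set g E c. generated_by g c (\<lambda>_. p) (\<lambda>_. q) A)}"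

definition frak_j :: "real^2^2" where
  "frak_j = vector [vector [0, -1], vector [1, 0]]"

definition pp_j :: "real \<Rightarrow> real \<Rightarrow> real^2^2" where
  "pp_j p q = vector [vector [p * p, p * q], vector [q * p, q * q]] ** frak_j"

definition a_fin :: "real \<Rightarrow> real \<Rightarrow> real \<Rightarrow> real \<Rightarrow> real^2^2" where
  "a_fin z c p q = mat 1 - (1 / (c - z)) *\<^sub>R pp_j p q"

definition a_inf :: "real \<Rightarrow> real \<Rightarrow> real \<Rightarrow> real^2^2" where
  "a_inf z p q = vector [vector [0, - p], vector [1 / p, (z - p * q) / p]]"

definition mat_prod_list :: "(real^2^2) list \<Rightarrow> real^2^2" where
  "mat_prod_list Ms = foldr (**) Ms (mat 1)"

definition Lam ::
  "nat \<Rightarrow> (nat \<Rightarrow> real) \<Rightarrow> nat \<Rightarrow> (nat \<Rightarrow> real) \<Rightarrow> (nat \<Rightarrow> real) \<Rightarrow> real" where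
  "Lam g c k p q = - trace
     (mat_prod_list (map (\<lambda>j. a_fin (c k) (c (j + 1)) (p j) (q j)) [0..<k - 1])
      ** pp_j (p (k - 1)) (q (k - 1))
      ** mat_prod_list (map (\<lambda>j. a_fin (c k) (c (j + 1)) (p j) (q j)) [k..<g])
      ** a_inf (c k) (p g) (q g))"

end

theory Submission
  imports Defs
begin

text \<open>
  Put \<open>N = g + 1\<close> and \<open>T = S\<^sup>N + S\<^sup>-\<^sup>N\<close>.  The outermost diagonals (at distance \<open>N\<close>) of a periodic GMP
  matrix \<open>A\<close> and of its resolvents \<open>(c\<^sub>k - A)\<^sup>-\<^sup>1\<close> occupy the \<open>N\<close> different residue classes modulo
  \<open>N\<close>, and their entries are positive.  Hence some combination of these operators with positive
  coefficients has the outermost diagonals of \<open>T\<close>.  The difference \<open>X\<close> from \<open>T\<close> commutes with \<open>A\<close>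
  and with the resolvents, which forces its remaining diagonals to vanish one after the other, so that
  \<open>X\<close> is scalar and \<open>f(A) = T\<close> for a function \<open>f\<close> of the form of \<open>\<Delta>\<^sub>E\<close>.  Floquet solutions of
  \<open>A x = z x\<close> identify \<open>f\<close> with the trace of the monodromy matrix, whose partial fraction
  coefficients are the \<open>\<Lambda>\<^sub>k\<close>.

  The spectrum of \<open>A\<close> is \<open>f\<^sup>-\<^sup>1([-2, 2])\<close>: truncated Floquet solutions give one inclusion; the other
  follows from \<open>w (f(z) - T) = (1 - w S\<^sup>N) (1 - w S\<^sup>-\<^sup>N)\<close>, where \<open>f(z) = w + 1/w\<close>, and from the
  divisibility of \<open>f(z) - f(A)\<close> by \<open>z - A\<close>.  Two such functions with the same preimage \<open>E\<close> of
  \<open>[-2, 2]\<close> agree at \<open>g + 2\<close> edges of \<open>E\<close> and therefore coincide.  Conversely, \<open>f(A) = T\<close> makes \<open>A\<close>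
  commute with \<open>T\<close>, and the band structure turns this into periodicity.  Finally, the equations of the
  isospectral surface guarantee the GMP property, because interchanging input and output in the
  state space realization of \<open>c\<^sub>k - A\<close> exhibits its inverse as a matrix of the same kind, with \<open>1/\<Lambda>\<^sub>k\<close>
  in the place of \<open>p\<^sub>g\<close>.
\<close>

section \<open>Square summable sequences\<close>

text \<open>A Floquet solution of \<open>A x = z x\<close> is not square summable, so
  \<open>f(A) = T\<close> cannot be applied to it directly. The GMP property repairs this: the
  resolvents at the poles are band matrices, hence so is \<open>f(A)\<close>, and near a given index
  it cannot tell the solution from a long truncation of it. The trace enters because the blocks are
  semiseparable of rank one: a row sees its input to the left of the diagonal through one number and
  its input from the diagonal on through another. These two numbers form the state. One period
  multiplies it by a matrix of determinant 1, whose eigenvalues w and 1/w therefore add up to f(z).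
  With the poles fixed, f has g + 2 coefficients, and the difference of two such functions has a
  numerator of degree at most g + 1; hence g + 2 edges determine f. On the side of the surface
  equations the invertibility of c_k - A is not given but has to be produced. The inverse is written
  down first, with positivity of \<open>Lam\<close> making its parameters admissible; it is checked
  to be a left inverse by following states, and the symmetry of both matrices makes it a right
  inverse.\<close>

lemma Rep_ell2_simps [simp]:
  "Rep_ell2 (x + y) n = Rep_ell2 x n + Rep_ell2 y n"
  "Rep_ell2 (x - y) n = Rep_ell2 x n - Rep_ell2 y n"
  "Rep_ell2 (- x) n = - Rep_ell2 x n"
  "Rep_ell2 0 n = 0"
  "Rep_ell2 (c *\<^sub>C x) n = c * Rep_ell2 x n"
  "Rep_ell2 (r *\<^sub>R x) n = complex_of_real r * Rep_ell2 x n"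
  "Rep_ell2 (shift_op x) n = Rep_ell2 x (n - 1)"
  "Rep_ell2 (basis_vec m) n = (if n = m then 1 else 0)"
  by (simp_all add: plus_ell2.rep_eq minus_ell2.rep_eq uminus_ell2.rep_eq zero_ell2.rep_eq
      scaleC.rep_eq scaleR_ell2_def shift_op.rep_eq basis_vec.rep_eq)

lemma Rep_ell2_sum [simp]: "Rep_ell2 (\<Sum>i\<in>I. f i) n = (\<Sum>i\<in>I. Rep_ell2 (f i) n)"
  by (induction I rule: infinite_finite_induct) auto

lemma ell2_eqI: "(\<And>n. Rep_ell2 x n = Rep_ell2 y n) \<Longrightarrow> x = y"
  by (metis Rep_ell2_inject ext)

lemma summable_Rep_ell2: "(\<lambda>n. (cmod (Rep_ell2 x n))\<^sup>2) summable_on UNIV"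
  using Rep_ell2[of x] by simp

lemma norm_ell2_power2: "(norm x)\<^sup>2 = (\<Sum>\<^sub>\<infinity>n. (cmod (Rep_ell2 x n))\<^sup>2)"
  by (simp add: norm_ell2.rep_eq infsum_nonneg)

lemma sum_le_norm_ell2:
  "finite F \<Longrightarrow> (\<Sum>n\<in>F. (cmod (Rep_ell2 x n))\<^sup>2) \<le> (norm x)\<^sup>2"
  unfolding norm_ell2_power2 by (rule finite_sum_le_infsum[OF summable_Rep_ell2]) auto

lemma norm_ell2_leI:
  assumes "\<And>F. finite F \<Longrightarrow> (\<Sum>n\<in>F. (cmod (Rep_ell2 x n))\<^sup>2) \<le> B\<^sup>2" and "0 \<le> B"
  shows "norm x \<le> B"
proof -
  have "(norm x)\<^sup>2 \<le> B\<^sup>2"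
    unfolding norm_ell2_power2 by (rule infsum_le_finite_sums[OF summable_Rep_ell2]) (use assms in auto)
  then show ?thesis using assms(2) by (rule power2_le_imp_le)
qed

lemma cmod_Rep_ell2_le: "cmod (Rep_ell2 x n) \<le> norm x"
  using sum_le_norm_ell2[of "{n}" x] by (auto intro: power2_le_imp_le[OF _ norm_ge_zero])

lemma ell2_exists:
  assumes "\<And>F. finite F \<Longrightarrow> (\<Sum>n\<in>F. (cmod (f n))\<^sup>2) \<le> B"
  obtains x where "Rep_ell2 x = f"
proof -
  have "(\<lambda>n. (cmod (f n))\<^sup>2) summable_on UNIV"
    by (rule nonneg_bdd_above_summable_on) (use assms in \<open>auto intro!: bdd_aboveI2\<close>)
  then show ?thesis using that[of "Abs_ell2 f"] by (simp add: Abs_ell2_inverse)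
qed

text \<open>Completeness is what Banach's fixed point theorem requires in
  \<open>boundedly_invertible_contraction\<close>. The limit is the entrywise one.\<close>

instance ell2 :: banach
proof
  fix X :: "nat \<Rightarrow> ell2" assume X: "Cauchy X"
  have C: "\<exists>M. \<forall>m\<ge>M. \<forall>k\<ge>M. norm (X m - X k) < e" if "e > 0" for e
    using X that unfolding Cauchy_def dist_norm by blast
  have "Cauchy (\<lambda>k. Rep_ell2 (X k) n)" for n
    unfolding Cauchy_def dist_norm
    using C cmod_Rep_ell2_le[of "X m - X k" n for m k] by simp (meson le_less_trans)
  then obtain f where f: "(\<lambda>k. Rep_ell2 (X k) n) \<longlonglongrightarrow> f n" for n
    unfolding Cauchy_convergent_iff convergent_def by metis
  have bound: "(\<Sum>n\<in>F. (cmod (f n - Rep_ell2 (X m) n))\<^sup>2) \<le> e\<^sup>2"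
    if F: "finite F" and M: "\<And>k. k \<ge> M \<Longrightarrow> norm (X k - X m) \<le> e" for F m M e
  proof (rule Lim_bounded)
    show "(\<lambda>k. \<Sum>n\<in>F. (cmod (Rep_ell2 (X k) n - Rep_ell2 (X m) n))\<^sup>2)
        \<longlonglongrightarrow> (\<Sum>n\<in>F. (cmod (f n - Rep_ell2 (X m) n))\<^sup>2)"
      by (intro tendsto_intros f)
    show "\<forall>k\<ge>M. (\<Sum>n\<in>F. (cmod (Rep_ell2 (X k) n - Rep_ell2 (X m) n))\<^sup>2) \<le> e\<^sup>2"
    proof (intro allI impI)
      fix k assume "M \<le> k"
      have "(\<Sum>n\<in>F. (cmod (Rep_ell2 (X k) n - Rep_ell2 (X m) n))\<^sup>2) \<le> (norm (X k - X m))\<^sup>2"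
        using sum_le_norm_ell2[OF F, of "X k - X m"] by simp
      also have "\<dots> \<le> e\<^sup>2" using M[OF \<open>M \<le> k\<close>] by (simp add: power_mono)
      finally show "(\<Sum>n\<in>F. (cmod (Rep_ell2 (X k) n - Rep_ell2 (X m) n))\<^sup>2) \<le> e\<^sup>2" .
    qed
  qed
  obtain M where M: "\<And>m k. m \<ge> M \<Longrightarrow> k \<ge> M \<Longrightarrow> norm (X m - X k) < 1" using C[of 1] by auto
  \<comment> \<open>Square summability of the entrywise limit comes from its difference to one
    member of the sequence, which is bounded by 1.\<close>
  obtain y where y: "Rep_ell2 y = (\<lambda>n. f n - Rep_ell2 (X M) n)"
    by (rule ell2_exists[of _ "1\<^sup>2"]) (rule bound[of _ M M], auto intro: less_imp_le M)
  have Y: "Rep_ell2 (y + X M) n = f n" for n by (simp add: y)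
  have "X \<longlonglongrightarrow> y + X M"
  proof (rule LIMSEQ_I)
    fix r :: real assume r: "r > 0"
    obtain L where L: "\<And>m k. m \<ge> L \<Longrightarrow> k \<ge> L \<Longrightarrow> norm (X m - X k) < r / 2"
      using C[of "r / 2"] r by auto
    have "norm (X m - (y + X M)) < r" if "m \<ge> L" for m
    proof -
      have "norm (y + X M - X m) \<le> r / 2"
      proof (rule norm_ell2_leI)
        fix F :: "int set" assume "finite F"
        then have "(\<Sum>n\<in>F. (cmod (f n - Rep_ell2 (X m) n))\<^sup>2) \<le> (r / 2)\<^sup>2"
          by (rule bound[of _ L]) (use L[OF _ that] in \<open>auto intro: less_imp_le\<close>)
        then show "(\<Sum>n\<in>F. (cmod (Rep_ell2 (y + X M - X m) n))\<^sup>2) \<le> (r / 2)\<^sup>2"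
          using Y by simp
      qed (use r in simp)
      then show ?thesis using r by (subst norm_minus_commute) simp
    qed
    then show "\<exists>no. \<forall>n\<ge>no. norm (X n - (y + X M)) < r" by blast
  qed
  then show "convergent X" by (rule convergentI)
qed

text \<open>Through this expansion a bounded operator is determined by its matrix entries.\<close>

lemma ell2_has_sum: "((\<lambda>n. Rep_ell2 x n *\<^sub>C basis_vec n) has_sum x) UNIV"
  unfolding has_sum_def
proof (rule tendstoI)
  fix e :: real assume e: "e > 0"
  let ?h = "\<lambda>n. (cmod (Rep_ell2 x n))\<^sup>2"
  have "(sum ?h \<longlongrightarrow> (norm x)\<^sup>2) (finite_subsets_at_top UNIV)"
    unfolding norm_ell2_power2 by (rule infsum_tendsto[OF summable_Rep_ell2])
  then have "\<forall>\<^sub>F F in finite_subsets_at_top UNIV. dist (sum ?h F) ((norm x)\<^sup>2) < (e / 2)\<^sup>2"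
    by (rule tendstoD) (use e in auto)
  moreover have "\<forall>\<^sub>F F in finite_subsets_at_top (UNIV :: int set). finite F"
    by (simp add: eventually_finite_subsets_at_top_weakI)
  ultimately show "\<forall>\<^sub>F F in finite_subsets_at_top UNIV.
      dist (\<Sum>n\<in>F. Rep_ell2 x n *\<^sub>C basis_vec n) x < e"
  proof eventually_elim
    case (elim F)
    let ?y = "x - (\<Sum>n\<in>F. Rep_ell2 x n *\<^sub>C basis_vec n)"
    have y: "Rep_ell2 ?y n = (if n \<in> F then 0 else Rep_ell2 x n)" for n
      using elim(2) by (simp add: if_distrib[of "\<lambda>t. _ * t"] sum.delta' cong: if_cong)
    have "norm ?y \<le> e / 2"
    proof (rule norm_ell2_leI)
      fix G :: "int set" assume G: "finite G"
      \<comment> \<open>The squared norm of the tail is at most the total minus the partial sum over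
        \<open>F\<close>.\<close>
      have "(\<Sum>n\<in>G. (cmod (Rep_ell2 ?y n))\<^sup>2) + sum ?h F = sum ?h (G - F) + sum ?h F"
        unfolding y using G by (simp add: sum.If_cases if_distrib[of cmod] if_distrib[of "\<lambda>t. t\<^sup>2"]
            Diff_eq cong: if_cong)
      also have "\<dots> = sum ?h ((G - F) \<union> F)"
        by (rule sum.union_disjoint[symmetric]) (use G elim(2) in auto)
      also have "\<dots> \<le> (norm x)\<^sup>2" by (rule sum_le_norm_ell2) (use G elim(2) in auto)
      finally show "(\<Sum>n\<in>G. (cmod (Rep_ell2 ?y n))\<^sup>2) \<le> (e / 2)\<^sup>2"
        using elim(1) by (simp add: dist_real_def)
    qed (use e in simp)
    then show ?case using e by (simp add: dist_norm norm_minus_commute)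
  qed
qed

section \<open>Bounded operators and their matrices\<close>

lemma scaleR_scaleC: "r *\<^sub>R x = complex_of_real r *\<^sub>C x"
  by (rule scaleR_ell2_def)

lemma norm_scaleC [simp]: "norm (c *\<^sub>C x) = cmod c * norm x"
  by transfer (simp add: norm_mult power_mult_distrib infsum_cmult_right' real_sqrt_mult)

lemma bounded_opI:
  assumes "\<And>x y. T (x + y) = T x + T y" "\<And>c x. T (c *\<^sub>C x) = c *\<^sub>C T x"
    "\<And>x. norm (T x) \<le> K * norm x"
  shows "bounded_op T"
  unfolding bounded_op_def
  by (intro conjI bounded_linear_intro[of _ K]) (use assms in \<open>auto simp: scaleR_scaleC mult.commute\<close>)

lemma bounded_opD:
  assumes "bounded_op T"
  shows "bounded_linear T" "linear T" "T (x + y) = T x + T y" "T (x - y) = T x - T y" "T 0 = 0"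
    "T (- x) = - T x" "T (c *\<^sub>C x) = c *\<^sub>C T x" "T (r *\<^sub>R x) = r *\<^sub>R T x"
    "T (\<Sum>i\<in>I. f i) = (\<Sum>i\<in>I. T (f i))"
proof -
  show b: "bounded_linear T" and c: "T (c *\<^sub>C x) = c *\<^sub>C T x"
    using assms by (auto simp: bounded_op_def)
  show l: "linear T" using b by (rule bounded_linear.linear)
  show "T (x + y) = T x + T y" "T (x - y) = T x - T y" "T 0 = 0" "T (- x) = - T x"
    "T (r *\<^sub>R x) = r *\<^sub>R T x" "T (\<Sum>i\<in>I. f i) = (\<Sum>i\<in>I. T (f i))"
    by (simp_all add: linear_add[OF l] linear_diff[OF l] linear_0[OF l] linear_neg[OF l]
        linear_scale[OF l] linear_sum[OF l])
qed

lemma bounded_op_bound: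
  assumes "bounded_op T"
  obtains K where "K > 0" "\<And>x. norm (T x) \<le> K * norm x"
  using bounded_linear.pos_bounded[OF bounded_opD(1)[OF assms]] by (metis mult.commute)

lemma bounded_op_comp:
  assumes S: "bounded_op S" and T: "bounded_op T"
  shows "bounded_op (\<lambda>x. S (T x))"
  using bounded_linear_compose[OF bounded_opD(1)[OF S] bounded_opD(1)[OF T]] S T
  by (simp add: bounded_op_def)

lemma scaleC_algebra:
  "c *\<^sub>C (x + y) = c *\<^sub>C x + c *\<^sub>C y" "c *\<^sub>C (x - y) = c *\<^sub>C x - c *\<^sub>C y"
  "(c + d) *\<^sub>C x = c *\<^sub>C x + d *\<^sub>C x" "(c - d) *\<^sub>C x = c *\<^sub>C x - d *\<^sub>C x"
  "c *\<^sub>C d *\<^sub>C x = (c * d) *\<^sub>C x" "1 *\<^sub>C x = x" "c *\<^sub>C (0 :: ell2) = 0" "0 *\<^sub>C x = 0"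
  by (rule ell2_eqI; simp add: algebra_simps)+

lemma scaleC_sum: "c *\<^sub>C (\<Sum>i\<in>I. f i) = (\<Sum>i\<in>I. c *\<^sub>C f i)"
  by (rule ell2_eqI) (simp add: sum_distrib_left)

lemma bounded_op_scaleC:
  assumes "bounded_op T" shows "bounded_op (\<lambda>x. c *\<^sub>C T x)"
proof -
  obtain K where "\<And>x. norm (T x) \<le> K * norm x" using bounded_op_bound[OF assms] by metis
  then have "norm (c *\<^sub>C T x) \<le> (cmod c * K) * norm x" for x
    by (simp add: mult_left_mono mult.assoc)
  then show ?thesis
    by (intro bounded_opI[of _ "cmod c * K"])
      (simp_all add: bounded_opD[OF assms] scaleC_algebra mult.commute)
qed

lemma bounded_op_scaleR: "bounded_op T \<Longrightarrow> bounded_op (\<lambda>x. r *\<^sub>R T x)"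
  unfolding scaleR_scaleC by (rule bounded_op_scaleC)

lemma bounded_op_add: "bounded_op S \<Longrightarrow> bounded_op T \<Longrightarrow> bounded_op (\<lambda>x. S x + T x)"
  unfolding bounded_op_def by (auto intro: bounded_linear_add simp: scaleC_algebra)

lemma bounded_op_diff: "bounded_op S \<Longrightarrow> bounded_op T \<Longrightarrow> bounded_op (\<lambda>x. S x - T x)"
  unfolding bounded_op_def by (auto intro: bounded_linear_sub simp: scaleC_algebra)

lemma bounded_op_id: "bounded_op (\<lambda>x. x)"
  by (simp add: bounded_op_def)

lemma bounded_op_zero: "bounded_op (\<lambda>x. 0)"
  by (simp add: bounded_op_def scaleC_algebra)

lemma bounded_op_sum: "(\<And>i. i \<in> I \<Longrightarrow> bounded_op (T i)) \<Longrightarrow> bounded_op (\<lambda>x. \<Sum>i\<in>I. T i x)"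
  by (induction I rule: infinite_finite_induct) (auto intro: bounded_op_zero bounded_op_add)

lemmas bounded_op_intros =
  bounded_op_scaleC bounded_op_scaleR bounded_op_add bounded_op_diff bounded_op_id bounded_op_sum

lemma bounded_op_has_sum:
  assumes T: "bounded_op T"
  shows "((\<lambda>n. matrix_entry T m n * Rep_ell2 x n) has_sum Rep_ell2 (T x) m) UNIV"
proof -
  have "bounded_linear (\<lambda>x. Rep_ell2 x m)"
    by (rule bounded_linear_intro[of _ 1]) (simp_all add: cmod_Rep_ell2_le scaleR_conv_of_real)
  from bounded_linear_compose[OF this bounded_opD(1)[OF T]]
  have "((\<lambda>n. Rep_ell2 (T (Rep_ell2 x n *\<^sub>C basis_vec n)) m) has_sum Rep_ell2 (T x) m) UNIV"
    by (rule has_sum_bounded_linear) (rule ell2_has_sum)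
  then show ?thesis
    by (simp add: bounded_opD[OF T] matrix_entry_def mult.commute)
qed

text \<open>The disjunction allows either the band of \<open>T\<close> or the support of
  \<open>x\<close> to cut the series down to a finite sum.\<close>

lemma bounded_op_apply:
  assumes "bounded_op T" "finite L" "\<And>n. n \<notin> L \<Longrightarrow> matrix_entry T m n = 0 \<or> Rep_ell2 x n = 0"
  shows "Rep_ell2 (T x) m = (\<Sum>n\<in>L. matrix_entry T m n * Rep_ell2 x n)"
proof -
  have "((\<lambda>n. matrix_entry T m n * Rep_ell2 x n) has_sum
      (\<Sum>n\<in>L. matrix_entry T m n * Rep_ell2 x n)) L"
    by (rule has_sum_finite) fact
  then have "((\<lambda>n. matrix_entry T m n * Rep_ell2 x n) has_sum
      (\<Sum>n\<in>L. matrix_entry T m n * Rep_ell2 x n)) UNIV"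
    by (rule has_sum_cong_neutral[THEN iffD1, rotated -1]) (use assms(3) in auto)
  with bounded_op_has_sum[OF assms(1)] show ?thesis by (rule has_sum_unique)
qed

lemma matrix_entry_comp:
  assumes "bounded_op S" "finite L"
    "\<And>l. l \<notin> L \<Longrightarrow> matrix_entry S m l = 0 \<or> matrix_entry T l n = 0"
  shows "matrix_entry (\<lambda>x. S (T x)) m n = (\<Sum>l\<in>L. matrix_entry S m l * matrix_entry T l n)"
  unfolding matrix_entry_def[of "\<lambda>x. S (T x)"] matrix_entry_def[of T]
  by (rule bounded_op_apply) (use assms in \<open>auto simp: matrix_entry_def[of T]\<close>)

lemma bounded_op_eqI:
  assumes "bounded_op S" "bounded_op T" "\<And>m n. matrix_entry S m n = matrix_entry T m n"
  shows "S x = T x"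
proof (rule ell2_eqI)
  fix m
  show "Rep_ell2 (S x) m = Rep_ell2 (T x) m"
    using bounded_op_has_sum[OF assms(1), of m x] bounded_op_has_sum[OF assms(2), of m x] assms(3)
    by (simp add: has_sum_unique)
qed

lemma bounded_op_commute_entry:
  assumes "bounded_op S" "bounded_op T" "\<And>x. S (T x) = T (S x)" "finite L" "finite L'"
    "\<And>l. l \<notin> L \<Longrightarrow> matrix_entry S m l = 0 \<or> matrix_entry T l n = 0"
    "\<And>l. l \<notin> L' \<Longrightarrow> matrix_entry T m l = 0 \<or> matrix_entry S l n = 0"
  shows "(\<Sum>l\<in>L. matrix_entry S m l * matrix_entry T l n) =
    (\<Sum>l\<in>L'. matrix_entry T m l * matrix_entry S l n)"
  using matrix_entry_comp[of S L m T n] matrix_entry_comp[of T L' m S n] assms by simp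

section \<open>Shifts\<close>

lemma bij_shift_op: "bij shift_op"
proof (rule bijI)
  show "inj shift_op"
  proof (rule injI)
    fix x y assume "shift_op x = shift_op y"
    then have "Rep_ell2 (shift_op x) (n + 1) = Rep_ell2 (shift_op y) (n + 1)" for n by simp
    then show "x = y" by (intro ell2_eqI) simp
  qed
  show "surj shift_op"
  proof (rule surjI)
    fix y
    obtain x where x: "Rep_ell2 x = (\<lambda>n. Rep_ell2 y (n + 1))"
    proof (rule ell2_exists)
      fix F :: "int set" assume "finite F"
      then show "(\<Sum>n\<in>F. (cmod (Rep_ell2 y (n + 1)))\<^sup>2) \<le> (norm y)\<^sup>2"
        using sum_le_norm_ell2[of "(\<lambda>n. n + 1) ` F" y] by (simp add: sum.reindex)
    qed
    show "shift_op (SOME x. shift_op x = y) = y"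
      by (rule someI[of _ x]) (auto intro: ell2_eqI simp: x)
  qed
qed

lemma Rep_ell2_inv_shift_op [simp]: "Rep_ell2 (inv shift_op x) n = Rep_ell2 x (n + 1)"
proof -
  have "shift_op (inv shift_op x) = x" using bij_shift_op by (simp add: bij_is_surj surj_f_inv_f)
  then have "Rep_ell2 (shift_op (inv shift_op x)) (n + 1) = Rep_ell2 x (n + 1)" by simp
  then show ?thesis by simp
qed

lemma Rep_ell2_shift_pow [simp]:
  "Rep_ell2 ((shift_op ^^ k) x) n = Rep_ell2 x (n - int k)"
  "Rep_ell2 ((inv shift_op ^^ k) x) n = Rep_ell2 x (n + int k)"
  by (induction k arbitrary: n) (simp_all add: algebra_simps)

lemma norm_shift_pow_le:
  "norm ((shift_op ^^ k) x) \<le> norm x" "norm ((inv shift_op ^^ k) x) \<le> norm x"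
proof -
  have *: "norm y \<le> norm x" if y: "\<And>n. Rep_ell2 y n = Rep_ell2 x (n + d)" for y d
  proof (rule norm_ell2_leI)
    fix F :: "int set" assume "finite F"
    then show "(\<Sum>n\<in>F. (cmod (Rep_ell2 y n))\<^sup>2) \<le> (norm x)\<^sup>2"
      using sum_le_norm_ell2[of "(\<lambda>n. n + d) ` F" x] by (simp add: sum.reindex y)
  qed simp
  show "norm ((shift_op ^^ k) x) \<le> norm x" by (rule *[of _ "- int k"]) simp
  show "norm ((inv shift_op ^^ k) x) \<le> norm x" by (rule *[of _ "int k"]) simp
qed

lemma bounded_op_shift_pow: "bounded_op (shift_op ^^ k)" "bounded_op (inv shift_op ^^ k)"
  by (rule bounded_opI[of _ 1]; (rule ell2_eqI)?; simp add: norm_shift_pow_le)+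

lemma shift_pow_basis_vec [simp]:
  "(shift_op ^^ k) (basis_vec n) = basis_vec (n + int k)"
  "(inv shift_op ^^ k) (basis_vec n) = basis_vec (n - int k)"
  by (rule ell2_eqI; auto)+

section \<open>Inverses\<close>

lemma boundedly_invertibleD:
  assumes "boundedly_invertible T"
  shows "bounded_op (inv T)" "inv T (T x) = x" "T (inv T x) = x"
proof -
  obtain R where R: "bounded_op R" "R \<circ> T = id" "T \<circ> R = id"
    using assms by (auto simp: boundedly_invertible_def)
  then have inv: "inv T = R" by (metis inv_unique_comp)
  show "bounded_op (inv T)" unfolding inv by (rule R)
  show "inv T (T x) = x" "T (inv T x) = x"
    unfolding inv using fun_cong[OF R(2), of x] fun_cong[OF R(3), of x] by simp_all
qed

lemma boundedly_invertibleI: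
  assumes "bounded_op R" "\<And>x. R (T x) = x" "\<And>x. T (R x) = x"
  shows "boundedly_invertible T" "inv T = R"
proof -
  have "R \<circ> T = id" "T \<circ> R = id" using assms by auto
  then show "boundedly_invertible T" "inv T = R"
    using assms(1) by (auto simp: boundedly_invertible_def intro: inv_unique_comp)
qed

lemma boundedly_invertible_comp:
  assumes S: "boundedly_invertible S" and T: "boundedly_invertible T"
  shows "boundedly_invertible (\<lambda>x. S (T x))"
  by (rule boundedly_invertibleI[of "\<lambda>x. inv T (inv S x)"])
    (simp_all add: bounded_op_comp boundedly_invertibleD[OF S] boundedly_invertibleD[OF T])

text \<open>Applied to \<open>T\<close> = z - A and \<open>D\<close> = f(z) - f(A), with
  \<open>K\<close> the quotient. The right inverse \<open>K (inv D x)\<close> is also a left inverse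
  because \<open>D\<close> is injective.\<close>

lemma boundedly_invertible_factor:
  assumes D: "boundedly_invertible D" and K: "bounded_op K"
    and eq: "\<And>x. T (K x) = D x" "\<And>x. K (T x) = D x"
  shows "boundedly_invertible T"
proof (rule boundedly_invertibleI)
  show "bounded_op (\<lambda>x. K (inv D x))" by (rule bounded_op_comp[OF K boundedly_invertibleD(1)[OF D]])
  show TK: "T (K (inv D x)) = x" for x
    unfolding eq(1) by (rule boundedly_invertibleD(3)[OF D])
  show "K (inv D (T x)) = x" for x
  proof -
    have "D (K (inv D (T x))) = D x"
      unfolding eq(2)[symmetric] TK ..
    then have "inv D (D (K (inv D (T x)))) = inv D (D x)" by (rule arg_cong)
    then show ?thesis unfolding boundedly_invertibleD(2)[OF D] .
  qed
qed

text \<open>The inverse sends \<open>y\<close> to the fixed point of the contraction x -> y + F x;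
  uniqueness of the fixed point makes it linear.\<close>

lemma boundedly_invertible_contraction:
  assumes F: "bounded_op F" and le: "\<And>x. norm (F x) \<le> r * norm x" and r: "0 \<le> r" "r < 1"
  shows "boundedly_invertible (\<lambda>x. x - F x)"
proof -
  have ex1: "\<exists>!x. y + F x = x" for y
  proof -
    have "norm (F u - F v) \<le> r * norm (u - v)" for u v
      using le[of "u - v"] by (simp add: bounded_opD(4)[OF F])
    then show ?thesis using r by (intro banach_fix_type[of r]) (auto simp: dist_norm)
  qed
  define R where "R y = (THE x. y + F x = x)" for y
  have R: "y + F (R y) = R y" for y unfolding R_def by (rule theI'[OF ex1])
  have R_eq: "R y = x" if "y + F x = x" for x y using ex1[of y] R[of y] that by blast
  show ?thesis
  proof (rule boundedly_invertibleI)
    show "R (x - F x) = x" for x by (rule R_eq) simp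
    show "R y - F (R y) = y" for y using R[of y] by (metis add_diff_cancel_right')
    show "bounded_op R"
    proof (rule bounded_opI)
      show "R (x + y) = R x + R y" for x y
        by (rule R_eq) (metis R add.commute add.left_commute bounded_opD(3)[OF F])
      show "R (c *\<^sub>C x) = c *\<^sub>C R x" for c x
        by (rule R_eq) (metis R bounded_opD(7)[OF F] scaleC_algebra(1))
      show "norm (R y) \<le> 1 / (1 - r) * norm y" for y
      proof -
        have "norm (R y) \<le> norm y + r * norm (R y)"
          using R[of y] le[of "R y"] norm_triangle_ineq[of y "F (R y)"] by simp
        then show ?thesis using r by (simp add: field_simps)
      qed
    qed
  qed
qed

section \<open>Block matrices\<close>

definition blk :: "nat \<Rightarrow> int \<Rightarrow> nat \<Rightarrow> int" where
  "blk g i r = i * int (g + 1) + int r"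

lemma blk_cases: obtains i r where "r \<le> g" "m = blk g i r"
proof
  have "0 \<le> m mod int (g + 1)" "m mod int (g + 1) < int (g + 1)" by simp_all
  then show "nat (m mod int (g + 1)) \<le> g" by linarith
  have "int (nat (m mod int (g + 1))) = m mod int (g + 1)" by simp
  then show "m = blk g (m div int (g + 1)) (nat (m mod int (g + 1)))"
    by (simp only: blk_def div_mult_mod_eq)
qed

lemma blk_mod: "r \<le> g \<Longrightarrow> blk g i r mod int (g + 1) = int r"
  unfolding blk_def by (subst mod_mult_self3) (rule mod_pos_pos_trivial, auto)

lemma blk_div: "r \<le> g \<Longrightarrow> blk g i r div int (g + 1) = i"
  unfolding blk_def by (subst div_mult_self3) (auto simp: div_pos_pos_trivial)

lemma blk_eq_iff: "r \<le> g \<Longrightarrow> s \<le> g \<Longrightarrow> blk g i r = blk g j s \<longleftrightarrow> i = j \<and> r = s"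
  by (metis blk_div blk_mod of_nat_eq_iff)

lemma blk_add_period: "blk g i r + int (g + 1) = blk g (i + 1) r"
  by (simp add: blk_def algebra_simps)

lemma sum_blk:
  assumes "finite J"
  shows "(\<Sum>n\<in>(\<lambda>(j, s). blk g j s) ` (J \<times> {..g}). f n) = (\<Sum>j\<in>J. \<Sum>s\<le>g. f (blk g j s))"
proof -
  have "inj_on (\<lambda>(j, s). blk g j s) (J \<times> {..g})" by (auto simp: inj_on_def blk_eq_iff)
  then show ?thesis by (simp add: sum.reindex sum.cartesian_product case_prod_unfold)
qed

lemma matrix_entry_blk:
  "generated_by g c p q A \<Longrightarrow> r \<le> g \<Longrightarrow> s \<le> g \<Longrightarrow>
    matrix_entry A (blk g i r) (blk g j s) = complex_of_real (gmp_entry g c p q i r j s)"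
  by (simp add: generated_by_def blk_def)

lemma B_block_eq:
  "B_block g c p q r s = (if s \<le> r then p r * q s else q r * p s)
    + (if r = s \<and> r < g then c (Suc r) else 0)"
  by (simp add: B_block_def upper_part_def lower_part_def outer_def)

lemma gmp_entry_sym: "gmp_entry g c p q i r j s = gmp_entry g c p q j s i r"
  by (auto simp: gmp_entry_def B_block_eq mult.commute)

lemma generated_by_apply:
  assumes A: "generated_by g c p q A" and r: "r \<le> g"
  shows "Rep_ell2 (A x) (blk g i r) =
    (\<Sum>s\<le>g. complex_of_real (B_block g c (p i) (q i) r s) * Rep_ell2 x (blk g i s))
    + (if r = g then \<Sum>s\<le>g. complex_of_real (p (i + 1) s) * Rep_ell2 x (blk g (i + 1) s) else 0)
    + complex_of_real (p i r) * Rep_ell2 x (blk g (i - 1) g)"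
proof -
  let ?L = "(\<lambda>(j, s). blk g j s) ` ({i - 1, i, i + 1} \<times> {..g})"
  have zero: "matrix_entry A (blk g i r) n = 0" if "n \<notin> ?L" for n
  proof -
    obtain j s where n: "s \<le> g" "n = blk g j s" by (rule blk_cases)
    then have "j \<notin> {i - 1, i, i + 1}" using that by force
    then show ?thesis unfolding n(2) matrix_entry_blk[OF A r n(1)] by (auto simp: gmp_entry_def)
  qed
  have "Rep_ell2 (A x) (blk g i r) = (\<Sum>n\<in>?L. matrix_entry A (blk g i r) n * Rep_ell2 x n)"
    by (rule bounded_op_apply) (use A zero in \<open>auto simp: generated_by_def\<close>)
  also have "\<dots> = (\<Sum>j\<in>{i - 1, i, i + 1}. \<Sum>s\<le>g.
      complex_of_real (gmp_entry g c p q i r j s) * Rep_ell2 x (blk g j s))"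
    by (subst sum_blk) (use A r in \<open>auto intro!: sum.cong simp: matrix_entry_blk\<close>)
  finally show ?thesis
    by (simp add: gmp_entry_def A_block_def outer_def if_distrib[of complex_of_real]
        if_distrib[of "\<lambda>t. t * _"] sum.delta cong: if_cong)
qed

text \<open>
  The semiseparable structure of the blocks turns \<open>A x\<close> into the output of a linear system with
  the two-dimensional state \<open>(al, be)\<close>.
\<close>

lemma generated_by_states:
  fixes al be be' :: "nat \<Rightarrow> complex"
  assumes A: "generated_by g c (\<lambda>_. p) (\<lambda>_. q) A"
    and al0: "al 0 = Rep_ell2 x (blk g (j - 1) g)"
    and alS: "\<And>r. r < g \<Longrightarrow> al (Suc r) = al r + q r * Rep_ell2 x (blk g j r)"
    and beS: "\<And>r. r < g \<Longrightarrow> be (Suc r) = be r - p r * Rep_ell2 x (blk g j r)"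
    and beg: "be g = p g * Rep_ell2 x (blk g j g)"
    and be'S: "\<And>r. r < g \<Longrightarrow> be' (Suc r) = be' r - p r * Rep_ell2 x (blk g (j + 1) r)"
    and be'g: "be' g = p g * Rep_ell2 x (blk g (j + 1) g)"
  shows "r < g \<Longrightarrow> Rep_ell2 (A x) (blk g j r) =
      c (Suc r) * Rep_ell2 x (blk g j r) + p r * al r + q r * be r"
    and "Rep_ell2 (A x) (blk g j g) = p g * al g + q g * be g + be' 0"
proof -
  have al: "al r = Rep_ell2 x (blk g (j - 1) g) + (\<Sum>s<r. q s * Rep_ell2 x (blk g j s))"
    if "r \<le> g" for r
    using that by (induction r) (simp_all add: al0 alS)
  \<comment> \<open>The second state is anchored at the end of the block and sums what lies ahead,
    hence the downward induction.\<close>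
  have be: "b r = (\<Sum>s=r..g. p s * Rep_ell2 x (blk g i s))"
    if S: "\<And>r. r < g \<Longrightarrow> b (Suc r) = b r - p r * Rep_ell2 x (blk g i r)"
      and G: "b g = p g * Rep_ell2 x (blk g i g)" and r: "r \<le> g"
    for b :: "nat \<Rightarrow> complex" and i r
    using r
  proof (induction r rule: inc_induct)
    case (step n)
    then show ?case using S[of n] by (simp add: sum.atLeast_Suc_atMost[of n g] algebra_simps)
  qed (simp add: G)
  have be_j: "be r = (\<Sum>s=r..g. p s * Rep_ell2 x (blk g j s))" if "r \<le> g" for r
    using be[of be j r] beS beg that by blast
  have be'0: "be' 0 = (\<Sum>s=0..g. p s * Rep_ell2 x (blk g (j + 1) s))"
    using be[of be' "j + 1" 0] be'S be'g by blast
  have B: "(\<Sum>s\<le>g. complex_of_real (B_block g c p q r s) * Rep_ell2 x (blk g j s)) =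
      p r * (\<Sum>s<r. q s * Rep_ell2 x (blk g j s)) + q r * be r
      + (if r < g then c (Suc r) * Rep_ell2 x (blk g j r) else 0)" if r: "r \<le> g" for r
  proof -
    \<comment> \<open>Both formulas for the entry agree at \<open>s = r\<close>, so the diagonal may
      be moved to the part summed by \<open>be\<close>.\<close>
    have "(\<Sum>s\<le>g. complex_of_real (B_block g c p q r s) * Rep_ell2 x (blk g j s)) =
        (\<Sum>s\<le>g. (if s < r then p r * q s else q r * p s) * Rep_ell2 x (blk g j s)
          + (if s = r then if r < g then c (Suc r) * Rep_ell2 x (blk g j r) else 0 else 0))"
      by (rule sum.cong) (auto simp: B_block_eq algebra_simps)
    also have "\<dots> = (\<Sum>s\<le>g. (if s < r then p r * q s else q r * p s) * Rep_ell2 x (blk g j s))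
        + (if r < g then c (Suc r) * Rep_ell2 x (blk g j r) else 0)"
      using r by (simp add: sum.distrib)
    also have "(\<Sum>s\<le>g. (if s < r then p r * q s else q r * p s) * Rep_ell2 x (blk g j s)) =
        (\<Sum>s<r. (if s < r then p r * q s else q r * p s) * Rep_ell2 x (blk g j s))
        + (\<Sum>s=r..g. (if s < r then p r * q s else q r * p s) * Rep_ell2 x (blk g j s))"
    proof -
      have U: "{..g} = {..<r} \<union> {r..g}" using r by auto
      show ?thesis unfolding U by (rule sum.union_disjoint) auto
    qed
    also have "(\<Sum>s<r. (if s < r then p r * q s else q r * p s) * Rep_ell2 x (blk g j s)) =
        p r * (\<Sum>s<r. q s * Rep_ell2 x (blk g j s))"
      unfolding sum_distrib_left by (rule sum.cong) auto
    also have "(\<Sum>s=r..g. (if s < r then p r * q s else q r * p s) * Rep_ell2 x (blk g j s)) =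
        q r * be r"
      unfolding be_j[OF r] sum_distrib_left by (rule sum.cong) auto
    finally show ?thesis .
  qed
  show "Rep_ell2 (A x) (blk g j r) =
      c (Suc r) * Rep_ell2 x (blk g j r) + p r * al r + q r * be r" if r: "r < g"
    using generated_by_apply[OF A less_imp_le[OF r], of x j] r
    unfolding B[OF less_imp_le[OF r]] al[OF less_imp_le[OF r]] by (simp add: algebra_simps)
  show "Rep_ell2 (A x) (blk g j g) = p g * al g + q g * be g + be' 0"
    using generated_by_apply[OF A order_refl, of x j]
    unfolding B[OF order_refl] al[OF order_refl] be'0
    by (simp add: algebra_simps atMost_atLeast0)
qed

section \<open>Operators with prescribed band matrices\<close>

lemma diagonal_op_exists:
  fixes f :: "int \<Rightarrow> complex"
  assumes f: "\<And>n. cmod (f n) \<le> K"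
  obtains D where "bounded_op D" "\<And>x n. Rep_ell2 (D x) n = f n * Rep_ell2 x n"
proof -
  have K: "0 \<le> K" using f[of 0] norm_ge_zero[of "f 0"] by linarith
  have le: "(\<Sum>n\<in>F. (cmod (f n * Rep_ell2 x n))\<^sup>2) \<le> (K * norm x)\<^sup>2" if "finite F" for F x
  proof -
    have "(\<Sum>n\<in>F. (cmod (f n * Rep_ell2 x n))\<^sup>2) \<le> (\<Sum>n\<in>F. K\<^sup>2 * (cmod (Rep_ell2 x n))\<^sup>2)"
      by (intro sum_mono) (simp add: norm_mult power_mult_distrib mult_right_mono power_mono f)
    also have "\<dots> \<le> K\<^sup>2 * (norm x)\<^sup>2"
      unfolding sum_distrib_left[symmetric] by (rule mult_left_mono[OF sum_le_norm_ell2[OF that]]) simp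
    finally show ?thesis by (simp add: power_mult_distrib)
  qed
  have "\<exists>y. Rep_ell2 y = (\<lambda>n. f n * Rep_ell2 x n)" for x
    using ell2_exists[of "\<lambda>n. f n * Rep_ell2 x n" "(K * norm x)\<^sup>2"] le by metis
  then obtain D where D: "\<And>x. Rep_ell2 (D x) = (\<lambda>n. f n * Rep_ell2 x n)" by metis
  have "bounded_op D"
  proof (rule bounded_opI)
    show "D (x + y) = D x + D y" "D (k *\<^sub>C x) = k *\<^sub>C D x" for x y k
      by (rule ell2_eqI; simp add: D algebra_simps)+
    show "norm (D x) \<le> K * norm x" for x
      by (rule norm_ell2_leI) (use K le in \<open>simp_all add: D\<close>)
  qed
  with D show ?thesis using that by metis
qed

text \<open>Each diagonal of a band matrix is a shift followed by a bounded multiplication operator,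
  and finitely many diagonals are added up.\<close>

lemma banded_op_exists:
  fixes a :: "int \<Rightarrow> int \<Rightarrow> complex"
  assumes K: "\<And>m n. cmod (a m n) \<le> K" and band: "\<And>m n. \<bar>m - n\<bar> > w \<Longrightarrow> a m n = 0"
  obtains A where "bounded_op A" "\<And>m n. matrix_entry A m n = a m n"
proof -
  have "\<exists>D. bounded_op D \<and> (\<forall>x n. Rep_ell2 (D x) n = a n (n + d) * Rep_ell2 x n)" for d
    using diagonal_op_exists[of "\<lambda>n. a n (n + d)" K] K by metis
  then obtain D where D: "\<And>d. bounded_op (D d)"
    "\<And>d x n. Rep_ell2 (D d x) n = a n (n + d) * Rep_ell2 x n" by metis
  define U where "U d = (if d \<ge> 0 then inv shift_op ^^ nat d else shift_op ^^ nat (- d))" for d :: int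
  have U: "bounded_op (U d)" "Rep_ell2 (U d x) n = Rep_ell2 x (n + d)" for d x n
    by (auto simp: U_def bounded_op_shift_pow)
  define A where "A x = (\<Sum>d\<in>{-w..w}. D d (U d x))" for x
  have "bounded_op A" unfolding A_def by (intro bounded_op_sum bounded_op_comp[OF D(1) U(1)])
  moreover have "matrix_entry A m n = a m n" for m n
  proof -
    have "matrix_entry A m n = (\<Sum>d\<in>{-w..w}. if d = n - m then a m n else 0)"
      unfolding matrix_entry_def A_def Rep_ell2_sum D(2) U(2) by (intro sum.cong) auto
    also have "\<dots> = a m n" using band[of m n] by auto
    finally show ?thesis .
  qed
  ultimately show ?thesis using that by blast
qed

lemma gmp_op_exists:
  assumes p: "p g > 0"
  obtains A where "generated_by g c (\<lambda>_. p) (\<lambda>_. q) A"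
proof -
  define a where "a m n = complex_of_real (gmp_entry g c (\<lambda>_. p) (\<lambda>_. q)
    (m div int (g + 1)) (nat (m mod int (g + 1))) (n div int (g + 1)) (nat (n mod int (g + 1))))" for m n
  have a: "a (blk g i r) (blk g j s) = complex_of_real (gmp_entry g c (\<lambda>_. p) (\<lambda>_. q) i r j s)"
    if "r \<le> g" "s \<le> g" for i j r s
    unfolding a_def using that by (simp only: blk_div blk_mod nat_int)
  define K where "K = (\<Sum>r\<le>g. \<Sum>s\<le>g. \<bar>B_block g c p q r s\<bar> + \<bar>A_block g p r s\<bar> + \<bar>A_block g p s r\<bar>)"
  have "cmod (a m n) \<le> K" for m n
  proof -
    obtain i r where m: "r \<le> g" "m = blk g i r" by (rule blk_cases)
    obtain j s where n: "s \<le> g" "n = blk g j s" by (rule blk_cases)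
    let ?t = "\<lambda>r s. \<bar>B_block g c p q r s\<bar> + \<bar>A_block g p r s\<bar> + \<bar>A_block g p s r\<bar>"
    have "cmod (a m n) \<le> ?t r s"
      by (simp add: m n a gmp_entry_def)
    also have "\<dots> \<le> (\<Sum>s\<le>g. ?t r s)" by (rule member_le_sum) (use n in auto)
    also have "\<dots> \<le> K" unfolding K_def
      by (rule member_le_sum[of r "{..g}" "\<lambda>r. \<Sum>s\<le>g. ?t r s"]) (use m in \<open>auto intro: sum_nonneg\<close>)
    finally show ?thesis .
  qed
  moreover have "a m n = 0" if "\<bar>m - n\<bar> > 2 * int (g + 1)" for m n
  proof -
    obtain i r where m: "r \<le> g" "m = blk g i r" by (rule blk_cases)
    obtain j s where n: "s \<le> g" "n = blk g j s" by (rule blk_cases)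
    have "i \<noteq> j" "i \<noteq> j - 1" "i \<noteq> j + 1" using that m n by (auto simp: blk_def algebra_simps)
    then show ?thesis by (simp add: m n a gmp_entry_def)
  qed
  ultimately obtain A where A: "bounded_op A" "\<And>m n. matrix_entry A m n = a m n"
    using banded_op_exists[of a K "2 * int (g + 1)"] by metis
  have "generated_by g c (\<lambda>_. p) (\<lambda>_. q) A"
    unfolding generated_by_def using A p a by (simp add: blk_def)
  then show ?thesis by (rule that)
qed

section \<open>Banded operators whose outermost diagonal lives on one residue class\<close>

text \<open>The shape shared by \<open>A\<close>, with residue g, and by the resolvent at
  \<open>c k\<close>, with residue k - 1. Together these g + 1 operators cover every residue class
  modulo g + 1.\<close>

definition corner_op :: "int \<Rightarrow> int \<Rightarrow> (ell2 \<Rightarrow> ell2) \<Rightarrow> bool" where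
  "corner_op N \<rho> T \<longleftrightarrow> bounded_op T \<and> (\<forall>m n. matrix_entry T m n = matrix_entry T n m) \<and>
    (\<forall>m n. matrix_entry T m n \<in> \<real>) \<and>
    (\<forall>m n. \<bar>m - n\<bar> > N \<longrightarrow> matrix_entry T m n = 0) \<and>
    (\<forall>m. m mod N \<noteq> \<rho> \<longrightarrow> matrix_entry T m (m + N) = 0) \<and>
    (\<forall>m. m mod N = \<rho> \<longrightarrow> (\<exists>t>0. matrix_entry T m (m + N) = complex_of_real t))"

lemma corner_opD:
  assumes "corner_op N \<rho> T"
  shows "bounded_op T" "matrix_entry T m n = matrix_entry T n m"
    "\<bar>m - n\<bar> > N \<Longrightarrow> matrix_entry T m n = 0"
    "m mod N \<noteq> \<rho> \<Longrightarrow> matrix_entry T m (m + N) = 0"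
    "m mod N = \<rho> \<Longrightarrow> \<exists>t>0. matrix_entry T m (m + N) = complex_of_real t"
    "matrix_entry T m n \<in> \<real>"
  using assms by (auto simp: corner_op_def)

lemma generated_by_corner_op:
  assumes A: "generated_by g c p q A"
  shows "corner_op (int (g + 1)) (int g) A"
  unfolding corner_op_def
proof (intro conjI allI impI)
  show "bounded_op A" using A by (simp add: generated_by_def)
  fix m n
  obtain i r where m: "r \<le> g" "m = blk g i r" by (rule blk_cases)
  obtain j s where n: "s \<le> g" "n = blk g j s" by (rule blk_cases)
  show "matrix_entry A m n = matrix_entry A n m"
    by (simp add: m n matrix_entry_blk[OF A] gmp_entry_sym)
  show "matrix_entry A m n \<in> \<real>"
    by (simp add: m n matrix_entry_blk[OF A])
  show "matrix_entry A m n = 0" if "\<bar>m - n\<bar> > int (g + 1)"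
  proof -
    have "i \<noteq> j" "i = j - 1 \<Longrightarrow> r \<noteq> g" "i = j + 1 \<Longrightarrow> s \<noteq> g"
      using that m n by (auto simp: blk_def algebra_simps)
    then show ?thesis by (auto simp: m n matrix_entry_blk[OF A] gmp_entry_def A_block_def outer_def)
  qed
  have e: "matrix_entry A m (m + int (g + 1)) = complex_of_real (if r = g then p (i + 1) r else 0)"
    unfolding m(2) blk_add_period matrix_entry_blk[OF A m(1) m(1)]
    by (simp add: gmp_entry_def A_block_def outer_def)
  show "matrix_entry A m (m + int (g + 1)) = 0" if "m mod int (g + 1) \<noteq> int g"
    using that unfolding e unfolding m(2) by (subst (asm) blk_mod) (use m in auto)
  show "\<exists>t>0. matrix_entry A m (m + int (g + 1)) = complex_of_real t" if "m mod int (g + 1) = int g"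
  proof -
    have "r = g" using that unfolding m(2) by (subst (asm) blk_mod) (use m in auto)
    then show ?thesis unfolding e using A by (auto simp: generated_by_def)
  qed
qed

definition unshift :: "nat \<Rightarrow> (ell2 \<Rightarrow> ell2) \<Rightarrow> ell2 \<Rightarrow> ell2" where
  "unshift k T = (inv shift_op ^^ k) \<circ> T \<circ> (shift_op ^^ k)"

lemma matrix_entry_unshift:
  "matrix_entry (unshift k T) m n = matrix_entry T (m + int k) (n + int k)"
  by (simp add: unshift_def matrix_entry_def)

text \<open>Undoing the shift moves the residue g to g + k, which is k - 1 modulo g + 1.\<close>

lemma class_A_unshift_corner_op:
  assumes T: "bounded_op T" "unshift k T \<in> class_A g c" and k: "k \<in> {1..g}"
  shows "corner_op (int (g + 1)) (int k - 1) T"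
proof -
  let ?N = "int (g + 1)" and ?U = "unshift k T"
  obtain p q where "generated_by g c p q ?U" using T by (auto simp: class_A_def)
  then have U: "corner_op ?N (int g) ?U" by (rule generated_by_corner_op)
  have e: "matrix_entry T m n = matrix_entry ?U (m - int k) (n - int k)" for m n
    by (simp add: matrix_entry_unshift)
  have md: "(m - int k) mod ?N = int g \<longleftrightarrow> m mod ?N = int k - 1" for m
  proof -
    have "(m - int k) mod ?N = int g \<longleftrightarrow> (m - int k) mod ?N = int g mod ?N" by simp
    also have "\<dots> \<longleftrightarrow> m mod ?N = (int k - 1) mod ?N"
    proof -
      have "m - (int k - 1) = (m - int k - int g) + ?N" by simp
      then show ?thesis unfolding mod_eq_dvd_iff by (metis dvd_add_triv_right_iff)
    qed
    also have "(int k - 1) mod ?N = int k - 1" by (rule mod_pos_pos_trivial) (use k in auto)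
    finally show ?thesis .
  qed
  have s: "m + ?N - int k = m - int k + ?N" for m by simp
  show ?thesis
    unfolding corner_op_def e s
    using corner_opD[OF U] T(1) md by (auto simp del: of_nat_add)
qed

section \<open>The monodromy matrix\<close>

lemma matrix_mult_bilinear:
  fixes A B C :: "real^2^2"
  shows "(A + B) ** C = A ** C + B ** C" "A ** (B + C) = A ** B + A ** C"
    "(A - B) ** C = A ** C - B ** C" "A ** (B - C) = A ** B - A ** C"
    "(r *\<^sub>R A) ** C = r *\<^sub>R (A ** C)" "A ** (r *\<^sub>R C) = r *\<^sub>R (A ** C)"
    "(- A) ** C = - (A ** C)" "A ** (- C) = - (A ** C)"
  by (simp_all add: vec_eq_iff matrix_matrix_mult_def sum_2 algebra_simps)

lemma matrix_mult_sum_left: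
  fixes A :: "'i \<Rightarrow> real^2^2"
  shows "(\<Sum>i\<in>I. A i) ** C = (\<Sum>i\<in>I. A i ** C)"
  by (simp add: vec_eq_iff matrix_matrix_mult_def sum_2 sum_distrib_right sum.distrib)

lemma trace_2: "trace (A :: real^2^2) = A$1$1 + A$2$2"
  by (simp add: trace_def sum_2)

lemma trace_linear:
  fixes A :: "real^2^2" and B :: "'i \<Rightarrow> real^2^2"
  shows "trace (r *\<^sub>R A) = r * trace A" "trace (\<Sum>i\<in>I. B i) = (\<Sum>i\<in>I. trace (B i))"
    "trace (- A) = - trace A"
  by (simp_all add: trace_2 algebra_simps sum.distrib)

definition mprod :: "(nat \<Rightarrow> real^2^2) \<Rightarrow> nat \<Rightarrow> nat \<Rightarrow> real^2^2" where
  "mprod f a b = mat_prod_list (map f [a..<b])"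

lemma mat_prod_list_append: "mat_prod_list (xs @ ys) = mat_prod_list xs ** mat_prod_list ys"
  by (induction xs) (simp_all add: mat_prod_list_def matrix_mul_assoc)

lemma mprod_simps:
  "mprod f a a = mat 1" "a \<le> b \<Longrightarrow> mprod f a (Suc b) = mprod f a b ** f b"
  by (simp_all add: mprod_def mat_prod_list_append) (simp_all add: mat_prod_list_def)

lemma det_mprod:
  assumes "\<And>j. det (f j) = 1" "a \<le> b"
  shows "det (mprod f a b) = 1"
  using assms(2) by (induction b rule: dec_induct) (simp_all add: mprod_simps det_mul assms(1))

section \<open>Partial fractions of products of elementary factors\<close>

context
  fixes d :: "nat \<Rightarrow> real" and P :: "nat \<Rightarrow> real^2^2"
begin

definition elem_factor :: "real \<Rightarrow> nat \<Rightarrow> real^2^2" where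
  "elem_factor z j = mat 1 - (1 / (d j - z)) *\<^sub>R P j"

text \<open>The coefficient of 1/(d_k - z) in the product of the first n factors: factor k
  contributes \<open>- P k\<close>, and the other factors are evaluated at
  \<open>d k\<close>.\<close>

definition prod_residue :: "nat \<Rightarrow> nat \<Rightarrow> real^2^2" where
  "prod_residue n k =
    - (mprod (elem_factor (d k)) 0 k ** P k ** mprod (elem_factor (d k)) (Suc k) n)"

lemma prod_residue_Suc:
  "k < n \<Longrightarrow> prod_residue (Suc n) k =
    prod_residue n k - (1 / (d n - d k)) *\<^sub>R (prod_residue n k ** P n)"
  by (simp add: prod_residue_def mprod_simps elem_factor_def matrix_mult_bilinear matrix_mul_assoc)

text \<open>Induction on the number of factors. The point \<open>z\<close> stays arbitrary because
  the residue at the new pole contains the shorter product evaluated at \<open>d n\<close>, which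
  the induction hypothesis expands as well.\<close>

lemma mprod_partial_fractions:
  assumes "inj_on d {..<n}" "\<And>j. j < n \<Longrightarrow> d j \<noteq> z"
  shows "mprod (elem_factor z) 0 n = mat 1 + (\<Sum>k<n. (1 / (d k - z)) *\<^sub>R prod_residue n k)"
  using assms
proof (induction n arbitrary: z)
  case (Suc n)
  define X where "X k = prod_residue n k ** P n" for k
  have inj: "inj_on d {..<n}" using Suc.prems(1) by (rule inj_on_subset) auto
  have ne: "d k \<noteq> d n" if "k < n" for k
    using Suc.prems(1) that by (auto dest: inj_onD)
  have last: "prod_residue (Suc n) n = - P n - (\<Sum>k<n. (1 / (d k - d n)) *\<^sub>R X k)"
    using Suc.IH[OF inj, of "d n"] ne
    by (simp add: prod_residue_def mprod_simps matrix_mult_bilinear matrix_mult_sum_left X_def)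
  have split: "- ((1 / (d k - z)) * (1 / (d n - z))) *\<^sub>R X k =
      (1 / (d k - z)) *\<^sub>R (- ((1 / (d n - d k)) *\<^sub>R X k))
      + (1 / (d n - z)) *\<^sub>R (- ((1 / (d k - d n)) *\<^sub>R X k))" if "k < n" for k
  proof -
    have *: "- ((1 / (d k - z)) * (1 / (d n - z))) =
        - (1 / (d k - z)) * (1 / (d n - d k)) - (1 / (d n - z)) * (1 / (d k - d n))"
      using ne[OF that] Suc.prems(2)[of k] Suc.prems(2)[of n] that
      by (simp add: divide_simps) (simp add: algebra_simps)
    show ?thesis unfolding * by (simp add: scaleR_diff_left)
  qed
  have "mprod (elem_factor z) 0 (Suc n) =
      (mat 1 + (\<Sum>k<n. (1 / (d k - z)) *\<^sub>R prod_residue n k)) ** (mat 1 - (1 / (d n - z)) *\<^sub>R P n)"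
    using Suc.IH[OF inj, of z] Suc.prems(2) by (simp add: mprod_simps elem_factor_def[of z n])
  also have "\<dots> = mat 1 - (1 / (d n - z)) *\<^sub>R P n + (\<Sum>k<n. (1 / (d k - z)) *\<^sub>R prod_residue n k)
      + (\<Sum>k<n. - ((1 / (d k - z)) * (1 / (d n - z))) *\<^sub>R X k)"
    by (simp add: matrix_mult_bilinear matrix_mult_sum_left X_def scaleR_sum_right sum_negf
        scaleR_add_right mult.commute)
  also have "(\<Sum>k<n. - ((1 / (d k - z)) * (1 / (d n - z))) *\<^sub>R X k) =
      (\<Sum>k<n. (1 / (d k - z)) *\<^sub>R (- ((1 / (d n - d k)) *\<^sub>R X k))
        + (1 / (d n - z)) *\<^sub>R (- ((1 / (d k - d n)) *\<^sub>R X k)))"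
    by (intro sum.cong refl split) simp
  also have "\<dots> = (\<Sum>k<n. (1 / (d k - z)) *\<^sub>R (- ((1 / (d n - d k)) *\<^sub>R X k)))
      + (1 / (d n - z)) *\<^sub>R (- (\<Sum>k<n. (1 / (d k - d n)) *\<^sub>R X k))"
    by (simp only: sum.distrib scaleR_sum_right sum_negf[symmetric])
  also have "mat 1 - (1 / (d n - z)) *\<^sub>R P n + (\<Sum>k<n. (1 / (d k - z)) *\<^sub>R prod_residue n k) + \<dots> =
      mat 1 + (\<Sum>k<n. (1 / (d k - z)) *\<^sub>R (prod_residue n k - (1 / (d n - d k)) *\<^sub>R X k))
      + (1 / (d n - z)) *\<^sub>R prod_residue (Suc n) n"
    unfolding last by (simp add: scaleR_right_diff_distrib sum_subtractf sum_negf)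
  also have "\<dots> = mat 1 + (\<Sum>k<Suc n. (1 / (d k - z)) *\<^sub>R prod_residue (Suc n) k)"
    by (simp add: prod_residue_Suc X_def)
  finally show ?case .
qed (simp add: mprod_simps)

text \<open>This compares the terms of order 1/z at infinity in the expansion above. In the
  induction, the corrections to the old residues cancel against the sum contained in the new
  one.\<close>

lemma sum_prod_residue:
  assumes "inj_on d {..<n}"
  shows "(\<Sum>k<n. prod_residue n k) = - (\<Sum>k<n. P k)"
  using assms
proof (induction n)
  case (Suc n)
  have inj: "inj_on d {..<n}" using Suc.prems(1) by (rule inj_on_subset) auto
  have ne: "d k \<noteq> d n" if "k < n" for k
    using Suc.prems(1) that by (auto dest: inj_onD)
  have "prod_residue (Suc n) n =
      - P n - (\<Sum>k<n. (1 / (d k - d n)) *\<^sub>R (prod_residue n k ** P n))"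
    using mprod_partial_fractions[OF inj, of "d n"] ne
    by (simp add: prod_residue_def mprod_simps matrix_mult_bilinear matrix_mult_sum_left)
  moreover have "(\<Sum>k<n. prod_residue (Suc n) k) = (\<Sum>k<n. prod_residue n k)
      + (\<Sum>k<n. (1 / (d k - d n)) *\<^sub>R (prod_residue n k ** P n))"
  proof -
    have "prod_residue (Suc n) k = prod_residue n k
        + (1 / (d k - d n)) *\<^sub>R (prod_residue n k ** P n)" if "k < n" for k
    proof -
      have "1 / (d k - d n) = - (1 / (d n - d k))" using ne[OF that] by (simp add: divide_simps)
      then show ?thesis using prod_residue_Suc[OF that] by simp
    qed
    then show ?thesis by (simp add: sum.distrib)
  qed
  ultimately show ?case using Suc.IH[OF inj] by simp
qed simp

end

section \<open>Transfer matrices of the nodes and the trace of the monodromy matrix\<close>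

lemma pp_j_entries:
  "pp_j p q $ 1 $ 1 = p * q" "pp_j p q $ 1 $ 2 = - (p * p)"
  "pp_j p q $ 2 $ 1 = q * q" "pp_j p q $ 2 $ 2 = - (q * p)"
  by (simp_all add: pp_j_def frak_j_def matrix_matrix_mult_def sum_2 vector_2)

lemma a_fin_entries:
  "a_fin z c p q $ 1 $ 1 = 1 - p * q / (c - z)" "a_fin z c p q $ 1 $ 2 = p * p / (c - z)"
  "a_fin z c p q $ 2 $ 1 = - (q * q / (c - z))" "a_fin z c p q $ 2 $ 2 = 1 + q * p / (c - z)"
  by (simp_all add: a_fin_def pp_j_entries mat_def)

lemma a_inf_entries:
  "a_inf z p q $ 1 $ 1 = 0" "a_inf z p q $ 1 $ 2 = - p"
  "a_inf z p q $ 2 $ 1 = 1 / p" "a_inf z p q $ 2 $ 2 = (z - p * q) / p"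
  by (simp_all add: a_inf_def vector_2)

lemma det_a_fin: "det (a_fin z c p q) = 1"
  by (simp add: det_2 a_fin_entries algebra_simps)

lemma det_a_inf: "p \<noteq> 0 \<Longrightarrow> det (a_inf z p q) = 1"
  by (simp add: det_2 a_inf_entries)

definition partial_prod :: "(nat \<Rightarrow> real) \<Rightarrow> (nat \<Rightarrow> real) \<Rightarrow> (nat \<Rightarrow> real) \<Rightarrow> real \<Rightarrow> nat \<Rightarrow> real^2^2"
  where "partial_prod c p q z = mprod (\<lambda>j. a_fin z (c (j + 1)) (p j) (q j)) 0"

definition monodromy ::
  "nat \<Rightarrow> (nat \<Rightarrow> real) \<Rightarrow> (nat \<Rightarrow> real) \<Rightarrow> (nat \<Rightarrow> real) \<Rightarrow> real \<Rightarrow> real^2^2" where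
  "monodromy g c p q z = partial_prod c p q z g ** a_inf z (p g) (q g)"

lemma det_monodromy: "p g \<noteq> 0 \<Longrightarrow> det (monodromy g c p q z) = 1"
  by (simp add: monodromy_def partial_prod_def det_mul det_mprod det_a_fin det_a_inf)

text \<open>The last factor \<open>a_inf\<close> is affine in \<open>z\<close> with slope
  \<open>E\<close>. Replacing \<open>z\<close> by the pole in the term 1/(d_j - z) gives
  \<open>Lam\<close> as its coefficient and leaves the constant \<open>- (R j ** E)\<close>; these
  constants add up by \<open>sum_prod_residue\<close>.\<close>

lemma trace_monodromy:
  assumes p: "p g \<noteq> 0" and inj: "inj_on c {1..g}" and z: "z \<notin> c ` {1..g}"
  shows "trace (monodromy g c p q z) =
    1 / p g * z + (- q g - 1 / p g * (\<Sum>j=0..<g. p j * q j)) + (\<Sum>k=1..g. Lam g c k p q / (c k - z))"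
proof -
  define d where "d j = c (j + 1)" for j
  define P where "P j = pp_j (p j) (q j)" for j
  define R where "R = prod_residue d P g"
  define E :: "real^2^2" where "E = vector [vector [0, 0], vector [0, 1 / p g]]"
  have fin: "(\<lambda>j. a_fin x (c (j + 1)) (p j) (q j)) = elem_factor d P x" for x
    by (simp add: fun_eq_iff elem_factor_def a_fin_def d_def P_def)
  have dinj: "inj_on d {..<g}"
  proof (rule inj_onI)
    fix i j assume "i \<in> {..<g}" "j \<in> {..<g}" "d i = d j"
    then show "i = j" using inj_onD[OF inj, of "i + 1" "j + 1"] by (simp add: d_def)
  qed
  have dz: "d j \<noteq> z" if "j < g" for j using z that by (auto simp: d_def)
  have ainf: "a_inf z (p g) (q g) = a_inf x (p g) (q g) + (z - x) *\<^sub>R E" for x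
    by (simp add: vec_eq_iff forall_2 a_inf_entries E_def vector_2 diff_divide_distrib)
  have Lam: "Lam g c (Suc j) p q = trace (R j ** a_inf (d j) (p g) (q g))" if "j < g" for j
  proof -
    have dj: "d j = c (Suc j)" by (simp add: d_def)
    show ?thesis
      unfolding Lam_def fin R_def prod_residue_def
      by (simp add: dj mprod_def P_def matrix_mult_bilinear trace_linear)
  qed
  have "trace (monodromy g c p q z) = trace (a_inf z (p g) (q g))
      + (\<Sum>j<g. 1 / (d j - z) * trace (R j ** a_inf z (p g) (q g)))"
    unfolding monodromy_def partial_prod_def fin R_def
    by (subst mprod_partial_fractions[OF dinj dz])
      (simp_all add: matrix_mult_bilinear matrix_mult_sum_left trace_linear trace_add)
  also have "(\<Sum>j<g. 1 / (d j - z) * trace (R j ** a_inf z (p g) (q g))) =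
      (\<Sum>j<g. Lam g c (Suc j) p q / (d j - z) - trace (R j ** E))"
  proof (rule sum.cong)
    fix j assume "j \<in> {..<g}"
    then have j: "j < g" by simp
    have "trace (R j ** a_inf z (p g) (q g)) = Lam g c (Suc j) p q + (z - d j) * trace (R j ** E)"
      unfolding Lam[OF j] by (subst ainf[of "d j"])
        (simp add: matrix_mult_bilinear trace_linear trace_add)
    then show "1 / (d j - z) * trace (R j ** a_inf z (p g) (q g)) =
        Lam g c (Suc j) p q / (d j - z) - trace (R j ** E)"
      using dz[OF j] by (simp add: field_simps)
  qed simp
  also have "\<dots> = (\<Sum>j<g. Lam g c (Suc j) p q / (d j - z)) - trace ((\<Sum>j<g. R j) ** E)"
    by (simp add: sum_subtractf matrix_mult_sum_left trace_linear)
  also have "(\<Sum>j<g. Lam g c (Suc j) p q / (d j - z)) = (\<Sum>k=1..g. Lam g c k p q / (c k - z))"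
    by (rule sum.reindex_bij_witness[of _ "\<lambda>k. k - 1" Suc]) (auto simp: d_def)
  also have "trace ((\<Sum>j<g. R j) ** E) = 1 / p g * (\<Sum>j=0..<g. p j * q j)"
  proof -
    have "trace (P j ** E) = - (1 / p g * (p j * q j))" for j
      by (simp add: trace_2 matrix_matrix_mult_def sum_2 E_def vector_2 P_def pp_j_entries)
    then show ?thesis
      unfolding R_def sum_prod_residue[OF dinj]
      by (simp add: matrix_mult_bilinear matrix_mult_sum_left trace_linear sum_negf
          atLeast0LessThan sum_divide_distrib)
  qed
  finally show ?thesis
    using p by (simp add: trace_2 a_inf_entries diff_divide_distrib)
qed

text \<open>One period of the state equations of A x = z x for a solution whose j-th block is
  \<open>w\<close> to the power j times \<open>\<xi>\<close>. The first equation holds because the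
  state \<open>al\<close> at the start of a block is the last entry of the preceding block.\<close>

definition floquet_state ::
  "nat \<Rightarrow> (nat \<Rightarrow> real) \<Rightarrow> (nat \<Rightarrow> real) \<Rightarrow> (nat \<Rightarrow> real) \<Rightarrow> real \<Rightarrow> complex \<Rightarrow>
    (nat \<Rightarrow> complex) \<Rightarrow> (nat \<Rightarrow> complex) \<Rightarrow> (nat \<Rightarrow> complex) \<Rightarrow> bool" where
  "floquet_state g c p q z w al be \<xi> \<longleftrightarrow> w * al 0 = \<xi> g \<and> be g = p g * \<xi> g \<and>
    (\<forall>r<g. al (Suc r) = al r + q r * \<xi> r \<and> be (Suc r) = be r - p r * \<xi> r \<and>
      z * \<xi> r = c (Suc r) * \<xi> r + p r * al r + q r * be r) \<and>
    z * \<xi> g = p g * al g + q g * be g + w * be 0"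

lemma floquet_state_exists:
  fixes w :: complex
  assumes p: "p g \<noteq> 0" and z: "z \<notin> c ` {1..g}"
    and w: "w + 1 / w = complex_of_real (trace (monodromy g c p q z))" "w \<noteq> 0"
  obtains al be \<xi> where "floquet_state g c p q z w al be \<xi>" "\<exists>r\<le>g. \<xi> r \<noteq> 0"
proof -
  define M where "M = monodromy g c p q z"
  have det: "M$1$1 * M$2$2 - M$1$2 * M$2$1 = 1"
    using det_monodromy[of p g c q z] p by (simp add: M_def det_2)
  have chi: "w * w - (M$1$1 + M$2$2) * w + 1 = 0"
    using w by (simp add: trace_2 M_def field_simps)
  \<comment> \<open>A left eigenvector of \<open>M\<close> for the eigenvalue \<open>w\<close>:
    states are row vectors, multiplied by the transfer matrices from the right.\<close>
  obtain v1 v2 :: complex where v: "v1 \<noteq> 0 \<or> v2 \<noteq> 0" "v1 * M$1$1 + v2 * M$2$1 = w * v1"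
    "v1 * M$1$2 + v2 * M$2$2 = w * v2"
  proof -
    define m11 m12 m21 m22 where "m11 = complex_of_real (M$1$1)" "m12 = complex_of_real (M$1$2)"
      "m21 = complex_of_real (M$2$1)" "m22 = complex_of_real (M$2$2)"
    note m = this
    have detc: "m11 * m22 - m12 * m21 = 1"
      using arg_cong[OF det, of complex_of_real] by (simp add: m)
    have chic: "w * w - (m11 + m22) * w + 1 = 0" using chi by (simp add: m)
    note that = that[folded m]
    consider "m21 \<noteq> 0 \<or> w \<noteq> m11" | "m21 = 0" "w = m11" "w \<noteq> m22 \<or> m12 \<noteq> 0"
      | "m21 = 0" "w = m11" "w = m22" "m12 = 0" by blast
    then show thesis
    proof cases
      case 1
      have "m21 * m11 + (w - m11) * m21 = w * m21" by (simp add: algebra_simps)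
      moreover have "m21 * m12 + (w - m11) * m22 = w * (w - m11)" using chic detc by algebra
      ultimately show thesis using that[of m21 "w - m11"] 1 by simp
    next
      case 2
      have "(w - m22) * m12 + m12 * m22 = w * m12" by (simp add: algebra_simps)
      then show thesis using that[of "w - m22" m12] 2 by simp
    next
      case 3
      then show thesis using that[of 1 0] by simp
    qed
  qed
  define Q where "Q = partial_prod c p q z"
  have Q0: "Q 0 = mat 1" by (simp add: Q_def partial_prod_def mprod_simps)
  have QS: "Q (Suc r) = Q r ** a_fin z (c (r + 1)) (p r) (q r)" for r
    by (simp add: Q_def partial_prod_def mprod_simps)
  define al where "al r = v1 * Q r$1$1 + v2 * Q r$2$1" for r
  define be where "be r = v1 * Q r$1$2 + v2 * Q r$2$2" for r
  \<comment> \<open>The entries solve the node equations; the last one is read off from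
    \<open>be g = p g * \<xi> g\<close>.\<close>
  define \<xi> where "\<xi> r = (if r < g then (p r * al r + q r * be r) / (z - c (Suc r)) else be g / p g)" for r
  have M: "M = Q g ** a_inf z (p g) (q g)" by (simp add: M_def Q_def monodromy_def)
  have zc: "complex_of_real z - c (Suc r) \<noteq> 0" if "r < g" for r
    using z that by (auto simp flip: of_real_diff)
  have v0: "al 0 = v1" "be 0 = v2" by (simp_all add: al_def be_def Q0 mat_def)
  have stepa: "al (Suc r) = al r + q r * \<xi> r" and stepb: "be (Suc r) = be r - p r * \<xi> r" if "r < g" for r
  proof -
    define t where "t = 1 / (c (Suc r) - z)"
    have xi: "\<xi> r = - (t * (p r * al r + q r * be r))"
      using that zc[OF that] by (simp add: \<xi>_def t_def divide_simps) (simp add: algebra_simps)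
    have "al (Suc r) = al r * (1 - p r * q r * t) - be r * (q r * q r * t)"
      "be (Suc r) = al r * (p r * p r * t) + be r * (1 + q r * p r * t)"
      by (simp_all add: al_def be_def QS matrix_matrix_mult_def sum_2 a_fin_entries t_def algebra_simps)
    then show "al (Suc r) = al r + q r * \<xi> r" "be (Suc r) = be r - p r * \<xi> r"
      unfolding xi by (simp_all add: algebra_simps)
  qed
  have end1: "w * v1 = be g / p g"
    using v(2) by (simp add: M al_def be_def matrix_matrix_mult_def sum_2 a_inf_entries add_divide_distrib)
  have end2: "w * v2 = - (p g * al g) + be g * ((z - p g * q g) / p g)"
    using v(3) by (simp add: M al_def be_def matrix_matrix_mult_def sum_2 a_inf_entries algebra_simps)
  have x1: "w * al 0 = \<xi> g" by (simp add: v0 \<xi>_def end1)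
  have x2: "be g = p g * \<xi> g" using p by (simp add: \<xi>_def)
  have x3: "z * \<xi> r = c (Suc r) * \<xi> r + p r * al r + q r * be r" if "r < g" for r
  proof -
    have "(z - c (Suc r)) * \<xi> r = p r * al r + q r * be r"
      using that zc[OF that] by (simp add: \<xi>_def)
    then show ?thesis by (simp add: algebra_simps)
  qed
  have x4: "z * \<xi> g = p g * al g + q g * be g + w * be 0"
    unfolding v0 end2 using p by (simp add: \<xi>_def field_simps)
  have "floquet_state g c p q z w al be \<xi>"
    unfolding floquet_state_def using x1 x2 x3 x4 stepa stepb by simp
  moreover have "\<exists>r\<le>g. \<xi> r \<noteq> 0"
  proof (rule ccontr)
    assume "\<not> ?thesis"
    then have x0: "\<xi> r = 0" if "r \<le> g" for r using that by blast
    \<comment> \<open>Without input the state stays constant over the block, and the two equations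
      at its ends make it zero.\<close>
    have "al r = v1" "be r = v2" if "r \<le> g" for r
      using that by (induction r) (simp_all add: v0 stepa stepb x0)
    then have "v2 = 0" "v1 = 0"
      using x0[of g] p end1 w(2) by (auto simp: \<xi>_def)
    with v(1) show False by simp
  qed
  ultimately show ?thesis by (rule that)
qed

section \<open>Spectrum\<close>

lemma Im_pf_value:
  assumes "Im z \<noteq> 0"
  shows "Im (pf_value g l c z) = Im z * (l 0 + (\<Sum>j=1..g. l j / (cmod (complex_of_real (c j) - z))\<^sup>2))"
proof -
  have "Im (complex_of_real (l j) / (complex_of_real (c j) - z)) =
      Im z * (l j / (cmod (complex_of_real (c j) - z))\<^sup>2)" for j
    by (simp add: Im_divide cmod_power2)
  then show ?thesis
    by (simp add: pf_value_def sum_distrib_left algebra_simps)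
qed

text \<open>With positive coefficients the function is of Herglotz type: its imaginary part has the
  sign of that of \<open>z\<close>.\<close>

lemma pf_value_real_imp_real:
  assumes l: "\<And>j. j \<le> g \<Longrightarrow> l j > 0" and "Im (pf_value g l c z) = 0"
  shows "Im z = 0"
proof (rule ccontr)
  assume z: "Im z \<noteq> 0"
  have "0 \<le> l j / (cmod (complex_of_real (c j) - z))\<^sup>2" if "j \<in> {1..g}" for j
    using l[of j] that by simp
  then have "0 \<le> (\<Sum>j=1..g. l j / (cmod (complex_of_real (c j) - z))\<^sup>2)" by (rule sum_nonneg)
  with l[of 0] have "0 < l 0 + (\<Sum>j=1..g. l j / (cmod (complex_of_real (c j) - z))\<^sup>2)" by simp
  with assms(2) z show False unfolding Im_pf_value[OF z] by simp
qed

section \<open>The Joukowski map and the resolvent of \<open>free_op\<close>\<close>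

lemma joukowski_root:
  obtains w :: complex where "w \<noteq> 0" "w + 1 / w = d"
proof -
  define s where "s = csqrt (d\<^sup>2 / 4 - 1)"
  have s: "s * s = d\<^sup>2 / 4 - 1" by (simp add: s_def flip: power2_eq_square)
  have *: "(d / 2 + s) * (d / 2 - s) = 1" using s by (simp add: algebra_simps power2_eq_square)
  then have "d / 2 + s \<noteq> 0" by auto
  moreover from * this have "1 / (d / 2 + s) = d / 2 - s" by (simp add: field_simps)
  ultimately show ?thesis using that[of "d / 2 + s"] by simp
qed

lemma joukowski_unit_circle:
  fixes w :: complex
  assumes "w \<noteq> 0"
  shows "w + 1 / w \<in> complex_of_real ` {-2..2} \<longleftrightarrow> cmod w = 1"
proof
  assume w: "cmod w = 1"
  have "w * cnj w = 1" using w complex_norm_square[of w] by simp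
  then have "1 / w = cnj w" using assms by (simp add: field_simps)
  then have "w + 1 / w = complex_of_real (2 * Re w)" by (simp add: complex_add_cnj)
  moreover have "2 * Re w \<in> {-2..2}" using abs_Re_le_cmod[of w] w by auto
  ultimately show "w + 1 / w \<in> complex_of_real ` {-2..2}" by blast
next
  assume "w + 1 / w \<in> complex_of_real ` {-2..2}"
  then obtain t where t: "w + 1 / w = complex_of_real t" "-2 \<le> t" "t \<le> 2" by auto
  have eq: "w * w - t * w + 1 = 0" using t(1) assms by (simp add: field_simps)
  have re: "Re w * Re w - Im w * Im w - t * Re w + 1 = 0" and im: "2 * Re w * Im w = t * Im w"
    using arg_cong[OF eq, of Re] arg_cong[OF eq, of Im] by (simp_all add: algebra_simps)
  have "(Re w)\<^sup>2 + (Im w)\<^sup>2 = 1"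
  proof (cases "Im w = 0")
    case True
    then have q: "Re w * Re w - t * Re w + 1 = 0" using re by simp
    \<comment> \<open>A real root needs a nonnegative discriminant, which for t in [-2, 2] leaves
      only t = 2 and t = -2.\<close>
    have "(Re w - t / 2)\<^sup>2 = t\<^sup>2 / 4 - 1" using q by (simp add: power2_eq_square algebra_simps)
    moreover have "t\<^sup>2 \<le> 4" using t abs_le_square_iff[of t 2] by auto
    ultimately have "(Re w - t / 2)\<^sup>2 = 0" "t\<^sup>2 = 4"
      using zero_le_power2[of "Re w - t / 2"] by linarith+
    then have rw: "Re w = t / 2" by simp
    have "(Re w)\<^sup>2 = t\<^sup>2 / 4" unfolding rw by (simp add: power_divide)
    then show ?thesis using True \<open>t\<^sup>2 = 4\<close> by (simp add: power_divide)
  next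
    case False
    then have "t = 2 * Re w" using im by simp
    then show ?thesis using re by (simp add: power2_eq_square)
  qed
  then show "cmod w = 1" by (simp add: cmod_def)
qed

definition free_op :: "nat \<Rightarrow> ell2 \<Rightarrow> ell2" where
  "free_op n x = (shift_op ^^ n) x + (inv shift_op ^^ n) x"

lemma bounded_op_free_op: "bounded_op (free_op n)"
  unfolding free_op_def[abs_def] by (intro bounded_op_add bounded_op_shift_pow)

text \<open>Since \<open>w\<close> and \<open>1 / w\<close> have the same image \<open>d\<close>,
  and modulus 1 is excluded by the hypothesis, \<open>w\<close> can be taken inside the unit disc;
  both factors of \<open>d - free_op n\<close> are then perturbations of the identity by
  contractions.\<close>

lemma free_op_resolvent:
  assumes d: "d \<notin> complex_of_real ` {-2..2}"
  shows "boundedly_invertible (\<lambda>x. d *\<^sub>C x - free_op n x)"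
proof -
  obtain w where w: "w \<noteq> 0" "w + 1 / w = d" "cmod w < 1"
  proof -
    obtain w where w: "w \<noteq> 0" "w + 1 / w = d" by (rule joukowski_root)
    then have "cmod w \<noteq> 1" using joukowski_unit_circle[of w] d by auto
    then consider "cmod w < 1" | "cmod (1 / w) < 1"
      using w by (cases "cmod w < 1") (auto simp: norm_divide divide_simps)
    then show thesis
      by cases (use that[of w] that[of "1 / w"] w in \<open>auto simp: add.commute\<close>)
  qed
  have inv1: "boundedly_invertible (\<lambda>x. x - w *\<^sub>C (shift_op ^^ n) x)"
    and inv2: "boundedly_invertible (\<lambda>x. x - w *\<^sub>C (inv shift_op ^^ n) x)"
    using w(3) by (auto intro!: boundedly_invertible_contraction[of _ "cmod w"] bounded_op_scaleC
        bounded_op_shift_pow mult_left_mono norm_shift_pow_le)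
  have inv3: "boundedly_invertible (\<lambda>x. (1 / w) *\<^sub>C x)"
    by (rule boundedly_invertibleI[of "\<lambda>x. w *\<^sub>C x"])
      (use w in \<open>auto intro: bounded_op_scaleC bounded_op_id simp: scaleC_algebra\<close>)
  have "(1 / w) *\<^sub>C (x - w *\<^sub>C (inv shift_op ^^ n) x - w *\<^sub>C (shift_op ^^ n) (x - w *\<^sub>C (inv shift_op ^^ n) x)) =
      d *\<^sub>C x - free_op n x" for x
  proof -
    have key: "(1 / w) * (a - w * b - w * (e - w * a)) = d * a - (e + b)" for a b e
      unfolding w(2)[symmetric] using w(1) by (simp add: field_simps)
    show ?thesis
      by (rule ell2_eqI) (simp only: Rep_ell2_simps Rep_ell2_shift_pow free_op_def diff_add_cancel key)
  qed
  with boundedly_invertible_comp[OF inv3 boundedly_invertible_comp[OF inv1 inv2]]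
  show ?thesis by simp
qed

lemma shifted_minus_inv:
  assumes "boundedly_invertible (shifted_minus t A)"
  shows "bounded_op (inv (shifted_minus t A))"
    "A (inv (shifted_minus t A) x) = t *\<^sub>R inv (shifted_minus t A) x - x"
    "bounded_op A \<Longrightarrow> inv (shifted_minus t A) (A x) = t *\<^sub>R inv (shifted_minus t A) x - x"
proof -
  note R = boundedly_invertibleD[OF assms]
  show "bounded_op (inv (shifted_minus t A))" by (rule R)
  show "A (inv (shifted_minus t A) x) = t *\<^sub>R inv (shifted_minus t A) x - x"
    using R(3)[of x] unfolding shifted_minus_def by (simp add: algebra_simps)
  have "x = inv (shifted_minus t A) (shifted_minus t A x)" using R(2) by simp
  also have "shifted_minus t A x = t *\<^sub>R x - A x" by (simp add: shifted_minus_def)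
  finally show "inv (shifted_minus t A) (A x) = t *\<^sub>R inv (shifted_minus t A) x - x"
    by (simp add: bounded_opD[OF R(1)] algebra_simps)
qed

lemma spectrum_subset:
  assumes A: "bounded_op A" and R: "\<And>k. k \<in> {1..g} \<Longrightarrow> boundedly_invertible (shifted_minus (c k) A)"
    and magic: "pf_op g l c A = free_op n"
    and z: "z \<in> spectrum A"
  shows "z \<notin> complex_of_real ` c ` {1..g}" "pf_value g l c z \<in> complex_of_real ` {-2..2}"
proof -
  have "boundedly_invertible (\<lambda>x. complex_of_real (c k) *\<^sub>C x - A x)" if "k \<in> {1..g}" for k
    using R[OF that] by (simp add: shifted_minus_def[abs_def] scaleR_scaleC)
  with z show zc: "z \<notin> complex_of_real ` c ` {1..g}" by (auto simp: spectrum_def)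
  show "pf_value g l c z \<in> complex_of_real ` {-2..2}"
  proof (rule ccontr)
    assume "\<not> ?thesis"
    from free_op_resolvent[OF this, of n]
    have D: "boundedly_invertible (\<lambda>x. pf_value g l c z *\<^sub>C x - pf_op g l c A x)"
      unfolding magic .
    let ?R = "\<lambda>k. inv (shifted_minus (c k) A)"
    \<comment> \<open>The divided difference of f at \<open>z\<close> and \<open>A\<close>: each
      pole term satisfies 1/(c - z) - 1/(c - A) = (z - A) / ((c - z) (c - A)).\<close>
    define K where "K x = l 0 *\<^sub>R x + (\<Sum>k=1..g. (l k / (c k - z)) *\<^sub>C ?R k x)" for x
    have K: "bounded_op K"
      unfolding K_def[abs_def] using shifted_minus_inv(1)[OF R] by (intro bounded_op_intros) auto
    have term1: "(l k / (c k - z)) *\<^sub>C (z *\<^sub>C ?R k x - A (?R k x)) =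
        (l k / (c k - z)) *\<^sub>C x - l k *\<^sub>R ?R k x" if k: "k \<in> {1..g}" for k x
    proof -
      have "c k - z \<noteq> 0" using zc k by auto
      then show ?thesis unfolding shifted_minus_inv(2)[OF R[OF k]]
        by (intro ell2_eqI) (simp add: field_simps)
    qed
    have "z *\<^sub>C K x - A (K x) = pf_value g l c z *\<^sub>C x - pf_op g l c A x" for x
    proof -
      have "z *\<^sub>C K x - A (K x) = l 0 *\<^sub>R (z *\<^sub>C x - A x)
          + (\<Sum>k=1..g. (l k / (c k - z)) *\<^sub>C (z *\<^sub>C ?R k x - A (?R k x)))"
        unfolding K_def
        by (rule ell2_eqI) (simp add: bounded_opD[OF A] scaleR_scaleC scaleC_algebra scaleC_sum
            sum_subtractf sum_distrib_left algebra_simps)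
      also have "(\<Sum>k=1..g. (l k / (c k - z)) *\<^sub>C (z *\<^sub>C ?R k x - A (?R k x))) =
          (\<Sum>k=1..g. (l k / (c k - z)) *\<^sub>C x - l k *\<^sub>R ?R k x)"
        by (rule sum.cong) (simp_all only: term1)
      also have "l 0 *\<^sub>R (z *\<^sub>C x - A x) + \<dots> = pf_value g l c z *\<^sub>C x - pf_op g l c A x"
        by (rule ell2_eqI) (simp add: pf_value_def pf_op_def sum_subtractf algebra_simps
            sum_distrib_left sum_distrib_right)
      finally show ?thesis .
    qed
    moreover have "K (z *\<^sub>C x - A x) = z *\<^sub>C K x - A (K x)" for x
    proof -
      have "K (A x) = A (K x)"
        unfolding K_def using shifted_minus_inv(2,3)[OF R] A
        by (simp add: bounded_opD[OF A])
      then show ?thesis by (simp add: bounded_opD[OF K])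
    qed
    ultimately have "boundedly_invertible (\<lambda>x. z *\<^sub>C x - A x)"
      by (intro boundedly_invertible_factor[OF D K]) simp_all
    with z show False by (simp add: spectrum_def)
  qed
qed

text \<open>The sequence is not in \<open>ell2\<close>, so the eigenvalue equation is stated
  locally, for every vector that agrees with it near \<open>m\<close>. The radius 2 (g + 1) covers
  the block of \<open>m\<close> and its two neighbours.\<close>

lemma floquet_sequence:
  assumes A: "generated_by g c (\<lambda>_. p) (\<lambda>_. q) A" and z: "z \<notin> c ` {1..g}"
    and w: "w + 1 / w = complex_of_real (trace (monodromy g c p q z))" "w \<noteq> 0"
  obtains \<xi> :: "int \<Rightarrow> complex" where "\<forall>n. \<xi> (n + int (g + 1)) = w * \<xi> n" "\<exists>n. \<xi> n \<noteq> 0"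
    "\<forall>x m. (\<forall>n. \<bar>n - m\<bar> \<le> 2 * int (g + 1) \<longrightarrow> Rep_ell2 x n = \<xi> n) \<longrightarrow>
      Rep_ell2 (A x) m = z * \<xi> m"
proof -
  have p: "p g \<noteq> 0" using A by (auto simp: generated_by_def)
  obtain al be xi where st: "floquet_state g c p q z w al be xi" and nz: "\<exists>r\<le>g. xi r \<noteq> 0"
    using floquet_state_exists[of p g z c w q, OF p z w] .
  have f: "w * al 0 = xi g" "\<And>r. r < g \<Longrightarrow> al (Suc r) = al r + q r * xi r"
    "\<And>r. r < g \<Longrightarrow> be (Suc r) = be r - p r * xi r" "be g = p g * xi g"
    "\<And>r. r < g \<Longrightarrow> z * xi r = c (Suc r) * xi r + p r * al r + q r * be r"
    "z * xi g = p g * al g + q g * be g + w * be 0"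
    using st by (simp_all add: floquet_state_def)
  define \<xi> where "\<xi> n = w powi (n div int (g + 1)) * xi (nat (n mod int (g + 1)))" for n
  have \<xi>: "\<xi> (blk g j r) = w powi j * xi r" if "r \<le> g" for j r
    unfolding \<xi>_def using that by (simp only: blk_div blk_mod nat_int)
  have wj: "w powi (j + 1) = w * w powi j" for j
    using w(2) by (simp add: power_int_add mult.commute)
  show ?thesis
  proof (rule that; (intro allI impI)?)
    show "\<xi> (n + int (g + 1)) = w * \<xi> n" for n
    proof -
      obtain j r where n: "r \<le> g" "n = blk g j r" by (rule blk_cases)
      show ?thesis unfolding n(2) blk_add_period \<xi>[OF n(1)] wj by simp
    qed
    obtain r where "r \<le> g" "xi r \<noteq> 0" using nz by blast
    then have "\<xi> (blk g 0 r) \<noteq> 0" using w(2) by (simp add: \<xi>)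
    then show "\<exists>n. \<xi> n \<noteq> 0" ..
    fix x m assume x: "\<forall>n. \<bar>n - m\<bar> \<le> 2 * int (g + 1) \<longrightarrow> Rep_ell2 x n = \<xi> n"
    obtain j r where m: "r \<le> g" "m = blk g j r" by (rule blk_cases)
    have xb: "Rep_ell2 x (blk g i s) = w powi i * xi s" if "i \<in> {j - 1, j, j + 1}" "s \<le> g" for i s
    proof -
      have "\<bar>blk g i s - m\<bar> \<le> 2 * int (g + 1)"
        using that m by (auto simp: blk_def algebra_simps)
      then show ?thesis using x \<xi> that(2) by simp
    qed
    have w1: "al 0 * w powi j = xi g * w powi (j - 1)"
      using wj[of "j - 1"] f(1) by (simp add: mult.commute mult.left_commute)
    show "Rep_ell2 (A x) m = z * \<xi> m"
    proof (cases "r = g")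
      case True
      have "Rep_ell2 (A x) (blk g j g) =
          p g * (w powi j * al g) + q g * (w powi j * be g) + w powi (j + 1) * be 0"
        by (rule generated_by_states(2)[OF A])
          (simp_all add: xb f algebra_simps w1)
      also have "\<dots> = w powi j * (z * xi g)" unfolding f(6) wj by (simp add: algebra_simps)
      finally show ?thesis using True m by (simp add: \<xi>)
    next
      case False
      then have r: "r < g" using m by simp
      have "Rep_ell2 (A x) (blk g j r) = c (Suc r) * Rep_ell2 x (blk g j r)
          + p r * (w powi j * al r) + q r * (w powi j * be r)"
        by (rule generated_by_states(1)[OF A, where be' = "\<lambda>r. w powi (j + 1) * be r"])
          (simp_all add: xb f r algebra_simps w1)
      also have "\<dots> = w powi j * (c (Suc r) * xi r + p r * al r + q r * be r)"
        using r by (simp add: xb algebra_simps)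
      also have "\<dots> = w powi j * (z * xi r)" using f(5)[OF r] by simp
      finally show ?thesis using m by (simp add: \<xi>)
    qed
  qed
qed

lemma truncation_exists:
  fixes f :: "int \<Rightarrow> complex"
  assumes F: "finite F"
  obtains x where "\<And>n. Rep_ell2 x n = (if n \<in> F then f n else 0)"
proof -
  have "(\<Sum>n\<in>G. (cmod (if n \<in> F then f n else 0))\<^sup>2) \<le> (\<Sum>n\<in>F. (cmod (f n))\<^sup>2)" if "finite G" for G
  proof -
    have "(\<Sum>n\<in>G. (cmod (if n \<in> F then f n else 0))\<^sup>2) = (\<Sum>n\<in>G. if n \<in> F then (cmod (f n))\<^sup>2 else 0)"
      by (rule sum.cong) auto
    also have "\<dots> = (\<Sum>n\<in>G \<inter> F. (cmod (f n))\<^sup>2)" by (rule sum.inter_restrict[OF that, symmetric])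
    also have "\<dots> \<le> (\<Sum>n\<in>F. (cmod (f n))\<^sup>2)" by (rule sum_mono2) (use F in auto)
    finally show ?thesis .
  qed
  then obtain x where x: "Rep_ell2 x = (\<lambda>n. if n \<in> F then f n else 0)"
    using ell2_exists[of "\<lambda>n. if n \<in> F then f n else 0"] by blast
  show ?thesis by (rule that[of x]) (simp add: x)
qed

text \<open>Both sides of the magic formula are evaluated on a truncated Floquet solution at an
  index where it does not vanish; one side multiplies it by f(z), the other by w + 1/w. The update
  \<open>c(0 := \<kappa>)\<close> occurs because \<open>pf_op\<close> reads the additive constant
  from index 0, where a collection of poles carries no meaningful value.\<close>

lemma trace_monodromy_eq_pf_value:
  assumes A: "generated_by g c (\<lambda>_. p) (\<lambda>_. q) A"
    and R: "\<And>k. k \<in> {1..g} \<Longrightarrow> boundedly_invertible (shifted_minus (c k) A)"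
    and band: "\<And>k m n. k \<in> {1..g} \<Longrightarrow> \<bar>m - n\<bar> > int (g + 1) \<Longrightarrow>
      matrix_entry (inv (shifted_minus (c k) A)) m n = 0"
    and magic: "pf_op g l (c(0 := \<kappa>)) A = free_op (g + 1)" and z: "z \<notin> c ` {1..g}"
  shows "trace (monodromy g c p q z) = l 0 * z + \<kappa> + (\<Sum>k=1..g. l k / (c k - z))"
proof -
  let ?N = "int (g + 1)"
  obtain w where w: "w \<noteq> 0" "w + 1 / w = complex_of_real (trace (monodromy g c p q z))"
    by (rule joukowski_root)
  obtain \<xi> :: "int \<Rightarrow> complex" where fl: "\<forall>n. \<xi> (n + ?N) = w * \<xi> n" "\<exists>n. \<xi> n \<noteq> 0"
    "\<forall>x m. (\<forall>n. \<bar>n - m\<bar> \<le> 2 * ?N \<longrightarrow> Rep_ell2 x n = \<xi> n) \<longrightarrow>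
      Rep_ell2 (A x) m = z * \<xi> m"
    using floquet_sequence[OF A z w(2,1)] .
  note \<xi> = fl[rule_format]
  obtain n0 where n0: "\<xi> n0 \<noteq> 0" using \<xi>(2) by blast
  \<comment> \<open>A margin of 2N keeps A x = z x valid up to distance 4N from \<open>n0\<close>,
    beyond the reach N of the resolvents and of the shifts.\<close>
  define F where "F = {n0 - 6 * ?N..n0 + 6 * ?N}"
  obtain x where x: "\<And>n. Rep_ell2 x n = (if n \<in> F then \<xi> n else 0)"
    using truncation_exists[of F \<xi>] by (auto simp: F_def)
  have Ax: "Rep_ell2 (A x) m = z * \<xi> m" if "\<bar>m - n0\<bar> \<le> 4 * ?N" for m
    by (rule \<xi>(3)) (use that in \<open>auto simp: x F_def\<close>)
  have Rx: "Rep_ell2 (inv (shifted_minus (c k) A) x) n0 = \<xi> n0 / (c k - z)" if k: "k \<in> {1..g}" for k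
  proof -
    let ?R = "inv (shifted_minus (c k) A)"
    have Rb: "bounded_op ?R" by (rule shifted_minus_inv(1)[OF R[OF k]])
    have b: "bounded_op A" using A by (simp add: generated_by_def)
    \<comment> \<open>\<open>y\<close> vanishes within reach of \<open>n0\<close>, so
      \<open>?R y\<close> is zero there; expressing \<open>?R y\<close> through \<open>?R x\<close>
      determines \<open>?R x\<close> at \<open>n0\<close>.\<close>
    define y where "y = z *\<^sub>R x - A x"
    have y0: "Rep_ell2 y m = 0" if "\<bar>m - n0\<bar> \<le> 4 * ?N" for m
      using that Ax[OF that] by (auto simp: y_def x F_def)
    have "Rep_ell2 (?R y) n0 = (\<Sum>n\<in>{}. matrix_entry ?R n0 n * Rep_ell2 y n)"
    proof (rule bounded_op_apply[OF Rb])
      fix n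
      show "matrix_entry ?R n0 n = 0 \<or> Rep_ell2 y n = 0"
        using band[OF k, of n0 n] y0[of n] by (cases "\<bar>n0 - n\<bar> > ?N") auto
    qed simp
    moreover have "?R y = z *\<^sub>R ?R x - (c k *\<^sub>R ?R x - x)"
      unfolding y_def by (simp add: bounded_opD[OF Rb] shifted_minus_inv(3)[OF R[OF k] b])
    ultimately have "z * Rep_ell2 (?R x) n0 - (c k * Rep_ell2 (?R x) n0 - \<xi> n0) = 0"
      by (simp add: x F_def)
    then have "(c k - z) * Rep_ell2 (?R x) n0 = \<xi> n0" by (simp add: algebra_simps)
    moreover have "complex_of_real (c k - z) \<noteq> 0" using z k by auto
    ultimately show ?thesis by (simp add: field_simps)
  qed
  have "Rep_ell2 (pf_op g l (c(0 := \<kappa>)) A x) n0 =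
      l 0 * (z * \<xi> n0) + \<kappa> * \<xi> n0 + (\<Sum>k=1..g. l k * (\<xi> n0 / (c k - z)))"
    by (simp add: pf_op_def Rx Ax x F_def)
  also have "\<dots> = complex_of_real (l 0 * z + \<kappa> + (\<Sum>k=1..g. l k / (c k - z))) * \<xi> n0"
    by (simp add: algebra_simps sum_distrib_left)
  finally have 1: "Rep_ell2 (pf_op g l (c(0 := \<kappa>)) A x) n0 =
    complex_of_real (l 0 * z + \<kappa> + (\<Sum>k=1..g. l k / (c k - z))) * \<xi> n0" .
  have "\<xi> (n0 - ?N) = \<xi> n0 / w" using \<xi>(1)[of "n0 - ?N"] w by (simp add: field_simps)
  then have "Rep_ell2 (free_op (g + 1) x) n0 = (w + 1 / w) * \<xi> n0"
    using \<xi>(1)[of n0] by (simp add: free_op_def x F_def algebra_simps)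
  with 1 n0 show ?thesis unfolding magic w(2) by (simp only: mult_cancel_right of_real_eq_iff) simp
qed

lemma norm_basis_vec_le: "norm (basis_vec n) \<le> 1"
proof (rule norm_ell2_leI)
  fix F :: "int set" assume F: "finite F"
  have "(\<Sum>m\<in>F. (cmod (Rep_ell2 (basis_vec n) m))\<^sup>2) = (\<Sum>m\<in>F. if m = n then 1 else 0)"
    by (rule sum.cong) auto
  then show "(\<Sum>m\<in>F. (cmod (Rep_ell2 (basis_vec n) m))\<^sup>2) \<le> 1\<^sup>2" using F by simp
qed simp

lemma matrix_entry_bounded:
  assumes "bounded_op T"
  obtains K where "K > 0" "\<And>m n. cmod (matrix_entry T m n) \<le> K"
proof -
  obtain K where K: "K > 0" "\<And>x. norm (T x) \<le> K * norm x"
    using bounded_op_bound[OF assms] by metis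
  have "cmod (matrix_entry T m n) \<le> K" for m n
  proof -
    have "cmod (matrix_entry T m n) \<le> norm (T (basis_vec n))"
      unfolding matrix_entry_def by (rule cmod_Rep_ell2_le)
    also have "\<dots> \<le> K * norm (basis_vec n)" by (rule K)
    also have "\<dots> \<le> K" using norm_basis_vec_le[of n] K(1) by simp
    finally show ?thesis .
  qed
  with K(1) show ?thesis by (rule that)
qed

text \<open>
  Cutting off a bounded Floquet solution at distance \<open>J\<close> produces an error supported near the two
  ends, of norm independent of \<open>J\<close>, whereas the norm of the truncation tends to infinity.
\<close>

lemma floquet_in_spectrum:
  assumes A: "generated_by g c (\<lambda>_. p) (\<lambda>_. q) A" and z: "z \<notin> c ` {1..g}"
    and tr: "\<bar>trace (monodromy g c p q z)\<bar> \<le> 2"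
  shows "complex_of_real z \<in> spectrum A"
proof (rule ccontr)
  assume "complex_of_real z \<notin> spectrum A"
  then have inv: "boundedly_invertible (\<lambda>x. complex_of_real z *\<^sub>C x - A x)"
    by (simp add: spectrum_def)
  define N where "N = int (g + 1)"
  have N: "N > 0" by (simp add: N_def)
  have co: "corner_op N (int g) A" unfolding N_def by (rule generated_by_corner_op[OF A])
  note bA = corner_opD(1)[OF co]
  obtain w where w: "w \<noteq> 0" "w + 1 / w = complex_of_real (trace (monodromy g c p q z))"
    by (rule joukowski_root)
  have w1: "cmod w = 1"
    using joukowski_unit_circle[OF w(1)] tr unfolding w(2) by (auto simp: abs_le_iff)
  obtain \<xi> :: "int \<Rightarrow> complex" where fl: "\<forall>n. \<xi> (n + N) = w * \<xi> n" "\<exists>n. \<xi> n \<noteq> 0"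
    "\<forall>x m. (\<forall>n. \<bar>n - m\<bar> \<le> 2 * N \<longrightarrow> Rep_ell2 x n = \<xi> n) \<longrightarrow>
      Rep_ell2 (A x) m = z * \<xi> m"
    unfolding N_def using floquet_sequence[OF A z w(2,1)] .
  note \<xi> = fl[rule_format]
  obtain n0 where n0: "\<xi> n0 \<noteq> 0" using \<xi>(2) by blast
  have per: "cmod (\<xi> (n + int i * N)) = cmod (\<xi> n)" for n i
  proof (induction i)
    case (Suc i)
    have "n + int (Suc i) * N = (n + int i * N) + N" by (simp add: algebra_simps)
    then show ?case unfolding \<open>n + int (Suc i) * N = _\<close> \<xi>(1) by (simp add: norm_mult w1 Suc)
  qed simp
  define M where "M = (\<Sum>r\<in>{0..<N}. cmod (\<xi> r))"
  have M: "cmod (\<xi> n) \<le> M" for n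
  proof -
    have "cmod (\<xi> n) = cmod (\<xi> (n mod N))"
    proof (cases "n div N \<ge> 0")
      case True
      then show ?thesis using per[of "n mod N" "nat (n div N)"] by (simp add: algebra_simps)
    next
      case False
      have "n + (- (n div N)) * N = n mod N" by (simp add: minus_div_mult_eq_mod[symmetric])
      then show ?thesis using per[of n "nat (- (n div N))"] False by simp
    qed
    also have "\<dots> \<le> M" unfolding M_def
      by (rule member_le_sum) (use N in auto)
    finally show ?thesis .
  qed
  have M0: "0 \<le> M" using M[of 0] norm_ge_zero[of "\<xi> 0"] by linarith
  obtain K where K: "K > 0" "\<And>m n. cmod (matrix_entry A m n) \<le> K"
    using matrix_entry_bounded[OF bA] by metis
  define B where "B = \<bar>z\<bar> * M + real_of_int (2 * N + 1) * (K * M)"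
  have B0: "0 \<le> B" unfolding B_def using M0 K N by simp
  obtain L where L: "L > 0" "\<And>x. norm (inv (\<lambda>x. complex_of_real z *\<^sub>C x - A x) x) \<le> L * norm x"
    using bounded_op_bound[OF boundedly_invertibleD(1)[OF inv]] by metis
  have main: "(real t + 1) * (cmod (\<xi> n0))\<^sup>2 \<le> (L * sqrt (6 * real_of_int N * B\<^sup>2))\<^sup>2" for t :: nat
  proof -
    \<comment> \<open>The window contains \<open>n0\<close> and its first \<open>t\<close>
      translates by the period, at all of which the solution has the same modulus.\<close>
    define J where "J = \<bar>n0\<bar> + int t * N"
    obtain x where x: "\<And>n. Rep_ell2 x n = (if n \<in> {-J..J} then \<xi> n else 0)"
      using truncation_exists[of "{-J..J}" \<xi>] by auto
    have xM: "cmod (Rep_ell2 x n) \<le> M" for n using M[of n] M0 by (simp add: x)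
    define y where "y = complex_of_real z *\<^sub>C x - A x"
    \<comment> \<open>Near each end the error reaches less than 2N inwards, by the locality radius
      of the eigenvalue equation, and N outwards, by the band of \<open>A\<close>.\<close>
    define D where "D = {J - 2 * N + 1..J + N} \<union> {- (J + N)..- (J - 2 * N + 1)}"
    have cD: "real (card D) \<le> 6 * real_of_int N"
    proof -
      have "card D \<le> card {J - 2 * N + 1..J + N} + card {- (J + N)..- (J - 2 * N + 1)}"
        unfolding D_def by (rule card_Un_le)
      also have "\<dots> = nat (3 * N) + nat (3 * N)" by simp
      finally show ?thesis using N by linarith
    qed
    have Axm: "Rep_ell2 (A x) m = (\<Sum>n\<in>{m-N..m+N}. matrix_entry A m n * Rep_ell2 x n)" for m
      by (rule bounded_op_apply[OF bA]) (use corner_opD(3)[OF co, of m] in auto)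
    have yD: "Rep_ell2 y m = 0" if "m \<notin> D" for m
    proof (cases "\<bar>m\<bar> \<le> J")
      case True
      then have "\<bar>m\<bar> \<le> J - 2 * N" using that by (auto simp: D_def)
      then have "Rep_ell2 (A x) m = z * \<xi> m" by (intro \<xi>(3)) (auto simp: x)
      then show ?thesis using True by (simp add: y_def x abs_le_iff)
    next
      case False
      then have "\<bar>m\<bar> > J + N" using that by (auto simp: D_def)
      then have "Rep_ell2 (A x) m = 0"
        unfolding Axm by (intro sum.neutral) (auto simp: x)
      then show ?thesis using False by (auto simp: y_def x)
    qed
    have yB: "cmod (Rep_ell2 y m) \<le> B" for m
    proof -
      have "cmod (Rep_ell2 (A x) m) \<le> (\<Sum>n\<in>{m-N..m+N}. K * M)"
        unfolding Axm
        by (rule order_trans[OF norm_sum], rule sum_mono)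
          (auto intro!: mult_mono simp: norm_mult K xM less_imp_le)
      also have "\<dots> = real_of_int (2 * N + 1) * (K * M)" using N by simp
      finally have "cmod (Rep_ell2 (A x) m) \<le> real_of_int (2 * N + 1) * (K * M)" .
      moreover have "cmod (z * Rep_ell2 x m) \<le> \<bar>z\<bar> * M"
        by (simp add: norm_mult mult_left_mono xM)
      ultimately show ?thesis
        unfolding y_def B_def using norm_triangle_ineq4[of "z * Rep_ell2 x m" "Rep_ell2 (A x) m"] by simp
    qed
    have ny: "norm y \<le> sqrt (6 * real_of_int N * B\<^sup>2)"
    proof (rule norm_ell2_leI)
      fix G :: "int set" assume G: "finite G"
      have "(\<Sum>m\<in>G. (cmod (Rep_ell2 y m))\<^sup>2) = (\<Sum>m\<in>G \<inter> D. (cmod (Rep_ell2 y m))\<^sup>2)"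
        by (rule sum.mono_neutral_right) (use G yD in auto)
      also have "\<dots> \<le> (\<Sum>m\<in>D. (cmod (Rep_ell2 y m))\<^sup>2)"
        by (rule sum_mono2) (auto simp: D_def)
      also have "\<dots> \<le> (\<Sum>m\<in>D. B\<^sup>2)"
        by (intro sum_mono power_mono yB) simp
      also have "\<dots> \<le> 6 * real_of_int N * B\<^sup>2"
        using mult_right_mono[OF cD, of "B\<^sup>2"] by simp
      finally show "(\<Sum>m\<in>G. (cmod (Rep_ell2 y m))\<^sup>2) \<le> (sqrt (6 * real_of_int N * B\<^sup>2))\<^sup>2"
        using N by simp
    qed (use N in simp)
    have "inv (\<lambda>x. complex_of_real z *\<^sub>C x - A x) y = x"
      unfolding y_def by (rule boundedly_invertibleD(2)[OF inv])
    then have nx: "norm x \<le> L * sqrt (6 * real_of_int N * B\<^sup>2)"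
      using L(2)[of y] ny L(1) by (metis mult_left_mono order_trans less_imp_le)
    have "(real t + 1) * (cmod (\<xi> n0))\<^sup>2 = (\<Sum>i\<in>{0..t}. (cmod (\<xi> (n0 + int i * N)))\<^sup>2)"
      by (simp add: per)
    also have "\<dots> = (\<Sum>n\<in>(\<lambda>i. n0 + int i * N) ` {0..t}. (cmod (\<xi> n))\<^sup>2)"
      by (subst sum.reindex) (use N in \<open>auto simp: inj_on_def\<close>)
    also have "\<dots> = (\<Sum>n\<in>(\<lambda>i. n0 + int i * N) ` {0..t}. (cmod (Rep_ell2 x n))\<^sup>2)"
    proof (rule sum.cong)
      fix n assume "n \<in> (\<lambda>i. n0 + int i * N) ` {0..t}"
      then obtain i where i: "i \<le> t" "n = n0 + int i * N" by auto
      have "0 \<le> int i * N" "int i * N \<le> int t * N" using i N by (auto intro: mult_right_mono)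
      then have "n \<in> {-J..J}" unfolding J_def i by auto
      then show "(cmod (\<xi> n))\<^sup>2 = (cmod (Rep_ell2 x n))\<^sup>2" by (simp add: x)
    qed simp
    also have "\<dots> \<le> (norm x)\<^sup>2" by (rule sum_le_norm_ell2) simp
    also have "\<dots> \<le> (L * sqrt (6 * real_of_int N * B\<^sup>2))\<^sup>2" by (rule power_mono[OF nx]) simp
    finally show ?thesis .
  qed
  obtain t :: nat where "real t > (L * sqrt (6 * real_of_int N * B\<^sup>2))\<^sup>2 / (cmod (\<xi> n0))\<^sup>2"
    using reals_Archimedean2 by blast
  then have "(L * sqrt (6 * real_of_int N * B\<^sup>2))\<^sup>2 < real t * (cmod (\<xi> n0))\<^sup>2"
    using n0 by (simp add: field_simps)
  also have "\<dots> \<le> (real t + 1) * (cmod (\<xi> n0))\<^sup>2" by (simp add: algebra_simps)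
  finally show False using main[of t] by simp
qed

section \<open>Uniqueness of the coefficients\<close>

text \<open>Multiplication by all \<open>c j - z\<close> gives a polynomial of degree at most g + 1
  vanishing on \<open>Z\<close>, hence the zero polynomial. Its value at \<open>c k\<close> is
  \<open>\<mu> k\<close> times a nonzero product, and the affine function that remains has two
  zeros.\<close>

lemma partial_fraction_eq_0:
  fixes c \<mu> :: "nat \<Rightarrow> real"
  assumes inj: "inj_on c {1..g}" and card: "card Z \<ge> g + 2" and Z: "Z \<inter> c ` {1..g} = {}"
    and zero: "\<And>z. z \<in> Z \<Longrightarrow> \<mu> 0 * z + d + (\<Sum>k=1..g. \<mu> k / (c k - z)) = 0"
  shows "d = 0" and "j \<le> g \<Longrightarrow> \<mu> j = 0"
proof -
  define W where "W S = (\<Prod>j\<in>S. [:c j, - 1:])" for S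
  define F where "F = [:d, \<mu> 0:] * W {1..g} + (\<Sum>k=1..g. smult (\<mu> k) (W ({1..g} - {k})))"
  have polyW: "poly (W S) z = (\<Prod>j\<in>S. c j - z)" for S z by (simp add: W_def poly_prod)
  have degW: "degree (W S) \<le> card S" if "finite S" for S
    using degree_prod_sum_le[OF that, of "\<lambda>j. [:c j, - 1:]"] by (simp add: W_def)
  have "degree F \<le> g + 1"
    unfolding F_def
  proof (rule degree_add_le)
    show "degree ([:d, \<mu> 0:] * W {1..g}) \<le> g + 1"
    proof -
      have "degree [:d, \<mu> 0:] \<le> 1" "degree (W {1..g}) \<le> g" using degW[of "{1..g}"] by simp_all
      then show ?thesis using degree_mult_le[of "[:d, \<mu> 0:]" "W {1..g}"] by linarith
    qed
    show "degree (\<Sum>k=1..g. smult (\<mu> k) (W ({1..g} - {k}))) \<le> g + 1"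
    proof (rule degree_sum_le)
      fix k assume "k \<in> {1..g}"
      then show "degree (smult (\<mu> k) (W ({1..g} - {k}))) \<le> g + 1"
        using degree_smult_le[of "\<mu> k" "W ({1..g} - {k})"] degW[of "{1..g} - {k}"] by simp
    qed simp
  qed
  moreover have "poly F z = 0" if z: "z \<in> Z" for z
  proof -
    have ne: "c k - z \<noteq> 0" if "k \<in> {1..g}" for k using Z z that by auto
    have "poly F z = (d + z * \<mu> 0) * (\<Prod>j=1..g. c j - z)
        + (\<Sum>k=1..g. \<mu> k * (\<Prod>j\<in>{1..g} - {k}. c j - z))"
      by (simp add: F_def poly_sum polyW algebra_simps)
    also have "(\<Sum>k=1..g. \<mu> k * (\<Prod>j\<in>{1..g} - {k}. c j - z)) =
        (\<Sum>k=1..g. \<mu> k / (c k - z) * (\<Prod>j=1..g. c j - z))"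
    proof (rule sum.cong)
      fix k assume k: "k \<in> {1..g}"
      have "(\<Prod>j=1..g. c j - z) = (c k - z) * (\<Prod>j\<in>{1..g} - {k}. c j - z)"
        by (rule prod.remove) (use k in auto)
      then show "\<mu> k * (\<Prod>j\<in>{1..g} - {k}. c j - z) = \<mu> k / (c k - z) * (\<Prod>j=1..g. c j - z)"
        using ne[OF k] by simp
    qed simp
    also have "(d + z * \<mu> 0) * (\<Prod>j=1..g. c j - z) + \<dots> =
        (\<mu> 0 * z + d + (\<Sum>k=1..g. \<mu> k / (c k - z))) * (\<Prod>j=1..g. c j - z)"
      unfolding sum_distrib_right[symmetric] by algebra
    finally show ?thesis using zero[OF z] by simp
  qed
  ultimately have F0: "F = 0"
  proof (rule_tac ccontr)
    assume *: "\<And>z. z \<in> Z \<Longrightarrow> poly F z = 0" "degree F \<le> g + 1" "F \<noteq> 0"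
    have "card Z \<le> card {z. poly F z = 0}"
      by (rule card_mono) (use * in \<open>auto intro: poly_roots_finite\<close>)
    also have "\<dots> \<le> degree F" by (rule card_poly_roots_bound) fact
    finally show False using * card by simp
  qed
  have \<mu>: "\<mu> k = 0" if k: "k \<in> {1..g}" for k
  proof -
    have z: "(\<Prod>j\<in>S. c j - c k) = 0" if "k \<in> S" "finite S" for S
      using that by (auto simp: prod_zero_iff)
    have W0: "poly (W {1..g}) (c k) = 0" unfolding polyW by (rule z) (use k in auto)
    have "0 = poly F (c k)" by (simp add: F0)
    also have "\<dots> = (\<Sum>i=1..g. \<mu> i * (\<Prod>j\<in>{1..g} - {i}. c j - c k))"
      using W0 by (simp add: F_def poly_sum polyW[of "{1..g} - _", simplified])
    also have "\<dots> = (\<Sum>i\<in>{k}. \<mu> i * (\<Prod>j\<in>{1..g} - {i}. c j - c k))"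
      by (rule sum.mono_neutral_right) (use k z in auto)
    finally have "\<mu> k = 0 \<or> (\<Prod>j\<in>{1..g} - {k}. c j - c k) = 0" by simp
    moreover have "(\<Prod>j\<in>{1..g} - {k}. c j - c k) \<noteq> 0"
    proof -
      have "c j \<noteq> c k" if "j \<in> {1..g} - {k}" for j using inj_onD[OF inj _ _ k, of j] that by blast
      then show ?thesis by simp
    qed
    ultimately show ?thesis by simp
  qed
  have lin: "\<mu> 0 * z + d = 0" if "z \<in> Z" for z
    using zero[OF that] \<mu> by simp
  have "finite Z" using card by (rule_tac ccontr) simp
  obtain z1 z2 where zz: "z1 \<in> Z" "z2 \<in> Z" "z1 \<noteq> z2"
  proof -
    have "\<not> card Z \<le> Suc 0" using card by simp
    then show ?thesis using that card_le_Suc0_iff_eq[OF \<open>finite Z\<close>] by blast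
  qed
  have "\<mu> 0 * (z1 - z2) = 0" using lin[OF zz(1)] lin[OF zz(2)] by algebra
  then have m0: "\<mu> 0 = 0" using zz by simp
  then show "d = 0" using lin[OF zz(1)] by simp
  show "\<mu> j = 0" if "j \<le> g" using m0 \<mu> that by (cases "j = 0") auto
qed

section \<open>The magic formula\<close>

lemma inv_commute:
  assumes "boundedly_invertible T" "\<And>x. X (T x) = T (X x)"
  shows "X (inv T x) = inv T (X x)"
  by (metis assms boundedly_invertibleD(2,3))

lemma matrix_entry_free_op:
  "matrix_entry (free_op n) i j = (if i = j + int n then 1 else 0) + (if i = j - int n then 1 else 0)"
  by (simp add: matrix_entry_def free_op_def)

lemma matrix_entry_shift_pow:
  "matrix_entry (\<lambda>x. T ((shift_op ^^ k) x)) m n = matrix_entry T m (n + int k)"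
  "matrix_entry (\<lambda>x. (shift_op ^^ k) (T x)) m n = matrix_entry T (m - int k) n"
  "matrix_entry (\<lambda>x. T ((inv shift_op ^^ k) x)) m n = matrix_entry T m (n - int k)"
  "matrix_entry (\<lambda>x. (inv shift_op ^^ k) (T x)) m n = matrix_entry T (m + int k) n"
  by (simp_all add: matrix_entry_def)

lemma periodic_commute_free_op:
  assumes T: "bounded_op T" and per: "\<And>m n. matrix_entry T (m + int k) (n + int k) = matrix_entry T m n"
  shows "T (free_op k x) = free_op k (T x)"
proof -
  have "T ((shift_op ^^ k) x) = (shift_op ^^ k) (T x)"
    by (rule bounded_op_eqI[OF bounded_op_comp[OF T bounded_op_shift_pow(1)]
          bounded_op_comp[OF bounded_op_shift_pow(1) T]])
      (simp add: matrix_entry_shift_pow, metis per add.commute diff_add_cancel)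
  moreover have "T ((inv shift_op ^^ k) x) = (inv shift_op ^^ k) (T x)"
    by (rule bounded_op_eqI[OF bounded_op_comp[OF T bounded_op_shift_pow(2)]
          bounded_op_comp[OF bounded_op_shift_pow(2) T]])
      (simp add: matrix_entry_shift_pow, metis per add.commute diff_add_cancel)
  ultimately show ?thesis by (simp add: free_op_def bounded_opD[OF T])
qed

lemma periodic_entry_multiple:
  fixes f :: "int \<Rightarrow> int \<Rightarrow> 'a" and N i :: int
  assumes "\<And>m n. f (m + N) (n + N) = f m n"
  shows "f (m + i * N) (n + i * N) = f m n"
proof (induction i rule: int_induct[where k = 0])
  case (step1 i)
  then show ?case using assms[of "m + i * N" "n + i * N"] by (simp add: algebra_simps)
next
  case (step2 i)
  then show ?case using assms[of "m + (i - 1) * N" "n + (i - 1) * N"] by (simp add: algebra_simps)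
qed simp

text \<open>
  If \<open>X\<close> commutes with operators carrying their outermost diagonal on every residue class, then
  comparing the entries at distance \<open>N + d\<close> on both sides removes the diagonals of \<open>X\<close> one by one.
\<close>

lemma corner_commutant_diagonal:
  assumes N: "N > 0" and X: "bounded_op X" "\<And>m n. matrix_entry X m n = matrix_entry X n m"
    "\<And>m n. \<bar>m - n\<bar> \<ge> N \<Longrightarrow> matrix_entry X m n = 0"
    and T: "\<And>\<rho>. 0 \<le> \<rho> \<Longrightarrow> \<rho> < N \<Longrightarrow> \<exists>T. corner_op N \<rho> T \<and> (\<forall>x. X (T x) = T (X x))"
    and mn: "m \<noteq> n"
  shows "matrix_entry X m n = 0"
proof -
  have upper: "\<forall>m. matrix_entry X m (m + N - int e) = 0" if "int e < N" for e
    using that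
  proof (induction e rule: less_induct)
    case (less e)
    show ?case
    proof (cases "e = 0")
      case True
      then show ?thesis using X(3) N by simp
    next
      case False
      define d where "d = N - int e"
      have d: "0 < d" "d < N" using False less.prems by (auto simp: d_def)
      have far: "matrix_entry X i j = 0" if "j > i + d" for i j
      proof (cases "j - i \<ge> N")
        case True
        then show ?thesis by (intro X(3)) auto
      next
        case False
        define e' where "e' = nat (i + N - j)"
        have "e' < e" "int e' < N" "j = i + N - int e'"
          using False that d by (auto simp: e'_def d_def)
        with less.IH[of e'] show ?thesis by metis
      qed
      show ?thesis
      proof
        fix m
        \<comment> \<open>\<open>T\<close> has its corner in the class of \<open>m\<close>. In the
          entry (m - N, m + d) of X T = T X the only term on the left contains the corner entry of
          \<open>T\<close> in row m - N + d, which lies in another class; the only term on the right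
          is the nonzero corner in row m - N times the entry of \<open>X\<close> in
          question.\<close>
        obtain T where co: "corner_op N (m mod N) T" and comm: "\<And>x. X (T x) = T (X x)"
          using T[of "m mod N"] N by auto
        have "(\<Sum>l\<in>{m - N + d}. matrix_entry X (m - N) l * matrix_entry T l (m + d)) =
            (\<Sum>l\<in>{m}. matrix_entry T (m - N) l * matrix_entry X l (m + d))"
        proof (rule bounded_op_commute_entry[OF X(1) corner_opD(1)[OF co] comm])
          show "matrix_entry X (m - N) l = 0 \<or> matrix_entry T l (m + d) = 0" if "l \<notin> {m - N + d}" for l
            using that far[of "m - N" l] corner_opD(3)[OF co, of l "m + d"] by (cases "l > m - N + d") auto
          show "matrix_entry T (m - N) l = 0 \<or> matrix_entry X l (m + d) = 0" if "l \<notin> {m}" for l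
            using that far[of l "m + d"] corner_opD(3)[OF co, of "m - N" l] by (cases "l > m") auto
        qed simp_all
        moreover have "matrix_entry T (m - N + d) (m - N + d + N) = 0"
        proof (rule corner_opD(4)[OF co])
          have "\<not> N dvd d" using d by (simp add: zdvd_not_zless)
          then have "(m + d) mod N \<noteq> m mod N" by (simp add: mod_eq_dvd_iff)
          moreover have "(m - N + d) mod N = (m + d) mod N"
            by (metis add.commute add_diff_eq mod_diff_right_eq diff_zero mod_self minus_mod_self2)
          ultimately show "(m - N + d) mod N \<noteq> m mod N" by simp
        qed
        moreover have "matrix_entry T (m - N) (m - N + N) \<noteq> 0"
          using corner_opD(5)[OF co, of "m - N"] by (auto simp: minus_mod_self2)
        ultimately show "matrix_entry X m (m + N - int e) = 0"
          by (simp add: d_def algebra_simps)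
      qed
    qed
  qed
  have ord: "matrix_entry X i j = 0" if "i < j" for i j
  proof (cases "j - i \<ge> N")
    case True
    then show ?thesis by (intro X(3)) auto
  next
    case False
    then have "int (nat (i + N - j)) < N" "j = i + N - int (nat (i + N - j))" using that by auto
    then show ?thesis using upper[of "nat (i + N - j)"] by metis
  qed
  show ?thesis using ord[of m n] ord[of n m] X(2)[of m n] mn by (cases "m < n") auto
qed

lemma gmp_resolvent_corner_op:
  assumes A: "A \<in> GMP g c" and k: "k \<in> {1..g}"
  shows "corner_op (int (g + 1)) (int k - 1) (inv (shifted_minus (c k) A))"
proof -
  have inv: "boundedly_invertible (shifted_minus (c k) A)" using A k by (simp add: GMP_def)
  obtain c' where "unshift k (inv (shifted_minus (c k) A)) \<in> class_A g c'"
    using A k unfolding GMP_def unshift_def by blast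
  then show ?thesis by (rule class_A_unshift_corner_op[OF shifted_minus_inv(1)[OF inv] _ k])
qed

lemma generated_by_periodic:
  assumes A: "generated_by g c (\<lambda>_. p) (\<lambda>_. q) A"
  shows "matrix_entry A (m + int (g + 1)) (n + int (g + 1)) = matrix_entry A m n"
proof -
  obtain i r where m: "r \<le> g" "m = blk g i r" by (rule blk_cases)
  obtain j s where n: "s \<le> g" "n = blk g j s" by (rule blk_cases)
  show ?thesis
    unfolding m(2) n(2) blk_add_period matrix_entry_blk[OF A m(1) n(1)]
    by (simp add: gmp_entry_def)
qed

lemma magic_formula_exists:
  assumes gen: "generated_by g c (\<lambda>_. p) (\<lambda>_. q) A" and gmp: "A \<in> GMP g c"
  obtains l \<kappa> where "\<forall>j\<le>g. l j > 0" "pf_op g l (c(0 := \<kappa>)) A = free_op (g + 1)"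
proof -
  define N where "N = int (g + 1)"
  have N: "N > 0" by (simp add: N_def)
  have bA: "bounded_op A" using gen by (simp add: generated_by_def)
  have inv: "boundedly_invertible (shifted_minus (c k) A)" if "k \<in> {1..g}" for k
    using gmp that by (simp add: GMP_def)
  define T where "T j = (if j = 0 then A else inv (shifted_minus (c j) A))" for j
  \<comment> \<open>The residue class that carries the corner of \<open>T j\<close>.\<close>
  define \<sigma> where "\<sigma> j = (if j = 0 then int g else int j - 1)" for j
  have co: "corner_op N (\<sigma> j) (T j)" if "j \<le> g" for j
  proof (cases "j = 0")
    case True
    then show ?thesis using generated_by_corner_op[OF gen] by (simp only: T_def \<sigma>_def N_def) simp
  next
    case False
    then show ?thesis using gmp_resolvent_corner_op[OF gmp, of j] that
      by (simp only: T_def \<sigma>_def N_def) simp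
  qed
  have bT: "bounded_op (T j)" if "j \<le> g" for j using corner_opD(1)[OF co[OF that]] .
  have \<sigma>: "0 \<le> \<sigma> j" "\<sigma> j < N" if "j \<le> g" for j using that by (auto simp: \<sigma>_def N_def)
  have \<sigma>_ex: "\<exists>j\<le>g. \<sigma> j = \<rho>" if "0 \<le> \<rho>" "\<rho> < N" for \<rho>
  proof (cases "\<rho> = int g")
    case True
    then show ?thesis by (intro exI[of _ 0]) (simp add: \<sigma>_def)
  next
    case False
    then show ?thesis using that by (intro exI[of _ "nat (\<rho> + 1)"]) (auto simp: \<sigma>_def N_def)
  qed
  have \<sigma>_inj: "i = j" if "i \<le> g" "j \<le> g" "\<sigma> i = \<sigma> j" for i j
    using that by (auto simp: \<sigma>_def split: if_splits)
  have freeA: "A (free_op (g + 1) x) = free_op (g + 1) (A x)" for x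
    by (rule periodic_commute_free_op[OF bA generated_by_periodic[OF gen]])
  have shA: "A ((shift_op ^^ (g + 1)) x) = (shift_op ^^ (g + 1)) (A x)" for x
    by (rule bounded_op_eqI[OF bounded_op_comp[OF bA bounded_op_shift_pow(1)]
          bounded_op_comp[OF bounded_op_shift_pow(1) bA]])
      (simp only: matrix_entry_shift_pow, metis generated_by_periodic[OF gen] diff_add_cancel)
  have sm: "X (shifted_minus t A x) = shifted_minus t A (X x)"
    if "bounded_op X" "\<And>x. X (A x) = A (X x)" for X t x
    using that by (simp add: shifted_minus_def bounded_opD[OF that(1)])
  have comm: "X (T j x) = T j (X x)"
    if "bounded_op X" "\<And>x. X (A x) = A (X x)" "j \<le> g" for X j x
    using that inv[of j] inv_commute[where X = X and T = "shifted_minus (c j) A", of x] sm[of X "c j"]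
    by (cases "j = 0") (auto simp: T_def)
  \<comment> \<open>The N-th power of the shift commutes with \<open>A\<close>, hence with the
    resolvents.\<close>
  have perT: "matrix_entry (T j) (m + N) (n + N) = matrix_entry (T j) m n" if "j \<le> g" for j m n
  proof -
    have "(shift_op ^^ (g + 1)) (T j (basis_vec n)) = T j ((shift_op ^^ (g + 1)) (basis_vec n))"
      by (rule comm[OF bounded_op_shift_pow(1) shA[symmetric] that])
    then have "Rep_ell2 ((shift_op ^^ (g + 1)) (T j (basis_vec n))) (m + N) =
        Rep_ell2 (T j ((shift_op ^^ (g + 1)) (basis_vec n))) (m + N)" by simp
    then show ?thesis
      unfolding Rep_ell2_shift_pow shift_pow_basis_vec by (simp add: matrix_entry_def N_def)
  qed
  have "\<exists>t>0. \<forall>m. m mod N = \<sigma> j \<longrightarrow> matrix_entry (T j) m (m + N) = complex_of_real t" if j: "j \<le> g" for j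
  proof -
    obtain t where t: "t > 0" "matrix_entry (T j) (\<sigma> j) (\<sigma> j + N) = complex_of_real t"
      using corner_opD(5)[OF co[OF j], of "\<sigma> j"] \<sigma>[OF j] by auto
    have "matrix_entry (T j) m (m + N) = complex_of_real t" if m: "m mod N = \<sigma> j" for m
    proof -
      have "m = \<sigma> j + (m div N) * N" using m by (metis add.commute div_mult_mod_eq)
      moreover have "m + N = \<sigma> j + N + (m div N) * N" using calculation by simp
      ultimately show ?thesis
        using periodic_entry_multiple[of "matrix_entry (T j)" N "\<sigma> j" "m div N" "\<sigma> j + N"]
          perT[OF j] t(2) by metis
    qed
    with t(1) show ?thesis by blast
  qed
  then obtain t where t: "\<And>j. j \<le> g \<Longrightarrow> t j > 0"
    "\<And>j m. j \<le> g \<Longrightarrow> m mod N = \<sigma> j \<Longrightarrow> matrix_entry (T j) m (m + N) = complex_of_real (t j)"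
    by metis
  \<comment> \<open>This normalizes every outermost entry of the combination to 1, as in
    \<open>free_op\<close>.\<close>
  define l where "l j = 1 / t j" for j
  define X where "X x = (\<Sum>j\<le>g. l j *\<^sub>R T j x) - free_op (g + 1) x" for x
  have bX: "bounded_op X"
    unfolding X_def[abs_def] by (intro bounded_op_diff bounded_op_sum bounded_op_scaleR bounded_op_free_op bT) simp
  have XA: "X (A x) = A (X x)" for x
  proof -
    have "T j (A x) = A (T j x)" if "j \<le> g" for j
      using comm[OF bA refl that] by simp
    then show ?thesis by (simp add: X_def bounded_opD[OF bA] freeA[simplified])
  qed
  have Xe: "matrix_entry X m n = (\<Sum>j\<le>g. complex_of_real (l j) * matrix_entry (T j) m n)
      - ((if m = n + N then 1 else 0) + (if m = n - N then 1 else 0))" for m n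
    using matrix_entry_free_op[of "g + 1" m n] by (simp add: X_def matrix_entry_def N_def)
  have Xsym: "matrix_entry X m n = matrix_entry X n m" for m n
  proof -
    have "matrix_entry (T j) m n = matrix_entry (T j) n m" if "j \<le> g" for j
      using corner_opD(2)[OF co[OF that]] .
    then show ?thesis unfolding Xe by (auto simp: algebra_simps)
  qed
  have Xcorner: "matrix_entry X m (m + N) = 0" for m
  proof -
    obtain i where i: "i \<le> g" "\<sigma> i = m mod N" using \<sigma>_ex[of "m mod N"] N by auto
    have "(\<Sum>j\<le>g. complex_of_real (l j) * matrix_entry (T j) m (m + N)) =
        (\<Sum>j\<in>{i}. complex_of_real (l j) * matrix_entry (T j) m (m + N))"
    proof (rule sum.mono_neutral_right)
      show "\<forall>j\<in>{..g} - {i}. complex_of_real (l j) * matrix_entry (T j) m (m + N) = 0"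
        using corner_opD(4)[OF co] \<sigma>_inj i by (metis Diff_iff atMost_iff insertI1 mult_zero_right)
    qed (use i in auto)
    also have "\<dots> = 1" using t(1)[OF i(1)] t(2)[OF i(1), of m] i by (simp add: l_def)
    finally show ?thesis using N unfolding Xe by simp
  qed
  have Xband: "matrix_entry X m n = 0" if "\<bar>m - n\<bar> \<ge> N" for m n
  proof -
    have "\<bar>m - n\<bar> > N \<or> n = m + N \<or> m = n + N" using that by linarith
    then consider "\<bar>m - n\<bar> > N" | "n = m + N" | "m = n + N" by blast
    then show ?thesis
    proof cases
      case 1
      have "matrix_entry (T j) m n = 0" if "j \<le> g" for j using corner_opD(3)[OF co[OF that] 1] .
      then show ?thesis using 1 N unfolding Xe by auto
    next
      case 2
      then show ?thesis using Xcorner by simp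
    next
      case 3
      then show ?thesis using Xcorner Xsym by metis
    qed
  qed
  have Xoff: "matrix_entry X m n = 0" if "m \<noteq> n" for m n
  proof (rule corner_commutant_diagonal[OF N bX Xsym Xband _ that])
    fix \<rho> assume "0 \<le> \<rho>" "\<rho> < N"
    then obtain j where "j \<le> g" "\<sigma> j = \<rho>" using \<sigma>_ex by blast
    then show "\<exists>T. corner_op N \<rho> T \<and> (\<forall>x. X (T x) = T (X x))"
      using co comm[OF bX XA] by blast
  qed
  \<comment> \<open>\<open>X\<close> is already diagonal, so commuting with \<open>A\<close> equates
    its diagonal entries at any two indices joined by a nonzero entry of \<open>A\<close>.\<close>
  have Xconn: "matrix_entry X m m = matrix_entry X n n" if "matrix_entry A m n \<noteq> 0" for m n
  proof -
    have "(\<Sum>i\<in>{m}. matrix_entry X m i * matrix_entry A i n) =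
        (\<Sum>i\<in>{n}. matrix_entry A m i * matrix_entry X i n)"
      by (rule bounded_op_commute_entry[OF bX bA XA]) (use Xoff in auto)
    then show ?thesis using that by simp
  qed
  have Xper: "matrix_entry X (m + N) (m + N) = matrix_entry X m m" for m
    unfolding Xe using perT by (auto intro!: sum.cong)
  have Xblk: "matrix_entry X (blk g i r) (blk g i r) = matrix_entry X (blk g 0 r) (blk g 0 r)" for i r
    using periodic_entry_multiple[of "\<lambda>m n. matrix_entry X m m" N "blk g 0 r" i] Xper
    by (simp add: blk_def N_def add.commute)
  have pg: "p g > 0" using gen by (simp add: generated_by_def)
  have Xr: "matrix_entry X (blk g 0 r) (blk g 0 r) = matrix_entry X (blk g 0 g) (blk g 0 g)"
    if r: "r \<le> g" for r
  proof (cases "r = g")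
    case False
    then have r: "r < g" using r by simp
    \<comment> \<open>If both vanished, the basis vector would be an eigenvector for
      \<open>c (Suc r)\<close>, against the invertibility of c_{r+1} - A. A nonzero
      \<open>p r\<close> joins the index to the end of the preceding block, a nonzero
      \<open>q r\<close> to the end of its own.\<close>
    have "p r \<noteq> 0 \<or> q r \<noteq> 0"
    proof (rule ccontr)
      assume "\<not> ?thesis"
      then have pq: "p r = 0" "q r = 0" by auto
      have "A (basis_vec (blk g 0 r)) = c (Suc r) *\<^sub>R basis_vec (blk g 0 r)"
      proof (rule ell2_eqI)
        fix m
        obtain i s where m: "s \<le> g" "m = blk g i s" by (rule blk_cases)
        have "Rep_ell2 (A (basis_vec (blk g 0 r))) m = matrix_entry A (blk g i s) (blk g 0 r)"
          by (simp add: matrix_entry_def m)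
        also have "\<dots> = complex_of_real (if i = 0 \<and> r = s then c (Suc r) else 0)"
          using r m pq by (auto simp: matrix_entry_blk[OF gen] gmp_entry_def B_block_eq A_block_def
              outer_def)
        finally show "Rep_ell2 (A (basis_vec (blk g 0 r))) m =
            Rep_ell2 (c (Suc r) *\<^sub>R basis_vec (blk g 0 r)) m"
          using r m by (auto simp: blk_eq_iff)
      qed
      then have "shifted_minus (c (Suc r)) A (basis_vec (blk g 0 r)) = 0"
        by (simp add: shifted_minus_def)
      then have "basis_vec (blk g 0 r) = inv (shifted_minus (c (Suc r)) A) 0"
        using boundedly_invertibleD(2)[OF inv[of "Suc r"], of "basis_vec (blk g 0 r)"] r by simp
      also have "\<dots> = 0" using bounded_opD(5)[OF boundedly_invertibleD(1)[OF inv[of "Suc r"]]] r by simp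
      finally have "Rep_ell2 (basis_vec (blk g 0 r)) (blk g 0 r) = 0" by simp
      then show False by simp
    qed
    then show ?thesis
    proof
      assume "p r \<noteq> 0"
      then have "matrix_entry A (blk g (- 1) g) (blk g 0 r) \<noteq> 0"
        using r by (simp add: matrix_entry_blk[OF gen] gmp_entry_def A_block_def outer_def)
      from Xconn[OF this] show ?thesis using Xblk[of "- 1" g] by simp
    next
      assume "q r \<noteq> 0"
      then have "matrix_entry A (blk g 0 r) (blk g 0 g) \<noteq> 0"
        using r pg by (simp add: matrix_entry_blk[OF gen] gmp_entry_def B_block_eq)
      from Xconn[OF this] show ?thesis .
    qed
  qed simp
  have "matrix_entry X (blk g 0 g) (blk g 0 g) \<in> \<real>"
    unfolding Xe using corner_opD(6)[OF co] N by (intro Reals_diff sum_in_Reals Reals_mult) auto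
  then obtain \<kappa> where \<kappa>: "matrix_entry X (blk g 0 g) (blk g 0 g) = complex_of_real \<kappa>"
    by (auto elim: Reals_cases)
  have X: "X x = \<kappa> *\<^sub>R x" for x
  proof (rule bounded_op_eqI[OF bX bounded_op_scaleR[OF bounded_op_id]])
    fix m n
    obtain i r where m: "r \<le> g" "m = blk g i r" by (rule blk_cases)
    have "matrix_entry X m m = complex_of_real \<kappa>" by (simp only: m(2) Xblk[of i r] Xr[OF m(1)] \<kappa>)
    then show "matrix_entry X m n = matrix_entry (\<lambda>x. \<kappa> *\<^sub>R x) m n"
      using Xoff[of m n] by (auto simp: matrix_entry_def)
  qed
  have "pf_op g l (c(0 := - \<kappa>)) A x = free_op (g + 1) x" for x
  proof -
    have "{..g} = insert 0 {1..g}" by auto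
    then have "(\<Sum>j\<le>g. l j *\<^sub>R T j x) =
        l 0 *\<^sub>R A x + (\<Sum>j=1..g. l j *\<^sub>R inv (shifted_minus (c j) A) x)"
      by (simp add: T_def)
    with X[of x] show ?thesis by (simp add: X_def pf_op_def algebra_simps)
  qed
  then have "pf_op g l (c(0 := - \<kappa>)) A = free_op (g + 1)" by (rule ext)
  moreover have "\<forall>j\<le>g. l j > 0" using t(1) by (simp add: l_def)
  ultimately show ?thesis using that by blast
qed

text \<open>Together with \<open>gmp_const\<close>, the partial fraction coefficients of the trace
  of the monodromy matrix; index 0 holds the coefficient of z.\<close>

definition gmp_coeff :: "nat \<Rightarrow> (nat \<Rightarrow> real) \<Rightarrow> (nat \<Rightarrow> real) \<Rightarrow> (nat \<Rightarrow> real) \<Rightarrow> nat \<Rightarrow> real" where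
  "gmp_coeff g c p q j = (if j = 0 then 1 / p g else Lam g c j p q)"

definition gmp_const :: "nat \<Rightarrow> (nat \<Rightarrow> real) \<Rightarrow> (nat \<Rightarrow> real) \<Rightarrow> real" where
  "gmp_const g p q = - q g - 1 / p g * (\<Sum>j=0..<g. p j * q j)"

lemma trace_monodromy_coeff:
  assumes "p g \<noteq> 0" "inj_on c {1..g}" "z \<notin> c ` {1..g}"
  shows "trace (monodromy g c p q z) = gmp_coeff g c p q 0 * z + gmp_const g p q
    + (\<Sum>k=1..g. gmp_coeff g c p q k / (c k - z))"
  using trace_monodromy[of p g c z q] assms by (simp add: gmp_coeff_def gmp_const_def)

lemma pf_op_cong:
  assumes "\<And>j. j \<le> g \<Longrightarrow> l j = l' j" shows "pf_op g l c A = pf_op g l' c A"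
  using assms by (auto simp: pf_op_def fun_eq_iff)

lemma pf_value_of_real:
  "pf_value g l (c(0 := \<kappa>)) (complex_of_real x) =
    complex_of_real (l 0 * x + \<kappa> + (\<Sum>k=1..g. l k / (c k - x)))"
  by (simp add: pf_value_def)

text \<open>Both families of coefficients expand the trace of the monodromy matrix off the poles,
  and such expansions are unique.\<close>

lemma magic_formula_coefficients:
  assumes gen: "generated_by g c (\<lambda>_. p) (\<lambda>_. q) A" and gmp: "A \<in> GMP g c"
    and magic: "pf_op g l (c(0 := \<kappa>)) A = free_op (g + 1)"
  shows "j \<le> g \<Longrightarrow> l j = gmp_coeff g c p q j" and "\<kappa> = gmp_const g p q"
proof -
  let ?l = "gmp_coeff g c p q" and ?\<kappa> = "gmp_const g p q"
  have inj: "inj_on c {1..g}" using gmp by (simp add: GMP_def class_A_def)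
  have p: "p g \<noteq> 0" using gen by (auto simp: generated_by_def)
  have inv: "boundedly_invertible (shifted_minus (c k) A)" if "k \<in> {1..g}" for k
    using gmp that by (simp add: GMP_def)
  have eq: "(l 0 - ?l 0) * z + (\<kappa> - ?\<kappa>) + (\<Sum>k=1..g. (l k - ?l k) / (c k - z)) = 0"
    if z: "z \<notin> c ` {1..g}" for z
  proof -
    have "trace (monodromy g c p q z) = l 0 * z + \<kappa> + (\<Sum>k=1..g. l k / (c k - z))"
      by (rule trace_monodromy_eq_pf_value[OF gen inv _ magic z])
        (auto intro: corner_opD(3)[OF gmp_resolvent_corner_op[OF gmp]])
    with trace_monodromy_coeff[of p g c z q, OF p inj z] show ?thesis
      by (simp add: sum_subtractf diff_divide_distrib algebra_simps)
  qed
  have "infinite (- (c ` {1..g}))" by (simp add: finite_compl infinite_UNIV_char_0)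
  then obtain Z where Z: "Z \<subseteq> - (c ` {1..g})" "card Z = g + 2"
    using infinite_arbitrarily_large by blast
  have Z0: "Z \<inter> c ` {1..g} = {}" "card Z \<ge> g + 2" using Z by auto
  have "(\<lambda>j. l j - ?l j) j = 0" if "j \<le> g" for j
    by (rule partial_fraction_eq_0(2)[OF inj Z0(2,1) _ that]) (use eq Z in auto)
  then show "l j = ?l j" if "j \<le> g" using that by simp
  have "\<kappa> - ?\<kappa> = 0"
    by (rule partial_fraction_eq_0(1)[OF inj Z0(2,1), of "\<lambda>j. l j - ?l j"]) (use eq Z in auto)
  then show "\<kappa> = ?\<kappa>" by simp
qed

text \<open>For the inclusion of the preimage in the spectrum, a point where f lies in [-2, 2] is
  real, and there f is the trace of the monodromy matrix, so \<open>floquet_in_spectrum\<close>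
  applies.\<close>

lemma periodic_gmp_magic_formula:
  assumes gen: "generated_by g c (\<lambda>_. p) (\<lambda>_. q) A" and gmp: "A \<in> GMP g c"
  defines "l \<equiv> gmp_coeff g c p q" and "\<kappa> \<equiv> gmp_const g p q"
  shows "\<forall>j\<le>g. l j > 0" "pf_op g l (c(0 := \<kappa>)) A = free_op (g + 1)"
    "spectrum A = {z. z \<notin> complex_of_real ` c ` {1..g} \<and>
      pf_value g l (c(0 := \<kappa>)) z \<in> complex_of_real ` {-2..2}}"
proof -
  have inj: "inj_on c {1..g}" using gmp by (simp add: GMP_def class_A_def)
  have p: "p g \<noteq> 0" using gen by (auto simp: generated_by_def)
  have bA: "bounded_op A" using gen by (simp add: generated_by_def)
  have inv: "boundedly_invertible (shifted_minus (c k) A)" if "k \<in> {1..g}" for k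
    using gmp that by (simp add: GMP_def)
  obtain l' \<kappa>' where l': "\<forall>j\<le>g. l' j > 0" "pf_op g l' (c(0 := \<kappa>')) A = free_op (g + 1)"
    using magic_formula_exists[OF gen gmp] .
  have ll: "l' j = l j" if "j \<le> g" for j
    unfolding l_def by (rule magic_formula_coefficients(1)[OF gen gmp l'(2) that])
  have kk: "\<kappa>' = \<kappa>" unfolding \<kappa>_def by (rule magic_formula_coefficients(2)[OF gen gmp l'(2)])
  show pos: "\<forall>j\<le>g. l j > 0" using l'(1) ll by simp
  show magic: "pf_op g l (c(0 := \<kappa>)) A = free_op (g + 1)"
    using l'(2) pf_op_cong[of g l' l "c(0 := \<kappa>)" A] ll kk by simp
  have cimg: "(c(0 := \<kappa>)) ` {1..g} = c ` {1..g}" by (rule image_cong) auto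
  show "spectrum A = {z. z \<notin> complex_of_real ` c ` {1..g} \<and>
      pf_value g l (c(0 := \<kappa>)) z \<in> complex_of_real ` {-2..2}}"
  proof (intro equalityI subsetI CollectI)
    fix z assume "z \<in> spectrum A"
    then show "z \<notin> complex_of_real ` c ` {1..g} \<and>
        pf_value g l (c(0 := \<kappa>)) z \<in> complex_of_real ` {-2..2}"
      using spectrum_subset[OF bA _ magic, of z] inv unfolding cimg by simp
  next
    fix z assume "z \<in> {z. z \<notin> complex_of_real ` c ` {1..g} \<and>
        pf_value g l (c(0 := \<kappa>)) z \<in> complex_of_real ` {-2..2}}"
    then have zc: "z \<notin> complex_of_real ` c ` {1..g}"
      and pf: "pf_value g l (c(0 := \<kappa>)) z \<in> complex_of_real ` {-2..2}" by auto
    have "Im z = 0"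
      by (rule pf_value_real_imp_real[of g l "c(0 := \<kappa>)"]) (use pos pf in auto)
    then obtain x where x: "z = complex_of_real x" by (metis complex_is_Real_iff Reals_cases)
    have xc: "x \<notin> c ` {1..g}" using zc x by auto
    have "\<bar>trace (monodromy g c p q x)\<bar> \<le> 2"
      using pf unfolding x pf_value_of_real trace_monodromy_coeff[of p g c x q, OF p inj xc] l_def \<kappa>_def
      by (auto simp del: of_real_add of_real_mult of_real_sum)
    then show "z \<in> spectrum A" unfolding x by (rule floquet_in_spectrum[OF gen xc])
  qed
qed

section \<open>Resolvents of block-periodic matrices at the poles\<close>

lemma mprod_append:
  assumes "a \<le> b" "b \<le> d"
  shows "mprod f a d = mprod f a b ** mprod f b d"
  using assms(2) by (induction d rule: dec_induct) (use assms(1) in \<open>simp_all add: mprod_simps matrix_mul_assoc\<close>)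

lemma mprod_shift: "mprod (\<lambda>i. f (n + i)) a b = mprod f (n + a) (n + b)"
proof (cases "a \<le> b")
  case True
  then show ?thesis by (induction b rule: dec_induct) (simp_all add: mprod_simps)
qed (simp add: mprod_def)

lemma mprod_cong: "(\<And>i. a \<le> i \<Longrightarrow> i < b \<Longrightarrow> f i = h i) \<Longrightarrow> mprod f a b = mprod h a b"
  by (auto simp: mprod_def intro!: arg_cong[of _ _ mat_prod_list])

definition node_matrix ::
  "nat \<Rightarrow> (nat \<Rightarrow> real) \<Rightarrow> (nat \<Rightarrow> real) \<Rightarrow> (nat \<Rightarrow> real) \<Rightarrow> real \<Rightarrow> nat \<Rightarrow> real^2^2" where
  "node_matrix g c p q z r = (if r < g then a_fin z (c (r + 1)) (p r) (q r) else a_inf z (p g) (q g))"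

text \<open>The transfer matrices at \<open>c k\<close>, starting behind the node k - 1 whose pole
  is \<open>c k\<close> and running cyclically. With g factors this covers every node except the
  singular one.\<close>

definition cyc_prod ::
  "nat \<Rightarrow> (nat \<Rightarrow> real) \<Rightarrow> (nat \<Rightarrow> real) \<Rightarrow> (nat \<Rightarrow> real) \<Rightarrow> nat \<Rightarrow> nat \<Rightarrow> real^2^2" where
  "cyc_prod g c p q k = mprod (\<lambda>i. node_matrix g c p q (c k) ((k + i) mod (g + 1))) 0"

lemma cyc_prod_full:
  assumes k: "k \<in> {1..g}"
  shows "cyc_prod g c p q k g = mprod (node_matrix g c p q (c k)) k g ** a_inf (c k) (p g) (q g)
    ** mprod (node_matrix g c p q (c k)) 0 (k - 1)"
proof -
  let ?f = "node_matrix g c p q (c k)"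
  let ?h = "\<lambda>i. ?f ((k + i) mod (g + 1))"
  \<comment> \<open>The position at which the cyclic product meets node g; afterwards the indices
    restart at 0.\<close>
  define a where "a = g - k"
  have a: "k + a = g" "Suc a \<le> g" using k by (auto simp: a_def)
  have "mprod ?h 0 g = mprod ?h 0 a ** ?h a ** mprod ?h (Suc a) g"
    using mprod_append[of 0 "Suc a" g ?h] a(2) by (simp add: mprod_simps)
  also have "mprod ?h 0 a = mprod (\<lambda>i. ?f (k + i)) 0 a"
    by (rule mprod_cong) (use a in auto)
  also have "\<dots> = mprod ?f k g" using mprod_shift[of ?f k 0 a] a by simp
  also have "?h a = a_inf (c k) (p g) (q g)"
    using a by (simp add: node_matrix_def)
  also have "mprod ?h (Suc a) g = mprod (\<lambda>i. ?h (Suc a + i)) 0 (k - 1)"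
  proof -
    have "Suc a + (k - 1) = g" using a k by simp
    with mprod_shift[of ?h "Suc a" 0 "k - 1"] show ?thesis by simp
  qed
  also have "\<dots> = mprod ?f 0 (k - 1)"
  proof (rule mprod_cong)
    fix i assume "i < k - 1"
    then have "k + (Suc a + i) = i + (g + 1)" "i < g + 1" using a k by auto
    then show "?h (Suc a + i) = ?f i" by (simp only: mod_add_self2) simp
  qed
  finally show ?thesis unfolding cyc_prod_def .
qed

text \<open>Cyclicity of the trace collects the regular factors into \<open>C\<close>. Since
  \<open>pp_j\<close> has rank one, the trace becomes a determinant with columns v and
  \<open>C\<close> v, where v is the parameter pair of the singular node.\<close>

lemma Lam_cyc_prod:
  fixes c p q :: "nat \<Rightarrow> real"
  assumes k: "k \<in> {1..g}"
  defines "C \<equiv> cyc_prod g c p q k g"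
  shows "Lam g c k p q = p (k - 1) * (C$2$1 * p (k - 1) + C$2$2 * q (k - 1))
    - q (k - 1) * (C$1$1 * p (k - 1) + C$1$2 * q (k - 1))"
proof -
  let ?f = "node_matrix g c p q (c k)" and ?P = "pp_j (p (k - 1)) (q (k - 1))"
  let ?a = "\<lambda>j. a_fin (c k) (c (j + 1)) (p j) (q j)"
  have "mprod ?f 0 (k - 1) = mprod ?a 0 (k - 1)"
    by (rule mprod_cong) (use k in \<open>auto simp: node_matrix_def\<close>)
  moreover have "mprod ?f k g = mprod ?a k g"
    by (rule mprod_cong) (simp add: node_matrix_def)
  ultimately have "Lam g c k p q = - trace (mprod ?f 0 (k - 1) ** (?P ** (mprod ?f k g ** a_inf (c k) (p g) (q g))))"
    by (simp add: Lam_def mprod_def matrix_mul_assoc)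
  also have "\<dots> = - trace (?P ** C)"
    unfolding C_def cyc_prod_full[OF k] by (subst trace_mul_sym) (simp add: matrix_mul_assoc)
  finally show ?thesis
    by (simp add: trace_2 matrix_matrix_mult_def sum_2 pp_j_entries algebra_simps)
qed

text \<open>
  The next lemmas express that the coordinates of the state with respect to a frame \<open>G\<close> transported
  by the transfer matrices at \<open>z\<close> evolve according to the node of the resolvent, in which the
  roles of input \<open>x\<close> and output \<open>y = z x - A x\<close> are interchanged.
\<close>

lemma gauge_finite_node:
  fixes p q u x y \<alpha> \<beta> :: complex
  assumes det: "G11 * G22 - G12 * G21 = 1" and u: "u \<noteq> 0"
    and y: "y = x / u - p * \<alpha> - q * \<beta>"
    and G': "G11' = G11 * (1 + p * q * u) + G12 * (q * q * u)" "G12' = - (G11 * (p * p * u)) + G12 * (1 - p * q * u)"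
      "G21' = G21 * (1 + p * q * u) + G22 * (q * q * u)" "G22' = - (G21 * (p * p * u)) + G22 * (1 - p * q * u)"
  defines "p' \<equiv> u * (G11 * p + G12 * q)" and "q' \<equiv> u * (G21 * p + G22 * q)"
  shows "(\<alpha> + q * x) * G22' - (\<beta> - p * x) * G21' = (\<alpha> * G22 - \<beta> * G21) + q' * y"
    and "(\<beta> - p * x) * G11' - (\<alpha> + q * x) * G12' = (\<beta> * G11 - \<alpha> * G12) - p' * y"
    and "u * y + p' * (\<alpha> * G22 - \<beta> * G21) + q' * (\<beta> * G11 - \<alpha> * G12) = x"
proof -
  have x: "x = u * (y + p * \<alpha> + q * \<beta>)" using u y by simp
  show "(\<alpha> + q * x) * G22' - (\<beta> - p * x) * G21' = (\<alpha> * G22 - \<beta> * G21) + q' * y"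
    "(\<beta> - p * x) * G11' - (\<alpha> + q * x) * G12' = (\<beta> * G11 - \<alpha> * G12) - p' * y"
    unfolding G' p'_def q'_def x by algebra+
  show "u * y + p' * (\<alpha> * G22 - \<beta> * G21) + q' * (\<beta> * G11 - \<alpha> * G12) = x"
    unfolding p'_def q'_def x using det by algebra
qed

lemma gauge_infinite_node:
  fixes p q x y z \<alpha> \<beta> :: complex
  assumes det: "G11 * G22 - G12 * G21 = 1" and p: "p \<noteq> 0"
    and y: "y = z * x - (p * \<alpha> + q * \<beta> + \<beta>')" and \<beta>: "\<beta> = p * x"
    and G': "G11' = G12 * (1 / p)" "G12' = - (G11 * p) + G12 * ((z - p * q) / p)"
      "G21' = G22 * (1 / p)" "G22' = - (G21 * p) + G22 * ((z - p * q) / p)"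
  shows "x * G22' - \<beta>' * G21' = (\<alpha> * G22 - \<beta> * G21) + G22 / p * y"
    and "\<beta>' * G11' - x * G12' = (\<beta> * G11 - \<alpha> * G12) - G12 / p * y"
    and "G12 / p * (\<alpha> * G22 - \<beta> * G21) + G22 / p * (\<beta> * G11 - \<alpha> * G12) = x"
proof -
  define v where "v = 1 / p"
  have v: "v * p = 1" using p by (simp add: v_def)
  have dv: "a / p = a * v" for a by (simp add: v_def)
  show "x * G22' - \<beta>' * G21' = (\<alpha> * G22 - \<beta> * G21) + G22 / p * y"
    "\<beta>' * G11' - x * G12' = (\<beta> * G11 - \<alpha> * G12) - G12 / p * y"
    unfolding G' \<beta> y dv using v by algebra+
  show "G12 / p * (\<alpha> * G22 - \<beta> * G21) + G22 / p * (\<beta> * G11 - \<alpha> * G12) = x"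
    unfolding \<beta> dv using v det by algebra
qed

lemma gauge_end_node:
  fixes p q s t x \<alpha> \<beta> L :: complex
  assumes det: "G11 * G22 - G12 * G21 = 1" and st: "s * q - t * p = 1" and L: "L \<noteq> 0"
    and G: "G11 * p + G12 * q = 0" "G21 * p + G22 * q = - L"
  shows "\<beta> * G11 - \<alpha> * G12 = 1 / L * (- (p * \<alpha>) - q * \<beta>)"
    and "1 / L * (\<alpha> * G22 - \<beta> * G21) + - (G21 * s + G22 * t) * (\<beta> * G11 - \<alpha> * G12)
      + (s * (\<alpha> + q * x) + t * (\<beta> - p * x)) = x"
proof -
  \<comment> \<open>Cramer's rule for \<open>G\<close>.\<close>
  have p: "p = L * G12" and q: "q = - L * G11" using G det by algebra+
  show "\<beta> * G11 - \<alpha> * G12 = 1 / L * (- (p * \<alpha>) - q * \<beta>)"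
    unfolding p q using L by (simp add: field_simps)
  define v where "v = 1 / L"
  have v: "v * L = 1" using L by (simp add: v_def)
  show "1 / L * (\<alpha> * G22 - \<beta> * G21) + - (G21 * s + G22 * t) * (\<beta> * G11 - \<alpha> * G12)
      + (s * (\<alpha> + q * x) + t * (\<beta> - p * x)) = x"
    unfolding v_def[symmetric] using v st det p q by algebra
qed

text \<open>States indexed by the integers instead of block and position, because the resolvent at
  \<open>c k\<close> has its blocks displaced by k.\<close>

lemma generated_by_global_states:
  assumes A: "generated_by g c (\<lambda>_. p) (\<lambda>_. q) A"
  obtains al be :: "int \<Rightarrow> complex" where
    "\<forall>n r. n mod int (g + 1) = int r \<and> r < g \<longrightarrow> al (n + 1) = al n + q r * Rep_ell2 x n \<and>
      be (n + 1) = be n - p r * Rep_ell2 x n \<and>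
      Rep_ell2 (A x) n = c (Suc r) * Rep_ell2 x n + p r * al n + q r * be n"
    "\<forall>n. n mod int (g + 1) = int g \<longrightarrow> be n = p g * Rep_ell2 x n \<and> al (n + 1) = Rep_ell2 x n \<and>
      Rep_ell2 (A x) n = p g * al n + q g * be n + be (n + 1)"
proof -
  define AL where "AL j r = Rep_ell2 x (blk g (j - 1) g) + (\<Sum>s<r. q s * Rep_ell2 x (blk g j s))" for j r
  define BE where "BE j r = (\<Sum>s=r..g. p s * Rep_ell2 x (blk g j s))" for j r
  define al where "al n = AL (n div int (g + 1)) (nat (n mod int (g + 1)))" for n
  define be where "be n = BE (n div int (g + 1)) (nat (n mod int (g + 1)))" for n
  have ab: "al (blk g j r) = AL j r" "be (blk g j r) = BE j r" if "r \<le> g" for j r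
    unfolding al_def be_def using that by (simp_all only: blk_div blk_mod nat_int)
  have S: "blk g j r + 1 = blk g j (Suc r)" "blk g j g + 1 = blk g (j + 1) 0" for j r
    by (simp_all add: blk_def algebra_simps)
  have beS: "BE j (Suc r) = BE j r - p r * Rep_ell2 x (blk g j r)" if "r < g" for j r
    unfolding BE_def using that by (simp add: sum.atLeast_Suc_atMost[of r g])
  note st = generated_by_states[OF A, of "AL j" x j "BE j" "BE (j + 1)" for j]
  have pre: "AL j 0 = Rep_ell2 x (blk g (j - 1) g)" "BE j g = p g * Rep_ell2 x (blk g j g)"
    "AL j (Suc r) = AL j r + q r * Rep_ell2 x (blk g j r)" for j r
    by (simp_all add: AL_def BE_def)
  have res: "\<exists>j. n = blk g j r" if "n mod int (g + 1) = int r" "r \<le> g" for n r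
    unfolding blk_def using that by (metis div_mult_mod_eq)
  show ?thesis
  proof (rule that; intro allI impI)
    fix n r assume "n mod int (g + 1) = int r \<and> r < g"
    then obtain j where n: "n = blk g j r" and r: "r < g" using res[of n r] by auto
    show "al (n + 1) = al n + q r * Rep_ell2 x n \<and> be (n + 1) = be n - p r * Rep_ell2 x n \<and>
        Rep_ell2 (A x) n = c (Suc r) * Rep_ell2 x n + p r * al n + q r * be n"
      using st(1)[of j r] r by (simp add: n S(1) ab pre beS)
  next
    fix n assume "n mod int (g + 1) = int g"
    then obtain j where n: "n = blk g j g" using res[of n g] by auto
    show "be n = p g * Rep_ell2 x n \<and> al (n + 1) = Rep_ell2 x n \<and>
        Rep_ell2 (A x) n = p g * al n + q g * be n + be (n + 1)"
      using st(2)[of j] by (simp add: n S(2) ab pre beS)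
  qed
qed

text \<open>Transposing the matrix identity R B = 1; the band of \<open>B\<close> keeps the sums
  finite.\<close>

lemma symmetric_left_inverse:
  assumes B: "bounded_op B" "\<And>m n. matrix_entry B m n = matrix_entry B n m"
    "\<And>m n. \<bar>m - n\<bar> > w \<Longrightarrow> matrix_entry B m n = 0"
    and R: "bounded_op R" "\<And>m n. matrix_entry R m n = matrix_entry R n m"
    and inv: "\<And>x. R (B x) = x"
  shows "B (R x) = x"
proof (rule bounded_op_eqI[OF bounded_op_comp[OF B(1) R(1)] bounded_op_id])
  fix m n
  let ?L = "{m - w..m + w}"
  have "matrix_entry (\<lambda>x. B (R x)) m n = (\<Sum>l\<in>?L. matrix_entry B m l * matrix_entry R l n)"
    by (rule matrix_entry_comp[OF B(1)]) (use B(3)[of m] in auto)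
  also have "\<dots> = (\<Sum>l\<in>?L. matrix_entry R n l * matrix_entry B l m)"
    by (rule sum.cong) (simp_all add: B(2)[of m] R(2)[of n] mult.commute)
  also have "\<dots> = matrix_entry (\<lambda>x. R (B x)) n m"
    by (rule matrix_entry_comp[OF R(1), symmetric]) (use B(3)[of _ m] in force)+
  finally show "matrix_entry (\<lambda>x. B (R x)) m n = matrix_entry (\<lambda>x. x) m n"
    by (simp add: inv) (simp add: matrix_entry_def)
qed

text \<open>The inverse is realized on one period read from behind the singular node. Its state is
  that of \<open>A\<close> in a transported frame \<open>G\<close>, its input is \<open>B x\<close>
  and its output is \<open>x\<close>; positivity of \<open>Lam\<close> permits the division by
  \<open>L\<close> and gives the last parameter 1/L the sign required of \<open>p g\<close>.\<close>

lemma periodic_resolvent: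
  assumes A: "generated_by g c (\<lambda>_. p) (\<lambda>_. q) A" and inj: "inj_on c {1..g}"
    and k: "k \<in> {1..g}" and Lam: "Lam g c k p q > 0"
  shows "boundedly_invertible (shifted_minus (c k) A)"
    "\<exists>c'. unshift k (inv (shifted_minus (c k) A)) \<in> class_A g c'"
proof -
  define L where "L = Lam g c k p q"
  define cyc where "cyc i = (k + i) mod (g + 1)" for i
  define p1 q1 where "p1 = p (k - 1)" and "q1 = q (k - 1)"
  define C where "C i = cyc_prod g c p q k i" for i
  define h1 h2 where "h1 = C g$1$1 * p1 + C g$1$2 * q1" and "h2 = C g$2$1 * p1 + C g$2$2 * q1"
  \<comment> \<open>The second row (q1, -p1) of the initial frame makes the new state at the start
    of a block equal to the preceding input. The first row is fixed by determinant 1 and by the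
    requirement that at the singular node \<open>be'\<close> be a multiple of the input; the
    solution is the multiple -1/L of (h1, h2).\<close>
  define s t where "s = - h1 / L" and "t = - h2 / L"
  define G where "G i = (vector [vector [t, - s], vector [q1, - p1]] :: real^2^2) ** C i" for i
  have L: "L > 0" "L = p1 * h2 - q1 * h1"
    using Lam Lam_cyc_prod[OF k, of c p q]
    by (simp_all add: L_def h1_def h2_def p1_def q1_def C_def)
  have pg: "p g > 0" using A by (simp add: generated_by_def)
  have st: "s * q1 - t * p1 = 1" using L by (simp add: s_def t_def field_simps)
  have cyc_le: "cyc i \<le> g" for i unfolding cyc_def by (simp add: less_Suc_eq_le[symmetric])
  have cyc_inj: "i = j" if "i \<le> g" "j \<le> g" "cyc i = cyc j" for i j
  proof -
    have "(k + i) mod (g + 1) = (k + j) mod (g + 1)" using that(3) by (simp add: cyc_def)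
    then have "i mod (g + 1) = j mod (g + 1)" using mod_add_left_eq by (simp add: nat_mod_eq_iff)
    then show ?thesis using that by simp
  qed
  have cycg: "cyc g = k - 1"
  proof -
    have "k + g = (k - 1) + (g + 1)" using k by simp
    then show ?thesis unfolding cyc_def by (simp only: mod_add_self2) (use k in simp)
  qed
  have cyc_ne: "cyc i \<noteq> k - 1" if "i < g" for i
    using cyc_inj[of i g] cycg that by auto
  have G0: "G 0$1$1 = t" "G 0$1$2 = - s" "G 0$2$1 = q1" "G 0$2$2 = - p1"
    by (simp_all add: G_def C_def cyc_prod_def mprod_simps vector_2)
  have GS: "G (Suc i) = G i ** node_matrix g c p q (c k) (cyc i)" for i
    by (simp add: G_def C_def cyc_prod_def mprod_simps matrix_mul_assoc cyc_def)
  have detG: "G i$1$1 * G i$2$2 - G i$1$2 * G i$2$1 = 1" for i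
  proof -
    have "det (node_matrix g c p q (c k) r) = 1" for r
      using pg by (simp add: node_matrix_def det_a_fin det_a_inf)
    then have "det (C i) = 1" unfolding C_def cyc_prod_def by (intro det_mprod) simp_all
    moreover have "det (vector [vector [t, - s], vector [q1, - p1]] :: real^2^2) = 1"
      using st by (simp add: det_2 vector_2 algebra_simps)
    ultimately have "det (G i) = 1" by (simp add: G_def det_mul)
    then show ?thesis by (simp add: det_2)
  qed
  have Gend: "G g$1$1 * p1 + G g$1$2 * q1 = 0" "G g$2$1 * p1 + G g$2$2 * q1 = - L"
  proof -
    have "G g$1$1 * p1 + G g$1$2 * q1 = t * h1 - s * h2" "G g$2$1 * p1 + G g$2$2 * q1 = q1 * h1 - p1 * h2"
      by (simp_all add: G_def matrix_matrix_mult_def sum_2 vector_2 h1_def h2_def algebra_simps)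
    then show "G g$1$1 * p1 + G g$1$2 * q1 = 0" "G g$2$1 * p1 + G g$2$2 * q1 = - L"
      using L by (simp_all add: s_def t_def)
  qed
  \<comment> \<open>The new poles are the images of the old ones under x -> 1/(c_k - x). The node at
    infinity becomes a finite node with pole 0, while the node of \<open>c k\<close> becomes the
    infinite one.\<close>
  define u where "u i = (if cyc i < g then 1 / (c k - c (Suc (cyc i))) else 0)" for i
  have ck: "c k \<noteq> c (Suc (cyc i))" if "i < g" "cyc i < g" for i
    using inj_onD[OF inj _ k, of "Suc (cyc i)"] cyc_ne[OF that(1)] that(2) by auto
  \<comment> \<open>The values dictated by the gauge lemmas for the singular node, the finite nodes
    and the old infinite node.\<close>
  define pt where "pt i = (if i = g then 1 / L else if cyc i < g
    then u i * (G i$1$1 * p (cyc i) + G i$1$2 * q (cyc i)) else G i$1$2 / p g)" for i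
  define qt where "qt i = (if i = g then - (G g$2$1 * s + G g$2$2 * t) else if cyc i < g
    then u i * (G i$2$1 * p (cyc i) + G i$2$2 * q (cyc i)) else G i$2$2 / p g)" for i
  define ct where "ct j = u (j - 1)" for j
  obtain A' where A': "generated_by g ct (\<lambda>_. pt) (\<lambda>_. qt) A'"
    using gmp_op_exists[of pt g ct qt] L(1) by (auto simp: pt_def)
  define R where "R x = (shift_op ^^ k) (A' ((inv shift_op ^^ k) x))" for x
  define B where "B = shifted_minus (c k) A"
  have bA: "bounded_op A" and bA': "bounded_op A'" using A A' by (simp_all add: generated_by_def)
  have bB: "bounded_op B"
    unfolding B_def shifted_minus_def[abs_def] by (intro bounded_op_intros bA)
  have bR: "bounded_op R"
    unfolding R_def[abs_def]
    by (rule bounded_op_comp[OF bounded_op_shift_pow(1) bounded_op_comp[OF bA' bounded_op_shift_pow(2)]])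
  have RB: "R (B x) = x" for x
  proof (rule ell2_eqI)
    fix n0 :: int
    obtain al be :: "int \<Rightarrow> complex" where glob:
      "\<forall>n r. n mod int (g + 1) = int r \<and> r < g \<longrightarrow> al (n + 1) = al n + q r * Rep_ell2 x n \<and>
        be (n + 1) = be n - p r * Rep_ell2 x n \<and>
        Rep_ell2 (A x) n = c (Suc r) * Rep_ell2 x n + p r * al n + q r * be n"
      "\<forall>n. n mod int (g + 1) = int g \<longrightarrow> be n = p g * Rep_ell2 x n \<and> al (n + 1) = Rep_ell2 x n \<and>
        Rep_ell2 (A x) n = p g * al n + q g * be n + be (n + 1)"
      using generated_by_global_states[OF A, of x] .
    define y where "y = B x"
    have y: "Rep_ell2 y n = c k * Rep_ell2 x n - Rep_ell2 (A x) n" for n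
      by (simp add: y_def B_def shifted_minus_def)
    define nn where "nn j i = blk g j i + int k" for j i
    have nnS: "nn j i + 1 = nn j (Suc i)" "nn j g + 1 = nn (j + 1) 0" "nn (j - 1) g + 1 = nn j 0" for j i
      by (simp_all add: nn_def blk_def algebra_simps)
    have nn_mod: "nn j i mod int (g + 1) = int (cyc i)" for j i
    proof -
      have "nn j i = int (k + i) + j * int (g + 1)" by (simp add: nn_def blk_def)
      then show ?thesis unfolding cyc_def by (simp only: mod_mult_self1 zmod_int)
    qed
    \<comment> \<open>With \<open>be'\<close>, this is the row vector of the two states times the
      inverse of \<open>G i\<close>, whose determinant is 1.\<close>
    define al' where "al' j i = al (nn j i) * G i$2$2 - be (nn j i) * G i$2$1" for j i
    define be' where "be' j i = be (nn j i) * G i$1$1 - al (nn j i) * G i$1$2" for j i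
    have detc: "complex_of_real (G i$1$1) * G i$2$2 - complex_of_real (G i$1$2) * G i$2$1 = 1" for i
      using arg_cong[OF detG[of i], of complex_of_real] by simp
    have node: "al' j (Suc i) = al' j i + qt i * Rep_ell2 y (nn j i)
        \<and> be' j (Suc i) = be' j i - pt i * Rep_ell2 y (nn j i)
        \<and> u i * Rep_ell2 y (nn j i) + pt i * al' j i + qt i * be' j i = Rep_ell2 x (nn j i)"
      if i: "i < g" for j i
    proof (cases "cyc i < g")
      case True
      let ?P = "complex_of_real (p (cyc i))" and ?Q = "complex_of_real (q (cyc i))"
        and ?u = "complex_of_real (u i)"
      have u0: "?u \<noteq> 0" using ck[OF i True] True by (simp add: u_def)
      have nd: "al (nn j i + 1) = al (nn j i) + ?Q * Rep_ell2 x (nn j i)"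
        "be (nn j i + 1) = be (nn j i) - ?P * Rep_ell2 x (nn j i)"
        "Rep_ell2 (A x) (nn j i) = c (Suc (cyc i)) * Rep_ell2 x (nn j i) + ?P * al (nn j i) + ?Q * be (nn j i)"
        using glob(1) nn_mod[of j i] True by blast+
      have yy: "Rep_ell2 y (nn j i) = Rep_ell2 x (nn j i) / ?u - ?P * al (nn j i) - ?Q * be (nn j i)"
        using ck[OF i True] True by (simp add: y nd(3) u_def algebra_simps)
      have fin: "node_matrix g c p q (c k) (cyc i) = a_fin (c k) (c (Suc (cyc i))) (p (cyc i)) (q (cyc i))"
        using True by (simp add: node_matrix_def)
      have inv: "1 / (c (Suc (cyc i)) - c k) = - u i"
        using True ck[OF i True] by (simp add: u_def divide_simps)
      have dv: "v / (c (Suc (cyc i)) - c k) = - (v * u i)" for v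
        using arg_cong[OF inv, of "(*) v"] by simp
      have a: "a_fin (c k) (c (Suc (cyc i))) p' q' $1$1 = 1 + p' * q' * u i"
        "a_fin (c k) (c (Suc (cyc i))) p' q' $1$2 = - (p' * p' * u i)"
        "a_fin (c k) (c (Suc (cyc i))) p' q' $2$1 = q' * q' * u i"
        "a_fin (c k) (c (Suc (cyc i))) p' q' $2$2 = 1 - p' * q' * u i" for p' q'
        unfolding a_fin_entries dv by (simp_all add: mult.commute)
      have G': "complex_of_real (G (Suc i)$1$1) = G i$1$1 * (1 + ?P * ?Q * ?u) + G i$1$2 * (?Q * ?Q * ?u)"
        "complex_of_real (G (Suc i)$1$2) = - (G i$1$1 * (?P * ?P * ?u)) + G i$1$2 * (1 - ?P * ?Q * ?u)"
        "complex_of_real (G (Suc i)$2$1) = G i$2$1 * (1 + ?P * ?Q * ?u) + G i$2$2 * (?Q * ?Q * ?u)"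
        "complex_of_real (G (Suc i)$2$2) = - (G i$2$1 * (?P * ?P * ?u)) + G i$2$2 * (1 - ?P * ?Q * ?u)"
        unfolding GS fin by (simp_all add: matrix_matrix_mult_def sum_2 a)
      from gauge_finite_node[OF detc u0 yy G'] show ?thesis
        unfolding al'_def be'_def nnS(1)[symmetric] nd(1,2) using i True
        by (simp add: pt_def qt_def)
    next
      case False
      then have cg: "cyc i = g" using cyc_le[of i] by simp
      let ?P = "complex_of_real (p g)" and ?Q = "complex_of_real (q g)"
      have nd: "be (nn j i) = ?P * Rep_ell2 x (nn j i)" "al (nn j i + 1) = Rep_ell2 x (nn j i)"
        "Rep_ell2 (A x) (nn j i) = ?P * al (nn j i) + ?Q * be (nn j i) + be (nn j i + 1)"
        using glob(2) nn_mod[of j i] cg by simp_all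
      have P0: "?P \<noteq> 0" using pg by simp
      have yy: "Rep_ell2 y (nn j i) = c k * Rep_ell2 x (nn j i)
          - (?P * al (nn j i) + ?Q * be (nn j i) + be (nn j i + 1))"
        by (simp add: y nd(3))
      have G': "complex_of_real (G (Suc i)$1$1) = G i$1$2 * (1 / ?P)"
        "complex_of_real (G (Suc i)$1$2) = - (G i$1$1 * ?P) + G i$1$2 * ((c k - ?P * ?Q) / ?P)"
        "complex_of_real (G (Suc i)$2$1) = G i$2$2 * (1 / ?P)"
        "complex_of_real (G (Suc i)$2$2) = - (G i$2$1 * ?P) + G i$2$2 * ((c k - ?P * ?Q) / ?P)"
        unfolding GS cg by (simp_all add: node_matrix_def matrix_matrix_mult_def sum_2 a_inf_entries)
      from gauge_infinite_node[OF detc P0 yy nd(1) G'] show ?thesis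
        unfolding al'_def be'_def nnS(1)[symmetric] nd(2) using i cg
        by (simp add: pt_def qt_def u_def)
    qed
    have last: "al (nn j g + 1) = al (nn j g) + q1 * Rep_ell2 x (nn j g)"
      "be (nn j g + 1) = be (nn j g) - p1 * Rep_ell2 x (nn j g)"
      "Rep_ell2 y (nn j g) = - (p1 * al (nn j g)) - q1 * be (nn j g)" for j
    proof -
      have k1: "nn j g mod int (g + 1) = int (k - 1) \<and> k - 1 < g" using nn_mod[of j g] cycg k by auto
      have "Suc (k - 1) = k" using k by simp
      with glob(1)[rule_format, OF k1]
      show "al (nn j g + 1) = al (nn j g) + q1 * Rep_ell2 x (nn j g)"
        "be (nn j g + 1) = be (nn j g) - p1 * Rep_ell2 x (nn j g)"
        "Rep_ell2 y (nn j g) = - (p1 * al (nn j g)) - q1 * be (nn j g)"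
        by (simp_all add: y p1_def q1_def)
    qed
    have stc: "complex_of_real s * q1 - complex_of_real t * p1 = 1"
      using arg_cong[OF st, of complex_of_real] by simp
    have Gendc: "complex_of_real (G g$1$1) * p1 + complex_of_real (G g$1$2) * q1 = 0"
      "complex_of_real (G g$2$1) * p1 + complex_of_real (G g$2$2) * q1 = - complex_of_real L"
      using arg_cong[OF Gend(1), of complex_of_real] arg_cong[OF Gend(2), of complex_of_real] by simp_all
    have Lc: "complex_of_real L \<noteq> 0" using L(1) by simp
    note fin = gauge_end_node[OF detc[of g] stc Lc Gendc]
    have yn: "Rep_ell2 ((inv shift_op ^^ k) y) (blk g j i) = Rep_ell2 y (nn j i)" for j i
      by (simp add: nn_def)
    have be'g: "be' j g = pt g * Rep_ell2 y (nn j g)" for j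
      unfolding be'_def last(3) using fin(1) by (simp add: pt_def)
    have al'0: "al' j 0 = Rep_ell2 y (nn (j - 1) g)" for j
    proof -
      have "al (nn j 0) = al (nn (j - 1) g) + q1 * Rep_ell2 x (nn (j - 1) g)"
        "be (nn j 0) = be (nn (j - 1) g) - p1 * Rep_ell2 x (nn (j - 1) g)"
        using last(1,2)[of "j - 1"] by (simp_all add: nnS(3))
      then show ?thesis unfolding al'_def last(3) G0 of_real_minus by algebra
    qed
    have out: "Rep_ell2 (A' ((inv shift_op ^^ k) y)) (blk g j i) = Rep_ell2 x (nn j i)" if "i \<le> g" for j i
    proof (cases "i = g")
      case True
      have "Rep_ell2 (A' ((inv shift_op ^^ k) y)) (blk g j g) =
          pt g * al' j g + qt g * be' j g + be' (j + 1) 0"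
        by (rule generated_by_states(2)[OF A']) (simp_all only: yn al'0 node be'g)
      also have "be' (j + 1) 0 = s * al (nn j g + 1) + t * be (nn j g + 1)"
        unfolding be'_def nnS(2) G0 by (simp add: mult.commute)
      also have "pt g * al' j g + qt g * be' j g + \<dots> = Rep_ell2 x (nn j g)"
        unfolding last(1,2) al'_def be'_def using fin(2) by (simp add: pt_def qt_def)
      finally show ?thesis using True by simp
    next
      case False
      then have i: "i < g" using that by simp
      have "Rep_ell2 (A' ((inv shift_op ^^ k) y)) (blk g j i) =
          ct (Suc i) * Rep_ell2 ((inv shift_op ^^ k) y) (blk g j i) + pt i * al' j i + qt i * be' j i"
        by (rule generated_by_states(1)[OF A', where be' = "be' (j + 1)"])
          (simp_all only: yn al'0 node be'g i)
      also have "\<dots> = Rep_ell2 x (nn j i)" unfolding yn using node[OF i, of j] by (simp add: ct_def)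
      finally show ?thesis .
    qed
    obtain j i where "i \<le> g" "n0 - int k = blk g j i" by (rule blk_cases)
    then show "Rep_ell2 (R (B x)) n0 = Rep_ell2 x n0"
      using out[of i j] unfolding R_def y_def[symmetric] by (simp add: nn_def flip: \<open>n0 - int k = _\<close>)
  qed
  have coA: "corner_op (int (g + 1)) (int g) A" by (rule generated_by_corner_op[OF A])
  have coA': "corner_op (int (g + 1)) (int g) A'" by (rule generated_by_corner_op[OF A'])
  have Be: "matrix_entry B m n = (if m = n then complex_of_real (c k) else 0) - matrix_entry A m n" for m n
    by (simp add: B_def shifted_minus_def matrix_entry_def)
  have Re: "matrix_entry R m n = matrix_entry A' (m - int k) (n - int k)" for m n
    by (simp add: R_def matrix_entry_def)
  have BR: "B (R x) = x" for x
  proof (rule symmetric_left_inverse[where w = "int (g + 1)", OF bB _ _ bR _ RB])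
    show "matrix_entry B m n = matrix_entry B n m" for m n
      using corner_opD(2)[OF coA, of m n] by (simp add: Be)
    show "matrix_entry B m n = 0" if "\<bar>m - n\<bar> > int (g + 1)" for m n
      using corner_opD(3)[OF coA that] that by (auto simp: Be)
    show "matrix_entry R m n = matrix_entry R n m" for m n
      unfolding Re by (rule corner_opD(2)[OF coA'])
  qed
  have invB: "boundedly_invertible B" "inv B = R"
    by (rule boundedly_invertibleI[OF bR RB BR])+
  show "boundedly_invertible (shifted_minus (c k) A)" using invB(1) by (simp add: B_def)
  have "unshift k R = A'"
  proof
    fix x
    have "(inv shift_op ^^ k) ((shift_op ^^ k) z) = z" for z by (rule ell2_eqI) simp
    then show "unshift k R x = A' x" by (simp add: unshift_def R_def)
  qed
  \<comment> \<open>The map x -> 1/(c_k - x) is injective and takes the value 0 only at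
    infinity.\<close>
  moreover have "inj_on ct {1..g}"
  proof (rule inj_onI)
    fix i j assume ij: "i \<in> {1..g}" "j \<in> {1..g}" "ct i = ct j"
    define i' j' where "i' = i - 1" and "j' = j - 1"
    have b: "i' < g" "j' < g" "u i' = u j'" using ij by (auto simp: i'_def j'_def ct_def)
    have u0: "u l = 0 \<longleftrightarrow> \<not> cyc l < g" if "l < g" for l using ck[OF that] by (auto simp: u_def)
    have "cyc i' = cyc j'"
    proof (cases "cyc i' < g")
      case True
      then have T: "cyc j' < g" using u0 b by metis
      have "c k - c (Suc (cyc i')) = c k - c (Suc (cyc j'))"
        using b(3) True T ck[OF b(1) True] ck[OF b(2) T] by (simp add: u_def)
      then show ?thesis using inj_onD[OF inj, of "Suc (cyc i')" "Suc (cyc j')"] True T by simp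
    next
      case False
      then have "\<not> cyc j' < g" using u0 b by metis
      then show ?thesis using False cyc_le[of i'] cyc_le[of j'] by simp
    qed
    then have "i' = j'" using cyc_inj[of i' j'] b by simp
    then show "i = j" using ij by (auto simp: i'_def j'_def)
  qed
  ultimately show "\<exists>c'. unshift k (inv (shifted_minus (c k) A)) \<in> class_A g c'"
    using A' invB(2) unfolding class_A_def B_def by auto
qed

section \<open>Uniqueness of \<open>\<Delta>\<^sub>E\<close> among functions with prescribed poles\<close>

text \<open>Since division by zero yields 0, the equation for P / Q alone does not exclude zeros of
  \<open>Q\<close> off the poles. At such a zero, continuity of the partial fraction in P = Q f
  would force \<open>P\<close> to vanish too, against coprimality.\<close>

lemma is_Delta_iff:
  fixes c l :: "nat \<Rightarrow> real"
  assumes Delta: "is_Delta E P Q"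
    and form: "\<And>z. z \<notin> complex_of_real ` c ` {1..g} \<Longrightarrow> poly P z / poly Q z = pf_value g l c z"
    and z: "z \<notin> complex_of_real ` c ` {1..g}"
  shows "z \<in> complex_of_real ` E \<longleftrightarrow> pf_value g l c z \<in> complex_of_real ` {-2..2}"
proof -
  have cop: "coprime P Q" and deg: "degree Q < degree P"
    and pre: "{z. poly Q z \<noteq> 0 \<and> poly P z / poly Q z \<in> complex_of_real ` {-2..2}} = complex_of_real ` E"
    using Delta by (auto simp: is_Delta_def)
  have Q0: "Q \<noteq> 0"
  proof
    assume "Q = 0"
    then have "is_unit P" using cop by simp
    then show False using deg by (auto simp: is_unit_poly_iff)
  qed
  have "poly Q z \<noteq> 0"
  proof
    assume Qz: "poly Q z = 0"
    then have Pz: "poly P z \<noteq> 0" using coprime_poly_0[OF cop] by auto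
    let ?S = "complex_of_real ` c ` {1..g} \<union> {x. poly Q x = 0}"
    have "finite ?S" using poly_roots_finite[OF Q0] by simp
    then have "\<forall>\<^sub>F x in at z. x \<notin> ?S"
      using islimpt_finite islimpt_iff_eventually by blast
    then have ev: "\<forall>\<^sub>F x in at z. poly P x - poly Q x * pf_value g l c x = 0"
    proof eventually_elim
      case (elim x)
      then show ?case using form[of x] by (auto simp: divide_simps)
    qed
    have "((\<lambda>x. poly P x - poly Q x * pf_value g l c x) \<longlongrightarrow>
        poly P z - poly Q z * pf_value g l c z) (at z)"
      unfolding pf_value_def using z
      by (intro tendsto_intros) auto
    moreover have "((\<lambda>x. poly P x - poly Q x * pf_value g l c x) \<longlongrightarrow> 0) (at z)"
      by (rule tendsto_eventually[OF ev])
    ultimately have "poly P z - poly Q z * pf_value g l c z = 0"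
      by (rule tendsto_unique[rotated]) simp
    then show False using Qz Pz by simp
  qed
  then show ?thesis unfolding pre[symmetric] mem_Collect_eq form[OF z] by simp
qed

section \<open>Real values near the poles, at infinity and at the edges of \<open>E\<close>\<close>

definition pf_real :: "nat \<Rightarrow> (nat \<Rightarrow> real) \<Rightarrow> real \<Rightarrow> (nat \<Rightarrow> real) \<Rightarrow> real \<Rightarrow> real" where
  "pf_real g l \<kappa> c x = l 0 * x + \<kappa> + (\<Sum>k=1..g. l k / (c k - x))"

lemma continuous_on_pf_real:
  "S \<inter> c ` {1..g} = {} \<Longrightarrow> continuous_on S (pf_real g l \<kappa> c)"
  unfolding pf_real_def by (intro continuous_intros) auto

lemma pf_real_near_pole:
  assumes k: "k \<in> {1..g}" and inj: "inj_on c {1..g}" and l: "l k > 0" and x: "x < c k"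
  shows "\<exists>t. x < t \<and> t < c k \<and> pf_real g l \<kappa> c t > 2"
proof -
  define h where "h x = l 0 * x + \<kappa> + (\<Sum>j\<in>{1..g} - {k}. l j / (c j - x))" for x
  have pf: "pf_real g l \<kappa> c x = h x + l k / (c k - x)" for x
  proof -
    have "(\<Sum>j=1..g. l j / (c j - x)) = l k / (c k - x) + (\<Sum>j\<in>{1..g} - {k}. l j / (c j - x))"
      by (rule sum.remove) (use k in auto)
    then show ?thesis by (simp add: pf_real_def h_def)
  qed
  have "\<And>j. j \<in> {1..g} - {k} \<Longrightarrow> c j - c k \<noteq> 0"
    using inj k by (auto dest: inj_onD)
  then have h: "(h \<longlongrightarrow> h (c k)) (at (c k))"
    unfolding h_def by (intro tendsto_intros) auto
  \<comment> \<open>Within \<open>\<epsilon>\<close> of the pole the singular term exceeds |h(c_k)|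
    + 3: this beats the regular part \<open>h\<close>, its variation by less than 1, and the target
    2.\<close>
  define \<epsilon> where "\<epsilon> = l k / (\<bar>h (c k)\<bar> + 4)"
  have \<epsilon>: "\<epsilon> > 0" using l by (simp add: \<epsilon>_def add_nonneg_pos)
  have big: "l k / d > \<bar>h (c k)\<bar> + 3" if "0 < d" "d < \<epsilon>" for d
  proof -
    have "d * (\<bar>h (c k)\<bar> + 4) < l k"
      using that(2) by (simp add: \<epsilon>_def pos_less_divide_eq add_nonneg_pos)
    then have "\<bar>h (c k)\<bar> + 4 < l k / d" using that(1) by (simp add: pos_less_divide_eq mult.commute)
    then show ?thesis by simp
  qed
  obtain \<delta> where \<delta>: "\<delta> > 0" "\<And>x. x \<noteq> c k \<Longrightarrow> \<bar>x - c k\<bar> < \<delta> \<Longrightarrow> \<bar>h x - h (c k)\<bar> < 1"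
    using tendstoD[OF h, of 1] unfolding eventually_at dist_real_def by auto
  define d where "d = min (min \<delta> \<epsilon>) (c k - x) / 2"
  have "0 < min (min \<delta> \<epsilon>) (c k - x)" using \<delta> \<epsilon> x by simp
  then have d: "0 < d" "d < \<delta>" "d < \<epsilon>" "d < c k - x"
    by (auto simp: d_def min_def split: if_splits)
  have "pf_real g l \<kappa> c (c k - d) > 2"
    using \<delta>(2)[of "c k - d"] big[OF d(1,3)] d by (simp add: pf)
  then show ?thesis using d by (intro exI[of _ "c k - d"]) simp
qed

lemma pf_real_at_infinity:
  assumes l: "l 0 > 0" "\<And>k. k \<in> {1..g} \<Longrightarrow> l k > 0"
    and c: "\<And>k. k \<in> {1..g} \<Longrightarrow> y < c k \<and> c k < x"
  shows "\<exists>t>x. pf_real g l \<kappa> c t > 2" and "\<exists>t<y. pf_real g l \<kappa> c t < - 2"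
proof -
  define m where "m = (\<Sum>k=1..g. l k)"
  have small: "\<bar>\<Sum>k=1..g. l k / (c k - t)\<bar> \<le> m" if "t \<ge> x + 1 \<or> t \<le> y - 1" for t
  proof -
    have "\<bar>\<Sum>k=1..g. l k / (c k - t)\<bar> \<le> (\<Sum>k=1..g. \<bar>l k / (c k - t)\<bar>)" by (rule sum_abs)
    also have "\<dots> \<le> m" unfolding m_def
    proof (rule sum_mono)
      fix k assume k: "k \<in> {1..g}"
      have "1 \<le> \<bar>c k - t\<bar>" using c[OF k] that by auto
      then have "\<bar>l k\<bar> / \<bar>c k - t\<bar> \<le> \<bar>l k\<bar> / 1" by (intro divide_left_mono) auto
      then show "\<bar>l k / (c k - t)\<bar> \<le> l k" using l(2)[OF k] by simp
    qed
    finally show ?thesis .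
  qed
  \<comment> \<open>At distance at least 1 from all poles the fractions add up to at most
    \<open>m\<close>, so the linear term decides; the thresholds make the value at least 3 or at
    most -3.\<close>
  define t1 where "t1 = max (x + 1) ((3 - \<kappa> + m) / l 0)"
  define t2 where "t2 = min (y - 1) ((- 3 - \<kappa> - m) / l 0)"
  have "(3 - \<kappa> + m) / l 0 \<le> t1" "t2 \<le> (- 3 - \<kappa> - m) / l 0"
    by (simp_all add: t1_def t2_def)
  then have "l 0 * t1 \<ge> 3 - \<kappa> + m" "l 0 * t2 \<le> - 3 - \<kappa> - m"
    using l(1) by (simp_all only: pos_divide_le_eq pos_le_divide_eq mult.commute)
  moreover have "\<bar>\<Sum>k=1..g. l k / (c k - t1)\<bar> \<le> m" "\<bar>\<Sum>k=1..g. l k / (c k - t2)\<bar> \<le> m"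
    by (rule small; simp add: t1_def t2_def)+
  ultimately have "pf_real g l \<kappa> c t1 > 2" "pf_real g l \<kappa> c t2 < - 2"
    unfolding pf_real_def by linarith+
  moreover have "t1 > x" "t2 < y" by (simp_all add: t1_def t2_def)
  ultimately show "\<exists>t>x. pf_real g l \<kappa> c t > 2" and "\<exists>t<y. pf_real g l \<kappa> c t < - 2" by blast+
qed

lemma gap_data_less:
  assumes "gap_data g a b" "j \<in> {1..g}"
  shows "a j < b j" "b 0 < a j" "b j < a 0"
proof -
  have lt: "a j < b j" and sub: "{a j..b j} \<subseteq> {b 0<..<a 0}"
    using assms by (auto simp: gap_data_def)
  have "a j \<in> {b 0<..<a 0}" "b j \<in> {b 0<..<a 0}" by (rule subsetD[OF sub]; use lt in simp)+
  with lt show "a j < b j" "b 0 < a j" "b j < a 0" by auto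
qed

lemma gap_data_ends:
  assumes "gap_data g a b"
  shows "b 0 < a 0"
proof -
  have "1 \<in> {1..g}" using assms by (simp add: gap_data_def)
  from gap_data_less[OF assms this] show ?thesis by linarith
qed

lemma gap_data_unique:
  "gap_data g a b \<Longrightarrow> i \<in> {1..g} \<Longrightarrow> j \<in> {1..g} \<Longrightarrow> x \<in> {a i..b i} \<Longrightarrow> x \<in> {a j..b j} \<Longrightarrow> i = j"
  unfolding gap_data_def disjoint_family_on_def by blast

lemma gap_points_inj:
  assumes gaps: "gap_data g a b" and c: "\<And>j. j \<in> {1..g} \<Longrightarrow> c j \<in> {a j<..<b j}"
  shows "inj_on c {1..g}"
proof (rule inj_onI)
  fix i j assume "i \<in> {1..g}" "j \<in> {1..g}" "c i = c j"
  then show "i = j" using gap_data_unique[OF gaps, of i j "c i"] c[of i] c[of j] by auto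
qed

text \<open>
  The edges of the gaps are the points where a function with preimage \<open>E\<close> of \<open>[-2, 2]\<close> leaves that
  interval; the direction is forced by the signs of the residues.
\<close>

lemma pf_real_edges:
  assumes gaps: "gap_data g a b" and E: "E = finite_gap_set g a b"
    and c: "\<And>j. j \<in> {1..g} \<Longrightarrow> c j \<in> {a j<..<b j}"
    and l: "\<And>j. j \<le> g \<Longrightarrow> l j > 0"
    and pre: "\<And>x. x \<notin> c ` {1..g} \<Longrightarrow> x \<in> E \<longleftrightarrow> pf_real g l \<kappa> c x \<in> {-2..2}"
  shows "j \<le> g \<Longrightarrow> pf_real g l \<kappa> c (a j) = 2" and "pf_real g l \<kappa> c (b 0) = - 2"
proof -
  let ?f = "pf_real g l \<kappa> c"
  note ab = gap_data_less[OF gaps] and dis = gap_data_unique[OF gaps]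
  have b0a0: "b 0 < a 0" by (rule gap_data_ends[OF gaps])
  have inj: "inj_on c {1..g}" by (rule gap_points_inj[OF gaps c])
  have edge: "a j \<in> E" "a j \<notin> c ` {1..g}" if "j \<le> g" for j
  proof -
    show "a j \<in> E"
    proof (cases "j = 0")
      case True
      then show ?thesis using b0a0 ab by (force simp: E finite_gap_set_def)
    next
      case False
      then have j: "j \<in> {1..g}" using that by simp
      have "a j \<notin> {a i<..<b i}" if "i \<in> {1..g}" for i
        using dis[OF that j, of "a j"] ab[OF j] by auto
      then show ?thesis using ab[OF j] by (auto simp: E finite_gap_set_def)
    qed
    show "a j \<notin> c ` {1..g}"
    proof
      assume "a j \<in> c ` {1..g}"
      then obtain i where i: "i \<in> {1..g}" "a j = c i" by auto
      then have "j \<in> {1..g}" using c[of i] ab[of i] that by (cases "j = 0") auto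
      then show False using dis[of i j "a j"] i c[of i] ab[of j] by auto
    qed
  qed
  have b0: "b 0 \<in> E" "b 0 \<notin> c ` {1..g}"
    using b0a0 ab c by (force simp: E finite_gap_set_def)+
  \<comment> \<open>A value below 2 at the edge would, by the intermediate value theorem, give the
    value 2 at a later point of the interval, which would then belong to \<open>E\<close>.\<close>
  have up: "?f x = 2" if h: "x \<in> E" "x \<notin> c ` {1..g}" "x < t" "?f t > 2" "{x..t} \<inter> c ` {1..g} = {}"
    "{x<..t} \<inter> E = {}" for x t
  proof (rule ccontr)
    assume "?f x \<noteq> 2"
    then have "?f x < 2" using pre[OF h(2)] h(1) by auto
    then obtain s where s: "x \<le> s" "s \<le> t" "?f s = 2"
      using IVT'[of ?f x 2 t] h continuous_on_pf_real[OF h(5)] by force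
    have "s \<in> {x..t}" using s by simp
    then have "s \<notin> c ` {1..g}" using h(5) by blast
    then have "s \<in> E" using pre[of s] s(3) by simp
    moreover have "s \<noteq> x" using s \<open>?f x \<noteq> 2\<close> by auto
    ultimately have "s \<in> {x<..t} \<inter> E" using s by simp
    then show False using h(6) by blast
  qed
  show "?f (a j) = 2" if jg: "j \<le> g"
  proof (cases "j = 0")
    case True
    have cc: "b 0 < c k \<and> c k < a 0" if "k \<in> {1..g}" for k
      using c[OF that] ab[OF that] by auto
    obtain t where t: "t > a 0" "?f t > 2"
      using pf_real_at_infinity(1)[of l g "b 0" c "a 0" \<kappa>] l cc by auto
    have "{a 0..t} \<inter> c ` {1..g} = {}" using cc by force
    moreover have "{a 0<..t} \<inter> E = {}" by (auto simp: E finite_gap_set_def)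
    ultimately show ?thesis using up[OF edge[OF le0] t] True by simp
  next
    case False
    then have j: "j \<in> {1..g}" using jg by simp
    have cj: "a j < c j" "c j < b j" using c[OF j] by auto
    \<comment> \<open>To the right of \<open>a j\<close> the gap leads up to its pole, which is
      approached from the left, where the positive residue sends the function to plus
      infinity.\<close>
    obtain t where t: "a j < t" "t < c j" "?f t > 2"
      using pf_real_near_pole[of j g c l "a j" \<kappa>] j inj l[OF jg] cj(1) by auto
    have "{a j..t} \<inter> c ` {1..g} = {}"
    proof -
      have "c i \<notin> {a j..t}" if "i \<in> {1..g}" for i
      proof
        assume "c i \<in> {a j..t}"
        then have "i = j" using dis[OF that j, of "c i"] c[OF that] t cj by auto
        then show False using \<open>c i \<in> {a j..t}\<close> t by auto
      qed
      then show ?thesis by auto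
    qed
    moreover have "{a j<..t} \<inter> E = {}"
      using t cj j by (auto simp: E finite_gap_set_def)
    ultimately show ?thesis using up[OF edge[OF jg] t(1,3)] by blast
  qed
  show "?f (b 0) = - 2"
  proof (rule ccontr)
    assume ne: "?f (b 0) \<noteq> - 2"
    then have gt: "?f (b 0) > - 2" using pre[OF b0(2)] b0(1) by auto
    have cc: "b 0 < c k \<and> c k < a 0" if "k \<in> {1..g}" for k
      using c[OF that] ab[OF that] by auto
    obtain t where t: "t < b 0" "?f t < - 2"
      using pf_real_at_infinity(2)[of l g "b 0" c "a 0" \<kappa>] l cc by auto
    have disj: "{t..b 0} \<inter> c ` {1..g} = {}" using cc by force
    obtain s where s: "t \<le> s" "s \<le> b 0" "?f s = - 2"
      using IVT'[of ?f t "- 2" "b 0"] t gt continuous_on_pf_real[OF disj] by force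
    have "s \<in> {t..b 0}" using s by simp
    then have "s \<notin> c ` {1..g}" using disj by blast
    then have "s \<in> E" using pre[of s] s(3) by simp
    then have "s = b 0" using s by (auto simp: E finite_gap_set_def)
    then show False using s ne by simp
  qed
qed

lemma pf_real_unique:
  assumes gaps: "gap_data g a b" and E: "E = finite_gap_set g a b"
    and c: "\<And>j. j \<in> {1..g} \<Longrightarrow> c j \<in> {a j<..<b j}"
    and l: "\<And>j. j \<le> g \<Longrightarrow> l j > 0" and l': "\<And>j. j \<le> g \<Longrightarrow> l' j > 0"
    and pre: "\<And>x. x \<notin> c ` {1..g} \<Longrightarrow> x \<in> E \<longleftrightarrow> pf_real g l \<kappa> c x \<in> {-2..2}"
    and pre': "\<And>x. x \<notin> c ` {1..g} \<Longrightarrow> x \<in> E \<longleftrightarrow> pf_real g l' \<kappa>' c x \<in> {-2..2}"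
  shows "\<kappa>' = \<kappa>" and "j \<le> g \<Longrightarrow> l' j = l j"
proof -
  note ab = gap_data_less[OF gaps] and dis = gap_data_unique[OF gaps]
  have b0a0: "b 0 < a 0" by (rule gap_data_ends[OF gaps])
  have inj: "inj_on c {1..g}" by (rule gap_points_inj[OF gaps c])
  \<comment> \<open>The right end \<open>a 0\<close>, the left edges of the g gaps and the left end
    \<open>b 0\<close>: g + 2 points off the poles with known values.\<close>
  let ?Z = "insert (b 0) (a ` {..g})"
  have b0a: "b 0 < a j" if "j \<le> g" for j using that ab b0a0 by (cases "j = 0") auto
  have inja: "inj_on a {..g}"
  proof (rule inj_onI)
    fix i j assume ij: "i \<in> {..g}" "j \<in> {..g}" "a i = a j"
    have lt: "a k < a 0" if "k \<in> {1..g}" for k using ab[OF that] by linarith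
    show "i = j"
    proof (cases "i = 0 \<or> j = 0")
      case True
      then show ?thesis using ij lt[of i] lt[of j] by (cases "i = 0"; cases "j = 0") auto
    next
      case False
      then show ?thesis using ij dis[of i j "a i"] ab[of i] ab[of j] by auto
    qed
  qed
  have "b 0 \<notin> a ` {..g}" using b0a by force
  then have cardZ: "g + 2 \<le> card ?Z" by (simp add: card_image[OF inja])
  have Zc: "?Z \<inter> c ` {1..g} = {}"
  proof -
    have "c i \<noteq> b 0" if "i \<in> {1..g}" for i using c[OF that] ab[OF that] by auto
    moreover have "c i \<noteq> a j" if "i \<in> {1..g}" "j \<le> g" for i j
    proof (cases "j = 0")
      case True
      then show ?thesis using c[OF that(1)] ab[OF that(1)] by auto
    next
      case False
      then have j: "j \<in> {1..g}" using that by simp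
      show ?thesis
      proof
        assume "c i = a j"
        then show False using dis[OF that(1) j, of "a j"] c[OF that(1)] ab[OF j] by auto
      qed
    qed
    ultimately show ?thesis by force
  qed
  have val: "pf_real g l' \<kappa>' c z = pf_real g l \<kappa> c z" if "z \<in> ?Z" for z
    using that pf_real_edges[OF gaps E c l pre] pf_real_edges[OF gaps E c l' pre'] by auto
  have eq: "(l' 0 - l 0) * z + (\<kappa>' - \<kappa>) + (\<Sum>k=1..g. (l' k - l k) / (c k - z)) = 0" if "z \<in> ?Z" for z
    using val[OF that] by (simp add: pf_real_def sum_subtractf diff_divide_distrib algebra_simps)
  have "\<kappa>' - \<kappa> = 0"
    by (rule partial_fraction_eq_0(1)[OF inj cardZ Zc, of "\<lambda>j. l' j - l j"]) (use eq in auto)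
  then show "\<kappa>' = \<kappa>" by simp
  have "(\<lambda>j. l' j - l j) j = 0" if "j \<le> g" for j
    by (rule partial_fraction_eq_0(2)[OF inj cardZ Zc _ that]) (use eq in auto)
  then show "l' j = l j" if "j \<le> g" using that by simp
qed

section \<open>Periodicity\<close>

lemma free_op_commutant_periodic:
  assumes A: "corner_op (int N) \<rho> A" and N: "N > 0" and comm: "\<And>x. A (free_op N x) = free_op N (A x)"
  shows "matrix_entry A (m + int N) (n + int N) = matrix_entry A m n"
proof -
  have e: "matrix_entry A m (n + int N) + matrix_entry A m (n - int N) =
      matrix_entry A (m - int N) n + matrix_entry A (m + int N) n" for m n
  proof -
    have "Rep_ell2 (A (free_op N (basis_vec n))) m = Rep_ell2 (free_op N (A (basis_vec n))) m"
      by (simp add: comm)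
    then show ?thesis
      by (simp add: free_op_def bounded_opD[OF corner_opD(1)[OF A]] matrix_entry_def)
  qed
  \<comment> \<open>In the entry (m, n + N) of the commutation relation, two of the four terms lie
    at distance at least 2N from the diagonal.\<close>
  have *: "matrix_entry A (m + int N) (n + int N) = matrix_entry A m n" if "m \<le> n" for m n
    using e[of m "n + int N"] corner_opD(3)[OF A, of m "n + int N + int N"]
      corner_opD(3)[OF A, of "m - int N" "n + int N"] that N by simp
  show ?thesis
  proof (cases "m \<le> n")
    case False
    then show ?thesis using *[of n m] corner_opD(2)[OF A] by simp
  qed (rule *)
qed

lemma generated_by_constant:
  assumes A: "generated_by g c p q A"
    and per: "\<And>m n. matrix_entry A (m + int (g + 1)) (n + int (g + 1)) = matrix_entry A m n"
  shows "generated_by g c (\<lambda>_. p 0) (\<lambda>_. q 0) A"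
proof -
  have step: "gmp_entry g c p q (i + 1) r (j + 1) s = gmp_entry g c p q i r j s"
    if "r \<le> g" "s \<le> g" for i j r s
    using per[of "blk g i r" "blk g j s"] that
    unfolding blk_add_period matrix_entry_blk[OF A that] by simp
  have p1: "p (j + 1) s = p j s" if "s \<le> g" for j s
    using step[of g s "j - 1" j] that by (simp add: gmp_entry_def A_block_def outer_def)
  \<comment> \<open>Row g of the diagonal block is \<open>p g\<close> times \<open>q\<close>, and
    \<open>p g\<close> is positive.\<close>
  have q1: "q (j + 1) s = q j s" if "s \<le> g" for j s
  proof -
    have "p j g > 0" using A by (simp add: generated_by_def)
    then show ?thesis
      using step[of g s j j] p1[of g j] that by (simp add: gmp_entry_def B_block_eq)
  qed
  have const: "f j = f 0" if "\<And>j. f (j + 1) = f j" for f :: "int \<Rightarrow> real" and j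
  proof (induction j rule: int_induct[where k = 0])
    case (step1 i)
    then show ?case using that[of i] by simp
  next
    case (step2 i)
    then show ?case using that[of "i - 1"] by simp
  qed simp
  have pc: "p j s = p 0 s" and qc: "q j s = q 0 s" if "s \<le> g" for j s
    using const[of "\<lambda>j. p j s"] const[of "\<lambda>j. q j s"] p1[OF that] q1[OF that] by auto
  have eq: "gmp_entry g c (\<lambda>_. p 0) (\<lambda>_. q 0) i r j s = gmp_entry g c p q i r j s"
    if "r \<le> g" "s \<le> g" for i j r s
    unfolding gmp_entry_def B_block_def A_block_def outer_def upper_part_def lower_part_def
      pc[OF that(1), of i] pc[OF that(1), of j] pc[OF that(2), of i] pc[OF that(2), of j]
      qc[OF that(1), of j] qc[OF that(2), of j] ..
  show ?thesis using A by (simp add: generated_by_def eq)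
qed

lemma magic_formula_periodic:
  assumes gmp: "A \<in> GMP g c" and magic: "pf_op g l c A = free_op (g + 1)"
  obtains p q where "generated_by g c (\<lambda>_. p) (\<lambda>_. q) A"
proof -
  obtain p q where gen: "generated_by g c p q A" using gmp by (auto simp: GMP_def class_A_def)
  have bA: "bounded_op A" using gen by (simp add: generated_by_def)
  have inv: "boundedly_invertible (shifted_minus (c k) A)" if "k \<in> {1..g}" for k
    using gmp that by (simp add: GMP_def)
  have "A (pf_op g l c A x) = pf_op g l c A (A x)" for x
  proof -
    have "A (inv (shifted_minus (c k) A) x) = inv (shifted_minus (c k) A) (A x)" if "k \<in> {1..g}" for k
      using shifted_minus_inv(2,3)[OF inv[OF that]] bA by simp
    then show ?thesis by (simp add: pf_op_def bounded_opD[OF bA])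
  qed
  then have comm: "A (free_op (g + 1) x) = free_op (g + 1) (A x)" for x unfolding magic .
  have "generated_by g c (\<lambda>_. p 0) (\<lambda>_. q 0) A"
    by (rule generated_by_constant[OF gen])
      (rule free_op_commutant_periodic[OF generated_by_corner_op[OF gen] _ comm], simp)
  then show ?thesis by (rule that)
qed

section \<open>The isospectral set and the equations of its surface\<close>

lemma pf_value_cong:
  assumes "\<And>j. j \<le> g \<Longrightarrow> l j = l' j" shows "pf_value g l c z = pf_value g l' c z"
  using assms by (auto simp: pf_value_def)

theorem proposition1p17:
  fixes g :: nat and a b l c :: "nat \<Rightarrow> real" and E :: "real set" and P Q :: "complex poly"
  assumes gaps: "gap_data g a b"
    and E: "E = finite_gap_set g a b"
    and Delta: "is_Delta E P Q"
    and form: "\<And>z. z \<notin> complex_of_real ` c ` {1..g} \<Longrightarrow> poly P z / poly Q z = pf_value g l c z"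
    and l_pos: "\<And>j. j \<le> g \<Longrightarrow> l j > 0"
    and c_gap: "\<And>j. j \<in> {1..g} \<Longrightarrow> c j \<in> {a j<..<b j}"
  shows "(\<forall>A\<in>GMP g c. A \<in> isospectral_set g E c \<longleftrightarrow>
            pf_op g l c A = (\<lambda>x. (shift_op ^^ (g + 1)) x + (inv shift_op ^^ (g + 1)) x))
    \<and> isospectral_surface g E c =
        {(p, q). p \<in> {..g} \<rightarrow>\<^sub>E UNIV \<and> q \<in> {..g} \<rightarrow>\<^sub>E UNIV \<and>
          p g = 1 / l 0 \<and>
          q g = - c 0 - l 0 * (\<Sum>j=0..<g. p j * q j) \<and>
          (\<forall>k\<in>{1..g}. Lam g c k p q = l k)}"
proof -
  have free: "(\<lambda>x. (shift_op ^^ (g + 1)) x + (inv shift_op ^^ (g + 1)) x) = free_op (g + 1)"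
    by (simp add: fun_eq_iff free_op_def)
  have spec_E: "{z. z \<notin> complex_of_real ` c ` {1..g} \<and>
      pf_value g l c z \<in> complex_of_real ` {-2..2}} = complex_of_real ` E"
  proof -
    \<comment> \<open>The poles lie inside the gaps.\<close>
    have "z \<notin> complex_of_real ` c ` {1..g}" if "z \<in> complex_of_real ` E" for z
      using that c_gap by (auto simp: E finite_gap_set_def)
    then show ?thesis using is_Delta_iff[OF Delta form] by blast
  qed
  have inj: "inj_on c {1..g}" by (rule gap_points_inj[OF gaps c_gap])
  have pre: "x \<in> E \<longleftrightarrow> pf_real g l (c 0) c x \<in> {-2..2}" if "x \<notin> c ` {1..g}" for x
  proof -
    have "complex_of_real x \<notin> complex_of_real ` c ` {1..g}" using that by auto
    from is_Delta_iff[OF Delta form this] pf_value_of_real[of g l c "c 0" x]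
    show ?thesis by (auto simp: pf_real_def simp del: of_real_add of_real_mult of_real_sum)
  qed
  \<comment> \<open>The spectrum determines f: the trace of the monodromy matrix and the given
    function have the same poles and the same preimage of [-2, 2], so their coefficients agree. Both
    claims of the theorem use this.\<close>
  have coeff: "pf_op g l c A = free_op (g + 1) \<and> gmp_const g p q = c 0 \<and>
      (\<forall>j\<le>g. gmp_coeff g c p q j = l j)"
    if A: "A \<in> isospectral_set g E c" and gen: "generated_by g c (\<lambda>_. p) (\<lambda>_. q) A" for A p q
  proof -
    have gmp: "A \<in> GMP g c" and spec: "spectrum A = complex_of_real ` E"
      using A by (auto simp: isospectral_set_def)
    note ml = periodic_gmp_magic_formula[OF gen gmp]
    have pre': "x \<in> E \<longleftrightarrow> pf_real g (gmp_coeff g c p q) (gmp_const g p q) c x \<in> {-2..2}"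
      if "x \<notin> c ` {1..g}" for x
    proof -
      have "x \<in> E \<longleftrightarrow> complex_of_real x \<in> spectrum A" unfolding spec by auto
      then show ?thesis
        unfolding ml(3) using that
        by (auto simp: pf_real_def pf_value_of_real simp del: of_real_add of_real_mult of_real_sum)
    qed
    have k: "gmp_const g p q = c 0"
      by (rule pf_real_unique(1)[OF gaps E c_gap l_pos _ pre pre']) (use ml(1) in auto)
    have l: "gmp_coeff g c p q j = l j" if "j \<le> g" for j
      by (rule pf_real_unique(2)[OF gaps E c_gap l_pos _ pre pre' that]) (use ml(1) in auto)
    have "pf_op g l c A = free_op (g + 1)"
      using ml(2) pf_op_cong[of g "gmp_coeff g c p q" l c A] l unfolding k by simp
    with k l show ?thesis by blast
  qed
  have spec: "spectrum A = complex_of_real ` E"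
    if gen: "generated_by g c (\<lambda>_. p) (\<lambda>_. q) A" and gmp: "A \<in> GMP g c"
      and k: "gmp_const g p q = c 0" and l: "\<And>j. j \<le> g \<Longrightarrow> gmp_coeff g c p q j = l j" for A p q
    using periodic_gmp_magic_formula(3)[OF gen gmp] pf_value_cong[of g "gmp_coeff g c p q" l c] l spec_E
    unfolding k by simp
  have part1: "A \<in> isospectral_set g E c \<longleftrightarrow> pf_op g l c A = free_op (g + 1)" if gmp: "A \<in> GMP g c" for A
  proof
    assume A: "A \<in> isospectral_set g E c"
    then obtain p q where "generated_by g c (\<lambda>_. p) (\<lambda>_. q) A" by (auto simp: isospectral_set_def)
    from coeff[OF A this] show "pf_op g l c A = free_op (g + 1)" by blast
  next
    assume magic: "pf_op g l c A = free_op (g + 1)"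
    obtain p q where gen: "generated_by g c (\<lambda>_. p) (\<lambda>_. q) A"
      using magic_formula_periodic[OF gmp magic] .
    have magic': "pf_op g l (c(0 := c 0)) A = free_op (g + 1)" using magic by simp
    have "spectrum A = complex_of_real ` E"
      by (rule spec[OF gen gmp]) (simp_all add: magic_formula_coefficients[OF gen gmp magic'])
    then show "A \<in> isospectral_set g E c" using gmp gen by (auto simp: isospectral_set_def)
  qed
  have part2: "(\<exists>A\<in>isospectral_set g E c. generated_by g c (\<lambda>_. p) (\<lambda>_. q) A) \<and> p g > 0 \<longleftrightarrow>
      p g = 1 / l 0 \<and> q g = - c 0 - l 0 * (\<Sum>j=0..<g. p j * q j) \<and> (\<forall>k\<in>{1..g}. Lam g c k p q = l k)"
    for p q
  proof
    assume "(\<exists>A\<in>isospectral_set g E c. generated_by g c (\<lambda>_. p) (\<lambda>_. q) A) \<and> p g > 0"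
    then obtain A where "A \<in> isospectral_set g E c" "generated_by g c (\<lambda>_. p) (\<lambda>_. q) A" by blast
    from coeff[OF this] have k: "gmp_const g p q = c 0" and l: "\<And>j. j \<le> g \<Longrightarrow> gmp_coeff g c p q j = l j"
      by auto
    have l0: "1 / p g = l 0" using l[of 0] by (simp add: gmp_coeff_def)
    have "p g = 1 / l 0" by (simp flip: l0)
    moreover have "q g = - c 0 - l 0 * (\<Sum>j=0..<g. p j * q j)"
      using k unfolding gmp_const_def l0 by linarith
    moreover have "Lam g c k p q = l k" if "k \<in> {1..g}" for k
      using l[of k] that by (simp add: gmp_coeff_def)
    ultimately show "p g = 1 / l 0 \<and> q g = - c 0 - l 0 * (\<Sum>j=0..<g. p j * q j) \<and>
        (\<forall>k\<in>{1..g}. Lam g c k p q = l k)" by blast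
  next
    assume eqs: "p g = 1 / l 0 \<and> q g = - c 0 - l 0 * (\<Sum>j=0..<g. p j * q j) \<and>
        (\<forall>k\<in>{1..g}. Lam g c k p q = l k)"
    \<comment> \<open>The equations do not mention the sign of \<open>p g\<close>; it comes from
      \<open>l 0\<close> being positive.\<close>
    have pg: "p g > 0" using eqs l_pos[of 0] by simp
    obtain A where gen: "generated_by g c (\<lambda>_. p) (\<lambda>_. q) A" using gmp_op_exists[of p g, OF pg] .
    have "A \<in> class_A g c" using gen inj by (auto simp: class_A_def)
    moreover have "boundedly_invertible (shifted_minus (c k) A) \<and>
        (\<exists>c'. unshift k (inv (shifted_minus (c k) A)) \<in> class_A g c')" if "k \<in> {1..g}" for k
      using periodic_resolvent[OF gen inj that] eqs l_pos[of k] that by simp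
    ultimately have gmp: "A \<in> GMP g c" by (simp add: GMP_def unshift_def)
    have "spectrum A = complex_of_real ` E"
    proof (rule spec[OF gen gmp])
      show "gmp_const g p q = c 0" using eqs by (simp add: gmp_const_def)
      show "gmp_coeff g c p q j = l j" if "j \<le> g" for j
        using eqs that by (cases "j = 0") (simp_all add: gmp_coeff_def)
    qed
    then have "A \<in> isospectral_set g E c" using gmp gen by (auto simp: isospectral_set_def)
    with gen pg show "(\<exists>A\<in>isospectral_set g E c. generated_by g c (\<lambda>_. p) (\<lambda>_. q) A) \<and> p g > 0"
      by blast
  qed
  show ?thesis
    unfolding free isospectral_surface_def using part1 part2 by blast
qed

end
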